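(* For every integer $n>0$ set $$k_s=\frac n2\left(1-\cos\frac{s}{\sqrt n}\right)\quad\text{for } s=0,1,\dots,\lfloor\pi\sqrt n\rfloor,$$ where $\lfloor\cdot\rfloor$ is integer part, and let $\mathfrak A=\mathfrak A_n$ be the partition of the set $\{0,1,\dots,n\}$ into the subsets $[k_s,k_{s+1})\cap\{0,1,\dots,n\}$, $s=0,1,\dots,\lfloor\pi\sqrt n\rfloor$ (where for $s=\lfloor\pi\sqrt n\rfloor$ one sets $k_{s+1}=+\infty$; empty subsets are disregarded). For $k\in\{0,1,\dots,n\}$ let $\mathfrak A(k)$ be the element of the partition containing $k$, and $|\mathfrak A(k)|$ its cardinality. Then there is a constant $C$ such that for all integers $n>0$ and all $k\in\{0,1,\dots,n\}$, $$\left|\,D^{\mathrm{binom}}_{n}(k)-\Bigl(\log_2|\mathfrak A(k)|-\mathit{KP}\bigl(k\mid n,\mathfrak A(k)\bigr)\Bigr)\right|\le C,$$ i.e. $D^{\mathrm{binom}}_{n}(k)=\log_2|\mathfrak A(k)|-\mathit{KP}(k\mid n,\mathfrak A(k))+O(1)$. (The constant may depend on the fixed choices of universal objects made in the definitions, but not on $n$, $k$.)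
   Context: Notation. $2^*$ is the set of all finite sequences of 0s and 1s. $N=\{0,1,2,\dots\}$, $N^*$ is the set of finite sequences of natural numbers, $\mathcal F(N)$ the set of finite subsets of $N$ (a finite subset is identified with the list of its elements in increasing order). $X=2^*\cup N^*\cup N\cup\mathcal F(N)$. A condition consisting of several objects (as in $\mathit{KP}(k\mid n,S)$ with $S\in\mathcal F(N)$) is regarded as a single element of $X$ via a fixed computable injective encoding. Prefix complexity. A description method is a partial computable function $B:2^*\times X\to X$. It is prefix if whenever $q\in2^*$ is a prefix of $q'\in2^*$ and $B(q,y)$ is defined, $B(q',y)$ is defined and $B(q',y)=B(q,y)$. For a description method $B$, $K_B(x\mid y)$ is the length of a shortest $q$ with $B(q,y)=x$ ($\infty$ if there is none). There is a prefix description method $A$ that is optimal: for every prefix description method $B$ there is a constant $C_B$ with $K_A(x\mid y)\le K_B(x\mid y)+C_B$ for all $x,y\in X$. Fix one such $A$; $\mathit{KP}(x\mid y):=K_A(x\mid y)$ is the prefix complexity of $x$ given $y$. Measures. For $p\in[0,1]$ and integer $n>0$, the binomial measure with parameters $(n,p)$ on $\{0,1,\dots,n\}$ is $P\{k\}=\binom nk p^k(1-p)^{n-k}$. Tests and deficiencies. A test (for binomial measures) is a function $T(k\mid P)$ with values in $\mathbb Z\cup\{+\infty\}$, where $P$ ranges over all binomial measures with parameters $(n,p)$, $n>0$, $p\in[0,1]$, and $k\in\{0,\dots,n\}$, such that: (1) $E\,2^{T(k\mid P)}\le1$, where $E$ is the mean under $P$ (terms with $P\{k\}=0$ contribute 0);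 (2) $T$ is lower semicomputable: there is an algorithm that, given $n$, $k$ and any oracle that for each $i\in N$ outputs a rational $a_i$ with $|a_i-p|\le2^{-i}$ (the sequence $a_i$ need not be computable), enumerates a nondecreasing sequence of integers $m_j$ with $\sup_j m_j=T(k\mid P)$, and it works correctly for every such oracle. There is a universal test $D(k\mid P)$: for every test $T$ there is a constant $C_T$ with $D(k\mid P)\ge T(k\mid P)-C_T$ for all $k,P$. Fix such a $D$. For $k\in\{0,\dots,n\}$, the binomiality deficiency is $D^{\mathrm{binom}}_{n}(k):=\inf D(k\mid P)$, the infimum being over the binomial measures $P$ with parameters $(n,p)$, $p\in[0,1]$. *)

theory Defs
  imports
    "HOL-Probability.Probability"
    "HOL-Library.Nat_Bijection"
    "HOL-Library.Sublist"
    "HOL-Library.Disjoint_Sets"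
begin

section \<open>Partial recursive functions with an oracle\<close>

text \<open>
  Partial recursive functions of one argument. Several arguments are packed with
  \<^const>\<open>prod_encode\<close>, so no arities are needed. \<open>Query\<close> asks the oracle, a total
  function on the natural numbers; with the constant oracle 0 one obtains exactly the
  ordinary partial recursive functions.
\<close>

datatype prog =
    Zero | Succ | Fst | Snd | Query
  | Tup prog prog | Comp prog prog | PrimRec prog prog | Mu prog

primrec run :: "(nat \<Rightarrow> nat) \<Rightarrow> prog \<Rightarrow> nat \<Rightarrow> nat option" where
  "run orc Zero = (\<lambda>x. Some 0)"
| "run orc Succ = (\<lambda>x. Some (Suc x))"
| "run orc Fst = (\<lambda>x. Some (fst (prod_decode x)))"
| "run orc Snd = (\<lambda>x. Some (snd (prod_decode x)))"
| "run orc Query = (\<lambda>x. Some (orc x))"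
| "run orc (Tup f g) =
     (\<lambda>x. Option.bind (run orc f x) (\<lambda>a. Option.bind (run orc g x) (\<lambda>b. Some (prod_encode (a, b)))))"
| "run orc (Comp f g) = (\<lambda>x. Option.bind (run orc g x) (run orc f))"
| "run orc (PrimRec f g) =
     (\<lambda>x. case prod_decode x of (a, n) \<Rightarrow>
        rec_nat (run orc f a)
          (\<lambda>m r. Option.bind r (\<lambda>b. run orc g (prod_encode (a, prod_encode (m, b))))) n)"
| "run orc (Mu f) =
     (\<lambda>x. if \<exists>n. run orc f (prod_encode (x, n)) = Some 0 \<and>
               (\<forall>m<n. run orc f (prod_encode (x, m)) \<noteq> None)
          then Some (LEAST n. run orc f (prod_encode (x, n)) = Some 0)
          else None)"


section \<open>Prefix complexity\<close>

text \<open>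
  Objects: binary strings, sequences of natural numbers and natural numbers. A finite set of
  natural numbers is identified with the increasing list of its elements.
\<close>

datatype obj = Bits "bool list" | Seq "nat list" | Num nat

definition set_obj :: "nat set \<Rightarrow> obj" where
  "set_obj S = Seq (sorted_list_of_set S)"

definition bits_code :: "bool list \<Rightarrow> nat" where
  "bits_code q = list_encode (map of_bool q)"

fun obj_code :: "obj \<Rightarrow> nat" where
  "obj_code (Bits q) = prod_encode (0, bits_code q)"
| "obj_code (Seq xs) = prod_encode (1, list_encode xs)"
| "obj_code (Num n) = prod_encode (2, n)"

definition pair_obj :: "obj \<Rightarrow> obj \<Rightarrow> obj" where
  "pair_obj x y = Num (prod_encode (obj_code x, obj_code y))"

definition description_method :: "(bool list \<Rightarrow> obj \<Rightarrow> obj option) \<Rightarrow> bool" where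
  "description_method B \<longleftrightarrow>
     (\<exists>e. \<forall>q y. run (\<lambda>_. 0) e (prod_encode (bits_code q, obj_code y)) = map_option obj_code (B q y))"

definition prefix_method :: "(bool list \<Rightarrow> obj \<Rightarrow> obj option) \<Rightarrow> bool" where
  "prefix_method B \<longleftrightarrow> description_method B \<and>
     (\<forall>q q' x y. prefix q q' \<longrightarrow> B q y = Some x \<longrightarrow> B q' y = Some x)"

text \<open>The infimum of the empty set is \<open>\<infinity>\<close> in \<^typ>\<open>enat\<close>.\<close>

definition complexity :: "(bool list \<Rightarrow> obj \<Rightarrow> obj option) \<Rightarrow> obj \<Rightarrow> obj \<Rightarrow> enat" where
  "complexity B x y = (INF q\<in>{q. B q y = Some x}. enat (length q))"

definition optimal_prefix_method :: "(bool list \<Rightarrow> obj \<Rightarrow> obj option) \<Rightarrow> bool" where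
  "optimal_prefix_method A \<longleftrightarrow> prefix_method A \<and>
     (\<forall>B. prefix_method B \<longrightarrow>
        (\<exists>C::nat. \<forall>x y. complexity A x y \<le> complexity B x y + enat C))"


section \<open>Tests for binomial measures\<close>

text \<open>
  The value of a test \<open>T\<close> at \<open>k\<close> and the binomial measure with parameters \<open>(n, p)\<close> is written
  \<open>T n p k\<close>. The measure is given by its parameters because \<^term>\<open>binomial_pmf n 0\<close>,
  being a distribution on all natural numbers, does not determine \<open>n\<close>. Only the values with
  \<open>n > 0\<close>, \<open>0 \<le> p \<le> 1\<close> and \<open>k \<le> n\<close> are relevant.
\<close>

definition rat_code :: "rat \<Rightarrow> nat" where
  "rat_code r = (case quotient_of r of (a, b) \<Rightarrow> prod_encode (int_encode a, nat b))"

definition lower_semicomputable :: "(nat \<Rightarrow> real \<Rightarrow> nat \<Rightarrow> ereal) \<Rightarrow> bool" where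
  "lower_semicomputable T \<longleftrightarrow>
     (\<exists>e. \<forall>n>0. \<forall>p\<in>{0..1}. \<forall>k\<le>n. \<forall>a :: nat \<Rightarrow> rat.
        (\<forall>i. \<bar>of_rat (a i) - p\<bar> \<le> 1 / 2 ^ i) \<longrightarrow>
        (\<exists>m :: nat \<Rightarrow> int. mono m \<and>
           (\<forall>j. run (\<lambda>i. rat_code (a i)) e (prod_encode (n, prod_encode (k, j)))
                  = Some (int_encode (m j))) \<and>
           (SUP j. ereal (of_int (m j))) = T n p k))"

definition pow2 :: "ereal \<Rightarrow> ennreal" where
  "pow2 x = (if x = \<infinity> then \<infinity> else if x = -\<infinity> then 0 else ennreal (2 powr real_of_ereal x))"

definition test :: "(nat \<Rightarrow> real \<Rightarrow> nat \<Rightarrow> ereal) \<Rightarrow> bool" where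
  "test T \<longleftrightarrow>
     (\<forall>n>0. \<forall>p\<in>{0..1}. \<forall>k\<le>n. T n p k = \<infinity> \<or> (\<exists>i::int. T n p k = ereal (of_int i))) \<and>
     (\<forall>n>0. \<forall>p\<in>{0..1}. (\<integral>\<^sup>+ k. pow2 (T n p k) \<partial>measure_pmf (binomial_pmf n p)) \<le> 1) \<and>
     lower_semicomputable T"

definition universal_test :: "(nat \<Rightarrow> real \<Rightarrow> nat \<Rightarrow> ereal) \<Rightarrow> bool" where
  "universal_test D \<longleftrightarrow> test D \<and>
     (\<forall>T. test T \<longrightarrow>
        (\<exists>C::real. \<forall>n>0. \<forall>p\<in>{0..1}. \<forall>k\<le>n. D n p k \<ge> T n p k - ereal C))"

definition binom_deficiency :: "(nat \<Rightarrow> real \<Rightarrow> nat \<Rightarrow> ereal) \<Rightarrow> nat \<Rightarrow> nat \<Rightarrow> ereal" where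
  "binom_deficiency D n k = (INF p\<in>{0..1}. D n p k)"


section \<open>The partition\<close>

definition knot :: "nat \<Rightarrow> nat \<Rightarrow> real" where
  "knot n s = real n / 2 * (1 - cos (real s / sqrt (real n)))"

definition last_index :: "nat \<Rightarrow> nat" where
  "last_index n = nat \<lfloor>pi * sqrt (real n)\<rfloor>"

text \<open>The interval with the last index is unbounded to the right.\<close>

definition block :: "nat \<Rightarrow> nat \<Rightarrow> nat set" where
  "block n s = {k \<in> {0..n}. knot n s \<le> real k \<and> (s < last_index n \<longrightarrow> real k < knot n (Suc s))}"

definition blocks :: "nat \<Rightarrow> nat set set" where
  "blocks n = block n ` {0..last_index n} - {{}}"

definition cell :: "nat \<Rightarrow> nat \<Rightarrow> nat set" where
  "cell n k = (THE S. S \<in> blocks n \<and> k \<in> S)"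

lemma last_index_angle:
  assumes "n > 0" "s \<le> last_index n"
  shows "real s / sqrt (real n) \<le> pi"
proof -
  have "real s \<le> of_int \<lfloor>pi * sqrt (real n)\<rfloor>"
    using assms(2) unfolding last_index_def by (simp add: le_nat_iff)
  then have "real s \<le> pi * sqrt (real n)"
    by linarith
  then show ?thesis
    using assms(1) by (simp add: divide_le_eq)
qed

lemma knot_mono:
  assumes "n > 0" "s \<le> t" "t \<le> last_index n"
  shows "knot n s \<le> knot n t"
proof -
  have "cos (real t / sqrt (real n)) \<le> cos (real s / sqrt (real n))"
    using assms last_index_angle[OF assms(1,3)]
    by (intro cos_monotone_0_pi_le) (auto intro: divide_right_mono)
  then show ?thesis
    unfolding knot_def by (intro mult_left_mono) auto
qed

lemma partition_blocks:
  assumes n: "n > 0"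
  shows "partition_on {0..n} (blocks n)"
proof (rule partition_onI)
  have "\<exists>s\<le>last_index n. k \<in> block n s" if k: "k \<le> n" for k
  proof -
    define M where "M = {s. s \<le> last_index n \<and> knot n s \<le> real k}"
    have fin: "finite M" and ne: "0 \<in> M"
      by (auto simp: M_def knot_def)
    define s where "s = Max M"
    have "s \<in> M"
      unfolding s_def using fin ne by (intro Max_in) auto
    then have s: "s \<le> last_index n \<and> knot n s \<le> real k"
      by (simp add: M_def)
    moreover have "real k < knot n (Suc s)" if "s < last_index n"
    proof (rule ccontr)
      assume "\<not> real k < knot n (Suc s)"
      with that have "Suc s \<in> M"
        by (simp add: M_def)
      then have "Suc s \<le> s"
        unfolding s_def using fin by (intro Max_ge)
      then show False by simp
    qed
    ultimately have "k \<in> block n s"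
      using k by (simp add: block_def)
    with s show ?thesis by blast
  qed
  note ex = this
  have "{0..n} \<subseteq> \<Union> (blocks n)"
  proof
    fix k assume "k \<in> {0..n}"
    then have "k \<le> n" by simp
    from ex[OF this] obtain s where s: "s \<le> last_index n" "k \<in> block n s"
      by blast
    then have "block n s \<in> blocks n"
      by (auto simp: blocks_def)
    with s(2) show "k \<in> \<Union> (blocks n)"
      by (rule UnionI[rotated])
  qed
  moreover have "\<Union> (blocks n) \<subseteq> {0..n}"
    by (auto simp: blocks_def block_def)
  ultimately show "\<Union> (blocks n) = {0..n}"
    by (intro subset_antisym)
next
  have *: "disjnt (block n s) (block n t)" if "s < t" "t \<le> last_index n" for s t
    using that knot_mono[OF n, of "Suc s" t] by (fastforce simp: disjnt_def block_def)
  fix S T assume ST: "S \<in> blocks n" "T \<in> blocks n" "S \<noteq> T"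
  from ST(1) obtain s where s: "S = block n s" "s \<le> last_index n"
    unfolding blocks_def by fastforce
  from ST(2) obtain t where t: "T = block n t" "t \<le> last_index n"
    unfolding blocks_def by fastforce
  note st = s(1) t(1) s(2) t(2)
  have "s < t \<or> t < s"
    using ST(3) unfolding st(1,2) by (cases "s = t") auto
  then show "disjnt S T"
  proof
    assume "s < t"
    from *[OF this st(4)] show ?thesis
      by (simp only: st)
  next
    assume "t < s"
    from *[OF this st(3)] show ?thesis
      by (simp only: st disjnt_def Int_commute)
  qed
qed (auto simp: blocks_def)

lemma cell:
  assumes "n > 0" "k \<le> n"
  shows "cell n k \<in> blocks n" "k \<in> cell n k"
proof -
  note P = partition_blocks[OF assms(1)]
  have "k \<in> \<Union> (blocks n)"
    using partition_onD1[OF P] assms(2) by auto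
  then obtain S where S: "S \<in> blocks n" "k \<in> S"
    by blast
  have "T = S" if "T \<in> blocks n" "k \<in> T" for T
    using disjointD[OF partition_onD2[OF P] that(1) S(1)] that(2) S(2) by blast
  with S have "\<exists>!S. S \<in> blocks n \<and> k \<in> S"
    by blast
  from theI'[OF this] show "cell n k \<in> blocks n" "k \<in> cell n k"
    unfolding cell_def by auto
qed

end

theory Submission
  imports Defs
begin

text \<open>
  The angle \<open>\<theta>\<close> with \<open>p = (1 - cos \<theta>) / 2\<close> is the variance-stabilizing parameter of the binomial
  family: the partition cuts the range of \<open>k\<close> into pieces of length \<open>1 / sqrt n\<close> in the angle, and each
  piece is about as long as the standard deviation of the binomial measures centred in it. This gives
  the two facts that carry the proof. First, if \<open>p = a / n\<close> with \<open>a\<close> in a cell \<open>S\<close>, the measure gives every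
  point of \<open>S\<close> probability at least a constant times \<open>1 / |S|\<close> (\<open>bin_block_ge\<close>). Second, for an arbitrary
  \<open>p\<close> with angle \<open>\<theta>\<close> the quantity \<open>|S|\<close> times the greatest probability of a point of \<open>S\<close> decays at least
  quadratically in the distance, counted in cells, from \<open>\<theta>\<close> to \<open>S\<close> (\<open>card_bin_le\<close>), so that its sum over
  all cells is bounded.

  Lower bound on the deficiency (\<open>deficiency_lower_bound\<close>). Put \<open>2 ^ T(k)\<close> equal to the greatest value
  of \<open>|S| 2 ^ (- |q|)\<close> over the programs \<open>q\<close> that print \<open>k\<close> given \<open>n\<close> and \<open>S\<close>, where \<open>S\<close> is a set containing \<open>k\<close>. By Kraft's
  inequality a fixed \<open>S\<close> contributes at most \<open>|S|\<close> times the greatest probability of its points to the mean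
  of \<open>2 ^ T\<close>, so by the second fact \<open>T\<close> is a test up to a constant, if \<open>S\<close> ranges over the cells. Deciding
  whether an integer lies below a knot would require deciding equalities between cosines and rational
  numbers. Therefore \<open>S\<close> ranges over candidate intervals whose ends are within a constant of the knots; this
  is decidable, every cell is a candidate, and the number of candidates per knot is bounded. \<open>T\<close> does
  not depend on \<open>p\<close>, so the universal test exceeds it, up to a constant, uniformly in \<open>p\<close>.

  Upper bound (\<open>deficiency_upper_bound\<close>). Take \<open>p = a / n\<close> where \<open>a\<close> is the least element of the cell.
  This number is computable from the condition, so the oracle for \<open>p\<close> can be compiled away and \<open>D(k | P)\<close> is
  enumerated from below by an ordinary program. By the first fact, \<open>2 ^ D(k | P) / |S|\<close> is, up to a
  constant factor, a semimeasure on \<open>S\<close>. Allotting to each newly enumerated value a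
  dyadic share of the unit interval and coding it by a dyadic interval inside its share yields a prefix method
  in which \<open>k\<close> has a program of length \<open>log |S| - D(k | P) + O(1)\<close>.

  Computability is reduced to closure properties of total functions. A given prefix method enters
  through its approximation in stages (\<open>approximation_in_stages\<close>), a given test through the elimination of
  its oracle (\<open>oracle_elimination\<close>), and the prefix method constructed from a test is a single unbounded
  search with a decidable matrix.
\<close>

section \<open>Total computable functions\<close>

text \<open>
  Quantifying over the oracle makes the notion independent of it: such a function may be used both
  by a prefix method, which has the trivial oracle, and by a test, which has an arbitrary one.
\<close>

definition computable :: "(nat \<Rightarrow> nat) \<Rightarrow> bool" where
  "computable f \<longleftrightarrow> (\<exists>e. \<forall>orc x. run orc e x = Some (f x))"

definition pfst :: "nat \<Rightarrow> nat" where "pfst x = fst (prod_decode x)"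
definition psnd :: "nat \<Rightarrow> nat" where "psnd x = snd (prod_decode x)"

lemma pfst_prod_encode [simp]: "pfst (prod_encode (a, b)) = a"
  and psnd_prod_encode [simp]: "psnd (prod_encode (a, b)) = b"
  by (simp_all add: pfst_def psnd_def)

lemma prod_encode_pfst_psnd [simp]: "prod_encode (pfst x, psnd x) = x"
  by (simp add: pfst_def psnd_def)

named_theorems computable_intros

lemma computable_comp:
  assumes "computable g" "computable f"
  shows "computable (\<lambda>x. g (f x))"
proof -
  from assms obtain a b where "\<forall>orc x. run orc a x = Some (g x)" "\<forall>orc x. run orc b x = Some (f x)"
    unfolding computable_def by blast
  then have "\<forall>orc x. run orc (Comp a b) x = Some (g (f x))" by simp
  then show ?thesis unfolding computable_def by blast
qed

lemma computable_Suc_raw: "computable Suc"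
  unfolding computable_def by (rule exI[of _ Succ]) simp

lemma computable_pfst_raw: "computable pfst"
  unfolding computable_def by (rule exI[of _ Fst]) (simp add: pfst_def)

lemma computable_psnd_raw: "computable psnd"
  unfolding computable_def by (rule exI[of _ Snd]) (simp add: psnd_def)

lemma computable_id [computable_intros]: "computable (\<lambda>x. x)"
proof -
  have "\<forall>orc x. run orc (Tup Fst Snd) x = Some x" by simp
  then show ?thesis unfolding computable_def by blast
qed

lemma computable_Suc [computable_intros]: "computable f \<Longrightarrow> computable (\<lambda>x. Suc (f x))"
  by (rule computable_comp[OF computable_Suc_raw])

lemma computable_pfst [computable_intros]: "computable f \<Longrightarrow> computable (\<lambda>x. pfst (f x))"
  by (rule computable_comp[OF computable_pfst_raw])

lemma computable_psnd [computable_intros]: "computable f \<Longrightarrow> computable (\<lambda>x. psnd (f x))"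
  by (rule computable_comp[OF computable_psnd_raw])

lemma computable_const [computable_intros]: "computable (\<lambda>x. c)"
proof (induction c)
  case 0
  show ?case unfolding computable_def by (rule exI[of _ Zero]) simp
qed (rule computable_Suc)

lemma computable_pair [computable_intros]:
  assumes "computable f" "computable g"
  shows "computable (\<lambda>x. prod_encode (f x, g x))"
proof -
  from assms obtain a b where "\<forall>orc x. run orc a x = Some (f x)" "\<forall>orc x. run orc b x = Some (g x)"
    unfolding computable_def by blast
  then have "\<forall>orc x. run orc (Tup a b) x = Some (prod_encode (f x, g x))" by simp
  then show ?thesis unfolding computable_def by blast
qed

lemma computable_rec [computable_intros]:
  assumes f: "computable f"
    and g: "computable (\<lambda>w. g (pfst w) (pfst (psnd w)) (psnd (psnd w)))"
    and n: "computable n"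
  shows "computable (\<lambda>x. rec_nat (f x) (\<lambda>m r. g x m r) (n x))"
proof -
  obtain a where a: "\<And>orc x. run orc a x = Some (f x)" using f unfolding computable_def by blast
  obtain b where b: "\<And>orc x. run orc b x = Some (g (pfst x) (pfst (psnd x)) (psnd (psnd x)))"
    using g unfolding computable_def by blast
  have *: "run orc (PrimRec a b) (prod_encode (x, m)) = Some (rec_nat (f x) (\<lambda>m r. g x m r) m)" for orc x m
    by (induction m) (simp_all add: a b)
  then have "\<forall>orc x. run orc (PrimRec a b) x = Some ((\<lambda>w. rec_nat (f (pfst w)) (\<lambda>m r. g (pfst w) m r) (psnd w)) x)"
    by (metis prod_encode_pfst_psnd)
  then have "computable (\<lambda>w. rec_nat (f (pfst w)) (\<lambda>m r. g (pfst w) m r) (psnd w))"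
    unfolding computable_def by blast
  from computable_comp[OF this computable_pair[OF computable_id n]] show ?thesis by simp
qed

text \<open>
  Rules about binders state computability of a body of two arguments on packed pairs; this rule
  applies such a hypothesis to arbitrary arguments.
\<close>

lemma computable_comp2:
  assumes "computable (\<lambda>w. h (pfst w) (psnd w))" "computable f" "computable g"
  shows "computable (\<lambda>x. h (f x) (g x))"
  using computable_comp[OF assms(1) computable_pair[OF assms(2,3)]] by simp

text \<open>
  Each arithmetic operation is rewritten as a primitive recursion, so that
  \<open>computable_rec\<close> is the only rule of recursion that has to be justified by a program.
\<close>

lemma rec_nat_add: "a + n = rec_nat a (\<lambda>_ r. Suc r) n"
  by (induction n) simp_all

lemma rec_nat_pred: "n - 1 = rec_nat 0 (\<lambda>m _. m) (n::nat)"
  by (cases n) simp_all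

lemma rec_nat_diff: "a - n = rec_nat a (\<lambda>_ r. r - 1) (n::nat)"
  by (induction n) simp_all

lemma rec_nat_mult: "a * n = rec_nat 0 (\<lambda>_ r. r + a) (n::nat)"
  by (induction n) simp_all

lemma rec_nat_power: "a ^ n = rec_nat 1 (\<lambda>_ r. r * a) (n::nat)" for a :: nat
  by (induction n) simp_all

lemma rec_nat_fact: "fact n = (rec_nat 1 (\<lambda>m r. Suc m * r) n :: nat)"
  by (induction n) simp_all

lemma rec_nat_if: "(if b then u else v) = rec_nat v (\<lambda>_ _. u) (of_bool b)" for u v :: nat
  by simp

lemma rec_nat_sum: "(\<Sum>i<n. g i) = rec_nat 0 (\<lambda>m r. r + g m) n" for g :: "nat \<Rightarrow> nat"
  by (induction n) simp_all

lemma computable_add [computable_intros]: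
  "computable f \<Longrightarrow> computable g \<Longrightarrow> computable (\<lambda>x. f x + g x)"
  unfolding rec_nat_add by (intro computable_intros)

lemma computable_pred:
  "computable f \<Longrightarrow> computable (\<lambda>x. f x - 1)"
  unfolding rec_nat_pred by (intro computable_intros)

lemma computable_diff [computable_intros]:
  "computable f \<Longrightarrow> computable g \<Longrightarrow> computable (\<lambda>x. f x - g x)"
  unfolding rec_nat_diff[of "f _"] by (intro computable_intros computable_pred)

lemma computable_mult [computable_intros]:
  assumes f: "computable f" and g: "computable g"
  shows "computable (\<lambda>x. f x * g x)"
  unfolding rec_nat_mult by (intro computable_intros f g computable_comp[OF f] computable_comp[OF g])

lemma computable_power [computable_intros]:
  assumes f: "computable f" and g: "computable g"
  shows "computable (\<lambda>x. f x ^ g x)"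
  unfolding rec_nat_power by (intro computable_intros f g computable_comp[OF f] computable_comp[OF g])

lemma computable_fact [computable_intros]:
  "computable f \<Longrightarrow> computable (\<lambda>x. fact (f x))"
  unfolding rec_nat_fact by (intro computable_intros)

lemma computable_if [computable_intros]:
  assumes P: "computable (\<lambda>x. of_bool (P x))" and f: "computable f" and g: "computable g"
  shows "computable (\<lambda>x. if P x then f x else g x)"
  unfolding rec_nat_if by (intro computable_intros P g computable_comp[OF f])

lemma computable_sum [computable_intros]:
  assumes g: "computable (\<lambda>w. g (pfst w) (psnd w))" and f: "computable f"
  shows "computable (\<lambda>x. \<Sum>i<f x. g x i)"
  unfolding rec_nat_sum by (intro computable_intros f computable_comp2[OF g])

lemma of_bool_not: "of_bool (\<not> b) = 1 - (of_bool b :: nat)"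
  by simp

lemma computable_not [computable_intros]:
  "computable (\<lambda>x. of_bool (P x)) \<Longrightarrow> computable (\<lambda>x. of_bool (\<not> P x))"
  unfolding of_bool_not by (intro computable_intros)

lemma computable_conj [computable_intros]:
  "computable (\<lambda>x. of_bool (P x)) \<Longrightarrow> computable (\<lambda>x. of_bool (Q x)) \<Longrightarrow>
    computable (\<lambda>x. of_bool (P x \<and> Q x))"
  unfolding of_bool_conj by (intro computable_intros)

lemma computable_disj [computable_intros]:
  assumes "computable (\<lambda>x. of_bool (P x))" "computable (\<lambda>x. of_bool (Q x))"
  shows "computable (\<lambda>x. of_bool (P x \<or> Q x))"
proof -
  have "computable (\<lambda>x. of_bool (\<not> (\<not> P x \<and> \<not> Q x)))"
    using assms by (intro computable_intros)
  then show ?thesis by simp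
qed

lemma of_bool_le: "of_bool (a \<le> b) = 1 - (a - (b::nat))"
  by simp

lemma computable_le [computable_intros]:
  "computable f \<Longrightarrow> computable g \<Longrightarrow> computable (\<lambda>x. of_bool (f x \<le> g x))"
  unfolding of_bool_le by (intro computable_intros)

lemma computable_less [computable_intros]:
  "computable f \<Longrightarrow> computable g \<Longrightarrow> computable (\<lambda>x. of_bool (f x < g x))"
  unfolding Suc_le_eq[symmetric] by (intro computable_intros)

lemma computable_eq [computable_intros]:
  "computable f \<Longrightarrow> computable g \<Longrightarrow> computable (\<lambda>x. of_bool (f x = g x))"
  unfolding eq_iff by (intro computable_intros)

lemma computable_all [computable_intros]:
  assumes "computable (\<lambda>w. of_bool (P (pfst w) (psnd w)))" "computable f"
  shows "computable (\<lambda>x. of_bool (\<forall>i<f x. P x i))"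
proof -
  have "computable (\<lambda>x. of_bool ((\<Sum>i<f x. of_bool (\<not> P x i)) = (0::nat)))"
    using assms by (intro computable_intros)
  moreover have "((\<Sum>i<f x. of_bool (\<not> P x i)) = (0::nat)) \<longleftrightarrow> (\<forall>i<f x. P x i)" for x
    by auto
  ultimately show ?thesis by simp
qed

lemma rec_nat_div: "m div d = rec_nat 0 (\<lambda>m r. if Suc r * d = Suc m then Suc r else r) (m::nat)"
proof (induction m)
  case (Suc m)
  have "Suc (m div d) * d = Suc m \<longleftrightarrow> Suc m mod d = 0"
  proof
    assume *: "Suc (m div d) * d = Suc m"
    show "Suc m mod d = 0" unfolding *[symmetric] by simp
  next
    assume *: "Suc m mod d = 0"
    then have "Suc m div d = Suc (m div d)" by (simp add: div_Suc)
    with * show "Suc (m div d) * d = Suc m" by (metis add.right_neutral div_mult_mod_eq)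
  qed
  then have "Suc m div d = (if Suc (m div d) * d = Suc m then Suc (m div d) else m div d)"
    by (simp only: div_Suc)
  then show ?case by (simp only: nat.rec(2) Suc.IH)
qed simp

lemma computable_div [computable_intros]:
  assumes f: "computable f" and g: "computable g"
  shows "computable (\<lambda>x. f x div g x)"
  unfolding rec_nat_div[of "f _"] by (intro computable_intros f g computable_comp[OF f] computable_comp[OF g])

lemma computable_mod [computable_intros]:
  "computable f \<Longrightarrow> computable g \<Longrightarrow> computable (\<lambda>x. f x mod g x)"
  unfolding modulo_nat_def by (intro computable_intros)

lemma computable_dvd [computable_intros]:
  "computable f \<Longrightarrow> computable g \<Longrightarrow> computable (\<lambda>x. of_bool (f x dvd g x))"
  unfolding dvd_eq_mod_eq_0 by (intro computable_intros)


lemma rec_nat_greatest: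
  "rec_nat 0 (\<lambda>m r. if P (Suc m) then Suc m else r) n = (if \<exists>d. 0 < d \<and> d \<le> n \<and> P d then Max {d. 0 < d \<and> d \<le> n \<and> P d} else 0)"
proof (induction n)
  case (Suc n)
  show ?case
  proof (cases "P (Suc n)")
    case True
    have "Max {d. 0 < d \<and> d \<le> Suc n \<and> P d} = Suc n"
      using True by (intro Max_eqI) (auto intro: finite_subset[of _ "{..Suc n}"])
    with True show ?thesis by auto
  next
    case False
    then have *: "(0 < d \<and> d \<le> Suc n \<and> P d) = (0 < d \<and> d \<le> n \<and> P d)" for d
      by (auto simp: le_Suc_eq)
    show ?thesis by (simp only: nat.rec(2) False if_False Suc.IH *)
  qed
qed auto

text \<open>
  The greatest common divisor is needed because rational numbers are coded in lowest terms.
\<close>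

lemma rec_nat_gcd:
  assumes "0 < n"
  shows "gcd k n = rec_nat 0 (\<lambda>m r. if Suc m dvd k \<and> Suc m dvd n then Suc m else r) n"
proof -
  have "rec_nat 0 (\<lambda>m r. if Suc m dvd k \<and> Suc m dvd n then Suc m else r) n
      = Max {d. 0 < d \<and> d \<le> n \<and> (d dvd k \<and> d dvd n)}"
    using assms by (subst rec_nat_greatest) (auto intro!: exI[of _ "Suc 0"])
  also have "\<dots> = gcd k n"
    using assms by (intro Max_eqI) (auto intro: finite_subset[of _ "{..n}"] dvd_imp_le gcd_le2_nat)
  finally show ?thesis by simp
qed

section \<open>Oracles and approximation in stages\<close>

text \<open>
  An oracle that answers every query by the same number, computed from a context \<open>c\<close>, can be
  replaced by a program. The context is threaded through all constructors, so the parameter part of the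
  argument of a recursion or of a search becomes a pair.
\<close>

lemma oracle_elimination:
  assumes g: "computable g"
  shows "\<exists>e'. \<forall>orc c x. run orc e' (prod_encode (c, x)) = run (\<lambda>_. g c) e x"
proof (induction e)
  case Zero
  show ?case by (rule exI[of _ Zero]) simp
next
  case Succ
  show ?case by (rule exI[of _ "Comp Succ Snd"]) simp
next
  case Fst
  show ?case by (rule exI[of _ "Comp Fst Snd"]) simp
next
  case Snd
  show ?case by (rule exI[of _ "Comp Snd Snd"]) simp
next
  case Query
  obtain a where "\<forall>orc x. run orc a x = Some (g x)" using g unfolding computable_def by blast
  then show ?case by (intro exI[of _ "Comp a Fst"]) simp
next
  case (Tup e1 e2)
  then obtain a b where "\<And>orc c x. run orc a (prod_encode (c, x)) = run (\<lambda>_. g c) e1 x"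
    "\<And>orc c x. run orc b (prod_encode (c, x)) = run (\<lambda>_. g c) e2 x" by blast
  then show ?case by (intro exI[of _ "Tup a b"]) simp
next
  case (Comp e1 e2)
  then obtain a b where ab: "\<And>orc c x. run orc a (prod_encode (c, x)) = run (\<lambda>_. g c) e1 x"
    "\<And>orc c x. run orc b (prod_encode (c, x)) = run (\<lambda>_. g c) e2 x" by blast
  have "run orc (Comp a (Tup Fst b)) (prod_encode (c, x)) = run (\<lambda>_. g c) (Comp e1 e2) x" for orc c x
    by (cases "run (\<lambda>_. g c) e2 x") (simp_all add: ab)
  then show ?case by blast
next
  case (PrimRec e1 e2)
  then obtain a b where ab: "\<And>orc c x. run orc a (prod_encode (c, x)) = run (\<lambda>_. g c) e1 x"
    "\<And>orc c x. run orc b (prod_encode (c, x)) = run (\<lambda>_. g c) e2 x" by blast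
  obtain p where p: "\<And>orc x. run orc p x = Some (prod_encode (prod_encode (pfst x, pfst (psnd x)), psnd (psnd x)))"
    using computable_pair[OF computable_pair[OF computable_pfst[OF computable_id]
      computable_pfst[OF computable_psnd[OF computable_id]]] computable_psnd[OF computable_psnd[OF computable_id]]]
    unfolding computable_def by blast
  obtain q where q: "\<And>orc x. run orc q x = Some (prod_encode (pfst (pfst x), prod_encode (psnd (pfst x), psnd x)))"
    using computable_pair[OF computable_pfst[OF computable_pfst[OF computable_id]]
      computable_pair[OF computable_psnd[OF computable_pfst[OF computable_id]] computable_psnd[OF computable_id]]]
    unfolding computable_def by blast
  have "run orc (Comp (PrimRec a (Comp b q)) p) (prod_encode (c, prod_encode (x, n)))
      = run (\<lambda>_. g c) (PrimRec e1 e2) (prod_encode (x, n))" for orc c x n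
    by (simp add: p q ab)
  then have "run orc (Comp (PrimRec a (Comp b q)) p) (prod_encode (c, x))
      = run (\<lambda>_. g c) (PrimRec e1 e2) x" for orc c x
    by (metis prod_encode_pfst_psnd)
  then show ?case by blast
next
  case (Mu e)
  then obtain a where a: "\<And>orc c x. run orc a (prod_encode (c, x)) = run (\<lambda>_. g c) e x" by blast
  obtain q where q: "\<And>orc x. run orc q x = Some (prod_encode (pfst (pfst x), prod_encode (psnd (pfst x), psnd x)))"
    using computable_pair[OF computable_pfst[OF computable_pfst[OF computable_id]]
      computable_pair[OF computable_psnd[OF computable_pfst[OF computable_id]] computable_psnd[OF computable_id]]]
    unfolding computable_def by blast
  have "run orc (Mu (Comp a q)) (prod_encode (c, x)) = run (\<lambda>_. g c) (Mu e) x" for orc c x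
    by (simp add: q a)
  then show ?case by blast
qed

text \<open>
  The value \<open>0\<close> stands for a computation that has not yet ended after \<open>t\<close> steps, and \<open>Suc y\<close> for
  the result \<open>y\<close>.
\<close>

definition approximates :: "(nat \<Rightarrow> nat \<Rightarrow> nat) \<Rightarrow> (nat \<Rightarrow> nat option) \<Rightarrow> bool" where
  "approximates h f \<longleftrightarrow>
     (\<forall>t t' x. t \<le> t' \<longrightarrow> h t x \<noteq> 0 \<longrightarrow> h t' x = h t x) \<and>
     (\<forall>x y. f x = Some y \<longleftrightarrow> (\<exists>t. h t x = Suc y))"

lemma approximates_mono:
  "approximates h f \<Longrightarrow> h t x = Suc y \<Longrightarrow> t \<le> t' \<Longrightarrow> h t' x = Suc y"
  unfolding approximates_def by (metis nat.distinct(2))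

lemma approximates_Some:
  "approximates h f \<Longrightarrow> f x = Some y \<longleftrightarrow> (\<exists>t. h t x = Suc y)"
  unfolding approximates_def by blast

lemma approximatesI:
  assumes "\<And>t t' x y. t \<le> t' \<Longrightarrow> h t x = Suc y \<Longrightarrow> h t' x = Suc y"
    and "\<And>t x y. h t x = Suc y \<Longrightarrow> f x = Some y"
    and "\<And>x y. f x = Some y \<Longrightarrow> \<exists>t. h t x = Suc y"
  shows "approximates h f"
  unfolding approximates_def by (metis assms not0_implies_Suc)

lemma rec_nat_search:
  "rec_nat 0 (\<lambda>m r. if r \<noteq> 0 then r else if P m then Suc m else 0) t = Suc n
     \<longleftrightarrow> n < t \<and> P n \<and> (\<forall>m<n. \<not> P m)"
proof (induction t arbitrary: n)
  case (Suc t)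
  let ?r = "rec_nat 0 (\<lambda>m r. if r \<noteq> 0 then r else if P m then Suc m else 0) t"
  have step: "rec_nat 0 (\<lambda>m r. if r \<noteq> 0 then r else if P m then Suc m else 0) (Suc t)
      = (if ?r \<noteq> 0 then ?r else if P t then Suc t else 0)" by simp
  show ?case
  proof (cases "?r")
    case 0
    then have *: "\<not> (m < t \<and> P m \<and> (\<forall>i<m. \<not> P i))" for m
      using Suc.IH[of m] by simp
    have "\<not> P m" if "m < t" for m
      using that
    proof (induction m rule: less_induct)
      case (less m)
      then show ?case using *[of m] by (meson less_trans)
    qed
    then show ?thesis unfolding step 0 by (auto simp: less_Suc_eq)
  next
    case (Suc k)
    then have k: "k < t" "P k" "\<forall>m<k. \<not> P m" using Suc.IH[of k] by simp_all
    have "n < Suc t \<and> P n \<and> (\<forall>m<n. \<not> P m) \<longleftrightarrow> k = n"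
      using k by (meson less_SucI linorder_neqE_nat)
    then show ?thesis unfolding step Suc by simp
  qed
qed simp

text \<open>
  The least zero of the definition of \<open>Mu\<close> is the first argument at which the search stops, since all smaller
  values are defined and, by minimality, not zero.
\<close>

lemma run_Mu_Some:
  "run orc (Mu e) x = Some y \<longleftrightarrow> run orc e (prod_encode (x, y)) = Some 0 \<and>
     (\<forall>m<y. run orc e (prod_encode (x, m)) \<noteq> None \<and> run orc e (prod_encode (x, m)) \<noteq> Some 0)"
  (is "?L \<longleftrightarrow> ?f y = Some 0 \<and> ?R y")
proof
  assume L: ?L
  then obtain n where n: "?f n = Some 0" "\<forall>m<n. ?f m \<noteq> None" and y: "y = (LEAST n. ?f n = Some 0)"
    by (auto split: if_splits)
  have "?f y = Some 0" unfolding y by (rule LeastI[of _ n]) (rule n)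
  moreover have "y \<le> n" unfolding y by (rule Least_le) (rule n)
  moreover have "?f m \<noteq> Some 0" if "m < y" for m
    using that not_less_Least unfolding y by blast
  ultimately show "?f y = Some 0 \<and> ?R y" using n(2) by auto
next
  assume R: "?f y = Some 0 \<and> ?R y"
  then have "(LEAST n. ?f n = Some 0) = y"
    by (intro Least_equality) (auto simp: not_le[symmetric])
  with R show ?L by auto
qed

lemma approximates_witness:
  "computable (\<lambda>w. h (pfst w) (psnd w)) \<Longrightarrow> approximates h f \<Longrightarrow>
    \<exists>h. computable (\<lambda>w. h (pfst w) (psnd w)) \<and> approximates h f"
  by blast

text \<open>
  Replaces a universal machine: for one fixed program, a step-bounded evaluation is built along its
  structure. Monotonicity in the number of steps is what allows finitely many subcomputations to be
  given a common bound.
\<close>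

lemma approximation_in_stages:
  "\<exists>h. computable (\<lambda>w. h (pfst w) (psnd w)) \<and> approximates h (run (\<lambda>_. 0) e)"
proof (induction e)
  case Zero
  show ?case
    by (rule exI[of _ "\<lambda>t x. Suc 0"]) (intro conjI computable_intros, auto simp: approximates_def)
next
  case Succ
  show ?case
    by (rule exI[of _ "\<lambda>t x. Suc (Suc x)"]) (intro conjI computable_intros, auto simp: approximates_def)
next
  case Fst
  show ?case
    by (rule exI[of _ "\<lambda>t x. Suc (pfst x)"]) (intro conjI computable_intros, auto simp: approximates_def pfst_def)
next
  case Snd
  show ?case
    by (rule exI[of _ "\<lambda>t x. Suc (psnd x)"]) (intro conjI computable_intros, auto simp: approximates_def psnd_def)
next
  case Query
  show ?case
    by (rule exI[of _ "\<lambda>t x. Suc 0"]) (intro conjI computable_intros, auto simp: approximates_def)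
next
  case (Tup e1 e2)
  let ?r1 = "run (\<lambda>_. 0) e1" and ?r2 = "run (\<lambda>_. 0) e2"
  from Tup obtain h1 h2 where c: "computable (\<lambda>w. h1 (pfst w) (psnd w))" "computable (\<lambda>w. h2 (pfst w) (psnd w))"
    and a: "approximates h1 ?r1" "approximates h2 ?r2" by blast
  let ?h = "\<lambda>t x. if h1 t x = 0 then 0 else if h2 t x = 0 then 0 else Suc (prod_encode (h1 t x - 1, h2 t x - 1))"
  have h: "?h t x = Suc y \<longleftrightarrow> (\<exists>u v. h1 t x = Suc u \<and> h2 t x = Suc v \<and> y = prod_encode (u, v))" for t x y
    by (cases "h1 t x"; cases "h2 t x") auto
  have "computable (\<lambda>w. ?h (pfst w) (psnd w))" by (intro computable_intros c)
  moreover have "approximates ?h (run (\<lambda>_. 0) (Tup e1 e2))"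
  proof (rule approximatesI, unfold h)
    fix t t' x y assume "t \<le> t'" "\<exists>u v. h1 t x = Suc u \<and> h2 t x = Suc v \<and> y = prod_encode (u, v)"
    then show "\<exists>u v. h1 t' x = Suc u \<and> h2 t' x = Suc v \<and> y = prod_encode (u, v)"
      using approximates_mono[OF a(1)] approximates_mono[OF a(2)] by blast
  next
    fix t x y assume "\<exists>u v. h1 t x = Suc u \<and> h2 t x = Suc v \<and> y = prod_encode (u, v)"
    then obtain u v where "?r1 x = Some u" "?r2 x = Some v" "y = prod_encode (u, v)"
      using approximates_Some[OF a(1)] approximates_Some[OF a(2)] by blast
    then show "run (\<lambda>_. 0) (Tup e1 e2) x = Some y" by simp
  next
    fix x y assume "run (\<lambda>_. 0) (Tup e1 e2) x = Some y"
    then obtain u v where uv: "?r1 x = Some u" "?r2 x = Some v" "y = prod_encode (u, v)"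
      by (auto simp: bind_eq_Some_conv)
    then obtain t1 t2 where "h1 t1 x = Suc u" "h2 t2 x = Suc v"
      using approximates_Some[OF a(1)] approximates_Some[OF a(2)] by blast
    then have "h1 (max t1 t2) x = Suc u" "h2 (max t1 t2) x = Suc v"
      using approximates_mono[OF a(1)] approximates_mono[OF a(2)] by (meson max.cobounded1 max.cobounded2)+
    with uv show "\<exists>t u v. h1 t x = Suc u \<and> h2 t x = Suc v \<and> y = prod_encode (u, v)" by blast
  qed
  ultimately show ?case by (rule approximates_witness[of ?h])
next
  case (Comp e1 e2)
  let ?r1 = "run (\<lambda>_. 0) e1" and ?r2 = "run (\<lambda>_. 0) e2"
  from Comp obtain h1 h2 where c: "computable (\<lambda>w. h1 (pfst w) (psnd w))" "computable (\<lambda>w. h2 (pfst w) (psnd w))"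
    and a: "approximates h1 ?r1" "approximates h2 ?r2" by blast
  let ?h = "\<lambda>t x. if h2 t x = 0 then 0 else h1 t (h2 t x - 1)"
  have h: "?h t x = Suc y \<longleftrightarrow> (\<exists>u. h2 t x = Suc u \<and> h1 t u = Suc y)" for t x y
    by (cases "h2 t x") auto
  have "computable (\<lambda>w. ?h (pfst w) (psnd w))" by (intro computable_intros c computable_comp2[OF c(1)])
  moreover have "approximates ?h (run (\<lambda>_. 0) (Comp e1 e2))"
  proof (rule approximatesI, unfold h)
    fix t t' x y assume "t \<le> t'" "\<exists>u. h2 t x = Suc u \<and> h1 t u = Suc y"
    then show "\<exists>u. h2 t' x = Suc u \<and> h1 t' u = Suc y"
      using approximates_mono[OF a(1)] approximates_mono[OF a(2)] by blast
  next
    fix t x y assume "\<exists>u. h2 t x = Suc u \<and> h1 t u = Suc y"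
    then obtain u where "?r2 x = Some u" "?r1 u = Some y"
      using approximates_Some[OF a(1)] approximates_Some[OF a(2)] by blast
    then show "run (\<lambda>_. 0) (Comp e1 e2) x = Some y" by simp
  next
    fix x y assume "run (\<lambda>_. 0) (Comp e1 e2) x = Some y"
    then obtain u where uv: "?r2 x = Some u" "?r1 u = Some y"
      by (auto simp: bind_eq_Some_conv)
    then obtain t1 t2 where "h2 t1 x = Suc u" "h1 t2 u = Suc y"
      using approximates_Some[OF a(1)] approximates_Some[OF a(2)] by blast
    then have "h2 (max t1 t2) x = Suc u" "h1 (max t1 t2) u = Suc y"
      using approximates_mono[OF a(1)] approximates_mono[OF a(2)] by (meson max.cobounded1 max.cobounded2)+
    then show "\<exists>t u. h2 t x = Suc u \<and> h1 t u = Suc y" by blast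
  qed
  ultimately show ?case by (rule approximates_witness[of ?h])
next
  case (PrimRec e1 e2)
  let ?r1 = "run (\<lambda>_. 0) e1" and ?r2 = "run (\<lambda>_. 0) e2"
  from PrimRec obtain h1 h2 where c: "computable (\<lambda>w. h1 (pfst w) (psnd w))" "computable (\<lambda>w. h2 (pfst w) (psnd w))"
    and a: "approximates h1 ?r1" "approximates h2 ?r2" by blast
  let ?H = "\<lambda>t x n. rec_nat (h1 t x) (\<lambda>m r. if r = 0 then 0 else h2 t (prod_encode (x, prod_encode (m, r - 1)))) n"
  let ?F = "\<lambda>x n. run (\<lambda>_. 0) (PrimRec e1 e2) (prod_encode (x, n))"
  have HS: "?H t x (Suc n) = Suc y \<longleftrightarrow> (\<exists>u. ?H t x n = Suc u \<and> h2 t (prod_encode (x, prod_encode (n, u))) = Suc y)" for t x n y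
    by (cases "?H t x n") auto
  have FS: "?F x (Suc n) = Some y \<longleftrightarrow> (\<exists>u. ?F x n = Some u \<and> ?r2 (prod_encode (x, prod_encode (n, u))) = Some y)" for x n y
    by (simp add: bind_eq_Some_conv)
  have "computable (\<lambda>w. ?H (pfst w) (pfst (psnd w)) (psnd (psnd w)))"
    by (intro computable_intros computable_comp2[OF c(1)] computable_comp2[OF c(2)])
  moreover
  have mono: "?H t' x n = Suc y" if "t \<le> t'" "?H t x n = Suc y" for t t' x n y
    using that(2)
  proof (induction n arbitrary: y)
    case 0
    then show ?case using approximates_mono[OF a(1) _ that(1)] by simp
  next
    case (Suc n)
    then show ?case unfolding HS using approximates_mono[OF a(2) _ that(1)] by blast
  qed
  have sound: "?F x n = Some y" if "?H t x n = Suc y" for t x n y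
    using that
  proof (induction n arbitrary: y)
    case 0
    then show ?case using approximates_Some[OF a(1)] by auto
  next
    case (Suc n)
    then show ?case unfolding HS FS using approximates_Some[OF a(2)] by blast
  qed
  have complete: "\<exists>t. ?H t x n = Suc y" if "?F x n = Some y" for x n y
    using that
  proof (induction n arbitrary: y)
    case 0
    then show ?case using approximates_Some[OF a(1)] by auto
  next
    case (Suc n)
    then obtain u where u: "?F x n = Some u" "?r2 (prod_encode (x, prod_encode (n, u))) = Some y"
      unfolding FS by blast
    from Suc.IH[OF u(1)] obtain t1 where t1: "?H t1 x n = Suc u" by blast
    from u(2) obtain t2 where t2: "h2 t2 (prod_encode (x, prod_encode (n, u))) = Suc y"
      using approximates_Some[OF a(2)] by blast
    have "?H (max t1 t2) x (Suc n) = Suc y"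
      unfolding HS using mono[OF max.cobounded1 t1] approximates_mono[OF a(2) t2 max.cobounded2] by blast
    then show ?case by blast
  qed
  have "approximates (\<lambda>t w. ?H t (pfst w) (psnd w)) (run (\<lambda>_. 0) (PrimRec e1 e2))"
  proof (rule approximatesI)
    fix t t' w y assume "t \<le> t'" "?H t (pfst w) (psnd w) = Suc y"
    then show "?H t' (pfst w) (psnd w) = Suc y" by (rule mono)
  next
    fix t w y assume "?H t (pfst w) (psnd w) = Suc y"
    from sound[OF this] show "run (\<lambda>_. 0) (PrimRec e1 e2) w = Some y" by (simp only: prod_encode_pfst_psnd)
  next
    fix w y assume "run (\<lambda>_. 0) (PrimRec e1 e2) w = Some y"
    then have "?F (pfst w) (psnd w) = Some y" by (simp only: prod_encode_pfst_psnd)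
    then show "\<exists>t. ?H t (pfst w) (psnd w) = Suc y" by (rule complete)
  qed
  ultimately show ?case by (rule approximates_witness[of "\<lambda>t w. ?H t (pfst w) (psnd w)"])
next
  case (Mu e)
  let ?r = "run (\<lambda>_. 0) e"
  from Mu obtain h where c: "computable (\<lambda>w. h (pfst w) (psnd w))" and a: "approximates h ?r" by blast
  let ?P = "\<lambda>t x m. h t (prod_encode (x, m)) = Suc 0 \<and> (\<forall>i<m. h t (prod_encode (x, i)) \<noteq> 0)"
  let ?H = "\<lambda>t x. rec_nat 0 (\<lambda>m r. if r \<noteq> 0 then r else if ?P t x m then Suc m else 0) t"
  have H: "?H t x = Suc n \<longleftrightarrow> n < t \<and> h t (prod_encode (x, n)) = Suc 0 \<and> (\<forall>m<n. \<exists>u. h t (prod_encode (x, m)) = Suc (Suc u))" for t x n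
  proof -
    have "?H t x = Suc n \<longleftrightarrow> n < t \<and> ?P t x n \<and> (\<forall>m<n. \<not> ?P t x m)"
      by (rule rec_nat_search)
    also have "\<dots> \<longleftrightarrow> n < t \<and> h t (prod_encode (x, n)) = Suc 0 \<and> (\<forall>m<n. \<exists>u. h t (prod_encode (x, m)) = Suc (Suc u))"
    proof -
      have two: "(\<exists>u. a = Suc (Suc u)) \<longleftrightarrow> a \<noteq> 0 \<and> a \<noteq> Suc 0" for a :: nat
        by (cases a; cases "a - 1") auto
      show ?thesis unfolding two using less_trans[of _ _ n] by (metis (no_types, lifting))
    qed
    finally show ?thesis .
  qed
  have "computable (\<lambda>w. ?H (pfst w) (psnd w))"
    by (intro computable_intros computable_comp2[OF c])
  moreover have "approximates ?H (run (\<lambda>_. 0) (Mu e))"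
  proof (rule approximatesI, unfold H)
    fix t t' x n
    assume "t \<le> t'" "n < t \<and> h t (prod_encode (x, n)) = Suc 0 \<and> (\<forall>m<n. \<exists>u. h t (prod_encode (x, m)) = Suc (Suc u))"
    then show "n < t' \<and> h t' (prod_encode (x, n)) = Suc 0 \<and> (\<forall>m<n. \<exists>u. h t' (prod_encode (x, m)) = Suc (Suc u))"
      using approximates_mono[OF a _ \<open>t \<le> t'\<close>] by auto
  next
    fix t x n
    assume *: "n < t \<and> h t (prod_encode (x, n)) = Suc 0 \<and> (\<forall>m<n. \<exists>u. h t (prod_encode (x, m)) = Suc (Suc u))"
    have "?r (prod_encode (x, n)) = Some 0" using * approximates_Some[OF a] by blast
    moreover have "\<exists>u. ?r (prod_encode (x, m)) = Some (Suc u)" if "m < n" for m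
      using * that approximates_Some[OF a] by blast
    ultimately show "run (\<lambda>_. 0) (Mu e) x = Some n" unfolding run_Mu_Some by fastforce
  next
    fix x n
    assume "run (\<lambda>_. 0) (Mu e) x = Some n"
    then have n: "?r (prod_encode (x, n)) = Some 0"
      and m: "\<forall>m<n. ?r (prod_encode (x, m)) \<noteq> None \<and> ?r (prod_encode (x, m)) \<noteq> Some 0"
      unfolding run_Mu_Some by auto
    have "\<forall>m\<in>{..<n}. \<exists>u. ?r (prod_encode (x, m)) = Some (Suc u)"
      using m by (metis lessThan_iff not0_implies_Suc option.exhaust)
    then have "\<forall>m\<in>{..<n}. \<exists>u t. h t (prod_encode (x, m)) = Suc (Suc u)"
      using approximates_Some[OF a] by blast
    then obtain u \<tau> where \<tau>: "\<forall>m\<in>{..<n}. h (\<tau> m) (prod_encode (x, m)) = Suc (Suc (u m))" by metis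
    from n obtain t0 where t0: "h t0 (prod_encode (x, n)) = Suc 0"
      using approximates_Some[OF a] by blast
    define t where "t = Suc n + t0 + (\<Sum>m<n. \<tau> m)"
    have "\<tau> m \<le> t" if "m < n" for m
      using member_le_sum[of m "{..<n}" \<tau>] that unfolding t_def by simp
    then have "\<forall>m<n. h t (prod_encode (x, m)) = Suc (Suc (u m))"
      using \<tau> approximates_mono[OF a] by blast
    moreover have "h t (prod_encode (x, n)) = Suc 0"
      by (rule approximates_mono[OF a t0]) (simp add: t_def)
    moreover have "n < t" by (simp add: t_def)
    ultimately show "\<exists>t. n < t \<and> h t (prod_encode (x, n)) = Suc 0 \<and> (\<forall>m<n. \<exists>u. h t (prod_encode (x, m)) = Suc (Suc u))"
      by blast
  qed
  ultimately show ?case by (rule approximates_witness[of ?H])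
qed


section \<open>Computable codes of strings and conditions\<close>

text \<open>
  The binary logarithm rounded up, written as a bounded sum because this form is visibly computable.
\<close>

definition clog :: "nat \<Rightarrow> nat" where
  "clog n = (\<Sum>i<n. of_bool (2 ^ i < n))"

lemma computable_clog [computable_intros]:
  assumes f: "computable f" shows "computable (\<lambda>x. clog (f x))"
  unfolding clog_def by (intro computable_intros f computable_comp[OF f])

lemma clog_eq_Least: "clog n = (LEAST m. n \<le> 2 ^ m)"
proof -
  define m where "m = (LEAST m. n \<le> 2 ^ m)"
  have n: "n \<le> 2 ^ n" by (simp add: less_imp_le)
  have ge: "n \<le> 2 ^ m" unfolding m_def by (rule LeastI[of _ n]) (rule n)
  have le: "m \<le> n" unfolding m_def by (rule Least_le) (rule n)
  have *: "2 ^ i < n \<longleftrightarrow> i < m" for i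
  proof
    assume "2 ^ i < n"
    with ge have "(2::nat) ^ i < 2 ^ m" by (rule less_le_trans[rotated])
    then show "i < m" by simp
  next
    assume "i < m"
    then show "2 ^ i < n" unfolding m_def using not_less_Least not_le by blast
  qed
  have "clog n = card {i \<in> {..<n}. i < m}"
    unfolding clog_def * by (subst card_eq_sum, subst sum.inter_filter) (auto simp: of_bool_def)
  also have "{i \<in> {..<n}. i < m} = {..<m}" using le by auto
  finally show ?thesis by (simp add: m_def)
qed

lemma le_two_power_clog: "n \<le> 2 ^ clog n"
  unfolding clog_eq_Least by (rule LeastI[of _ n]) (simp add: less_imp_le)

lemma two_power_clog_le:
  assumes "0 < n" shows "2 ^ clog n \<le> 2 * n"
proof (cases "clog n")
  case 0
  with assms show ?thesis by simp
next
  case (Suc m)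
  then have "\<not> n \<le> 2 ^ m"
    using not_less_Least[of m "\<lambda>m. n \<le> 2 ^ m"] unfolding clog_eq_Least by simp
  with Suc show ?thesis by simp
qed

lemma log_bounds_clog:
  assumes "0 < n"
  shows "log 2 (real n) \<le> real (clog n)" "real (clog n) \<le> log 2 (real n) + 1"
proof -
  have "real n \<le> real (2 ^ clog n)" using le_two_power_clog of_nat_le_iff by blast
  then have "log 2 (real n) \<le> log 2 (2 ^ clog n)" using assms by (subst log_le_cancel_iff) auto
  then show "log 2 (real n) \<le> real (clog n)" by (simp add: log_nat_power)
  have "real (2 ^ clog n) \<le> real (2 * n)" using two_power_clog_le[OF assms] of_nat_le_iff by blast
  then have "log 2 (2 ^ clog n) \<le> log 2 (2 * real n)" using assms by (subst log_le_cancel_iff) auto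
  then show "real (clog n) \<le> log 2 (real n) + 1" using assms by (simp add: log_nat_power log_mult)
qed

text \<open>
  The string \<open>q\<close> is read as a binary number, most significant bit first, so that \<open>q\<close> corresponds to
  the dyadic interval from \<open>bitval q / 2 ^ length q\<close> to \<open>Suc (bitval q) / 2 ^ length q\<close> and extensions
  of \<open>q\<close> to its subintervals.
\<close>

definition bitval :: "bool list \<Rightarrow> nat" where
  "bitval q = foldl (\<lambda>v b. 2 * v + of_bool b) 0 q"

lemma bitval_Nil [simp]: "bitval [] = 0"
  and bitval_snoc [simp]: "bitval (q @ [b]) = 2 * bitval q + of_bool b"
  by (simp_all add: bitval_def)

lemma bitval_append: "bitval (q @ r) = bitval q * 2 ^ length r + bitval r"
  by (induction r rule: rev_induct) (simp_all flip: append_assoc add: algebra_simps)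

lemma bitval_Cons: "bitval (b # q) = of_bool b * 2 ^ length q + bitval q"
  using bitval_append[of "[b]" q] bitval_snoc[of "[]" b] by simp

lemma bitval_less: "bitval q < 2 ^ length q"
  by (induction q rule: rev_induct) auto

primrec bits_of :: "nat \<Rightarrow> nat \<Rightarrow> bool list" where
  "bits_of 0 v = []"
| "bits_of (Suc l) v = odd (v div 2 ^ l) # bits_of l v"

lemma length_bits_of [simp]: "length (bits_of l v) = l"
  by (induction l) auto

lemma bitval_bits_of: "bitval (bits_of l v) = v mod 2 ^ l"
proof (induction l)
  case (Suc l)
  have "v mod (2 ^ l * 2) = 2 ^ l * (v div 2 ^ l mod 2) + v mod 2 ^ l" by (rule mod_mult2_eq)
  with Suc show ?case by (simp add: bitval_Cons mod2_eq_if mult.commute)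
qed simp

lemma bits_of_bitval: "bits_of (length q) (bitval q) = q"
proof (induction q)
  case (Cons b q)
  have high: "(c * 2 ^ m + v) div 2 ^ l mod 2 = v div 2 ^ l mod 2" if "l < m" for c m v l :: nat
  proof -
    from that obtain d where m: "m = Suc (l + d)" using less_iff_Suc_add by blast
    have eq: "c * 2 ^ m + v = v + 2 * c * 2 ^ d * 2 ^ l"
      by (simp add: m power_add)
    have "(c * 2 ^ m + v) div 2 ^ l = v div 2 ^ l + 2 * (c * 2 ^ d)" unfolding eq by simp
    then show ?thesis by (simp only: mod_mult_self2)
  qed
  have *: "bits_of l (c * 2 ^ m + v) = bits_of l v" if "l \<le> m" for c m v l
    using that by (induction l) (simp_all add: even_iff_mod_2_eq_zero high)
  show ?case
    using Cons bitval_less[of q] by (simp add: bitval_Cons *)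
qed simp

text \<open>
  The code of a string is computed from its length and its value. In this way programs search over
  pairs of numbers and never have to decode a list.
\<close>

definition code_bits :: "nat \<Rightarrow> nat \<Rightarrow> nat" where
  "code_bits l v = rec_nat 0 (\<lambda>i r. Suc (prod_encode (v div 2 ^ i mod 2, r))) l"

lemma computable_code_bits [computable_intros]:
  assumes f: "computable f" and g: "computable g"
  shows "computable (\<lambda>x. code_bits (f x) (g x))"
  unfolding code_bits_def by (intro computable_intros f computable_comp[OF g])

lemma code_bits: "code_bits l v = bits_code (bits_of l v)"
  by (induction l) (simp_all add: code_bits_def bits_code_def of_bool_odd_eq_mod_2)

lemma code_bits_bitval: "code_bits (length q) (bitval q) = bits_code q"
  by (simp add: code_bits bits_of_bitval)

lemma inj_bits_code: "bits_code q = bits_code r \<longleftrightarrow> q = r"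
proof -
  have "inj (of_bool :: bool \<Rightarrow> nat)" by (rule injI) (metis of_bool_eq_iff)
  then show ?thesis unfolding bits_code_def by (simp add: list_encode_eq)
qed

lemma code_bits_eq_iff:
  assumes "v < 2 ^ l"
  shows "code_bits l v = bits_code q \<longleftrightarrow> l = length q \<and> v = bitval q"
  using assms bitval_bits_of[of l v] by (auto simp: code_bits inj_bits_code bits_of_bitval)

definition condition :: "nat \<Rightarrow> nat set \<Rightarrow> obj" where
  "condition n S = pair_obj (Num n) (set_obj S)"

text \<open>
  The list of elements of the interval from \<open>a\<close> to \<open>b\<close> is built from its end, which turns it into a
  primitive recursion.
\<close>

definition code_condition :: "nat \<Rightarrow> nat \<Rightarrow> nat \<Rightarrow> nat" where
  "code_condition n a b = prod_encode (2, prod_encode (prod_encode (2, n),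
     prod_encode (1, rec_nat 0 (\<lambda>i r. Suc (prod_encode (b - Suc i, r))) (b - a))))"

lemma computable_code_condition [computable_intros]:
  assumes f: "computable f" and g: "computable g" and h: "computable h"
  shows "computable (\<lambda>x. code_condition (f x) (g x) (h x))"
  unfolding code_condition_def by (intro computable_intros f g h computable_comp[OF h])

lemma code_condition:
  assumes "a \<le> b"
  shows "code_condition n a b = obj_code (condition n {a..<b})"
proof -
  have "rec_nat 0 (\<lambda>i r. Suc (prod_encode (b - Suc i, r))) i = list_encode [b - i..<b]" if "i \<le> b - a" for i
    using that
  proof (induction i)
    case (Suc i)
    then have "[b - Suc i..<b] = (b - Suc i) # [b - i..<b]"
      by (subst upt_conv_Cons) (auto simp: Suc_diff_Suc)
    with Suc show ?case by simp
  qed simp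
  from this[of "b - a"] assms show ?thesis
    by (simp add: code_condition_def condition_def pair_obj_def set_obj_def)
qed

lemma code_condition_inj:
  assumes "a < b" "a' < b'" "code_condition n a b = code_condition n' a' b'"
  shows "n = n' \<and> a = a' \<and> b = b'"
proof -
  from assms have "n = n'" and "[a..<b] = [a'..<b']"
    by (simp_all add: code_condition condition_def pair_obj_def set_obj_def list_encode_eq)
  then have "{a..<b} = {a'..<b'}" by (metis set_upt)
  with \<open>n = n'\<close> assms(1,2) show ?thesis 
    by (metis atLeastLessThan_inj(1) atLeastLessThan_inj(2))
qed


section \<open>Prefix codes\<close>

text \<open>
  The extensions of the members of \<open>Q\<close> to a common length are disjoint sets of strings.
\<close>

lemma Kraft_inequality:
  fixes Q :: "bool list set"
  assumes fin: "finite Q" and free: "\<And>q r. q \<in> Q \<Longrightarrow> r \<in> Q \<Longrightarrow> prefix q r \<Longrightarrow> q = r"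
  shows "(\<Sum>q\<in>Q. (1 / 2) ^ length q) \<le> (1::real)"
proof -
  define N where "N = (\<Sum>q\<in>Q. length q)"
  have N: "length q \<le> N" if "q \<in> Q" for q
    using that fin unfolding N_def by (intro member_le_sum) auto
  let ?W = "\<lambda>n. {r::bool list. length r = n}"
  have W: "finite (?W n) \<and> card (?W n) = 2 ^ n" for n
    using finite_lists_length_eq[of "UNIV :: bool set" n] card_lists_length_eq[of "UNIV :: bool set" n] by simp
  define E where "E q = (\<lambda>s. q @ s) ` ?W (N - length q)" for q :: "bool list"
  have E: "finite (E q)" "card (E q) = 2 ^ (N - length q)" for q
    using W unfolding E_def by (auto simp: card_image inj_on_def)
  have "(\<Sum>q\<in>Q. 2 ^ (N - length q)) = card (\<Union>q\<in>Q. E q)"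
  proof (subst card_UN_disjoint)
    show "\<forall>q\<in>Q. \<forall>r\<in>Q. q \<noteq> r \<longrightarrow> E q \<inter> E r = {}"
    proof (intro ballI impI, rule ccontr)
      fix q r assume qr: "q \<in> Q" "r \<in> Q" "q \<noteq> r" "E q \<inter> E r \<noteq> {}"
      then obtain s t where "q @ s = r @ t" unfolding E_def by auto
      then have "prefix q (r @ t)" "prefix r (r @ t)" by (metis prefixI, simp)
      then have "prefix q r \<or> prefix r q" using prefix_same_cases by blast
      with qr free show False by blast
    qed
  qed (use fin E in auto)
  also have "\<dots> \<le> card (?W N)"
    using W N unfolding E_def by (intro card_mono) auto
  finally have le: "(\<Sum>q\<in>Q. 2 ^ (N - length q)) \<le> (2::nat) ^ N" using W by simp
  have "(\<Sum>q\<in>Q. (1 / 2) ^ length q) * (2::real) ^ N = (\<Sum>q\<in>Q. 2 ^ (N - length q))"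
    unfolding sum_distrib_right
    using N by (intro sum.cong refl) (simp add: power_diff power_divide)
  also have "\<dots> = real (\<Sum>q\<in>Q. 2 ^ (N - length q))" by simp
  also have "\<dots> \<le> real (2 ^ N)" using le of_nat_le_iff by blast
  finally show ?thesis by simp
qed

text \<open>
  The dyadic interval of a string with length \<open>l\<close> and value \<open>v\<close> lies in the interval from \<open>s / 2 ^ E\<close>
  to \<open>(s + z) / 2 ^ E\<close>, with denominators cleared.
\<close>

definition fits :: "nat \<Rightarrow> nat \<Rightarrow> nat \<Rightarrow> nat \<Rightarrow> nat \<Rightarrow> bool" where
  "fits E s z l v \<longleftrightarrow> s * 2 ^ l \<le> v * 2 ^ E \<and> Suc v * 2 ^ E \<le> (s + z) * 2 ^ l"

lemma fits_prefix:
  assumes "fits E s z (length q) (bitval q)" "prefix q q'"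
  shows "fits E s z (length q') (bitval q')"
proof -
  from assms(2) obtain r where q': "q' = q @ r" by (auto elim: prefixE)
  let ?l = "length q" and ?v = "bitval q" and ?k = "2 ^ length r :: nat"
  have f: "s * 2 ^ ?l \<le> ?v * 2 ^ E" "Suc ?v * 2 ^ E \<le> (s + z) * 2 ^ ?l"
    using assms(1) unfolding fits_def by auto
  have "s * 2 ^ length q' = (s * 2 ^ ?l) * ?k" by (simp add: q' power_add)
  also have "\<dots> \<le> (?v * 2 ^ E) * ?k" using f(1) by (rule mult_le_mono1)
  also have "\<dots> \<le> bitval q' * 2 ^ E" by (simp add: q' bitval_append algebra_simps)
  finally have 1: "s * 2 ^ length q' \<le> bitval q' * 2 ^ E" .
  have "Suc (bitval q') \<le> Suc ?v * ?k" using bitval_less[of r] by (simp add: q' bitval_append)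
  then have "Suc (bitval q') * 2 ^ E \<le> (Suc ?v * ?k) * 2 ^ E" by (rule mult_le_mono1)
  also have "\<dots> = (Suc ?v * 2 ^ E) * ?k" by (simp only: ac_simps)
  also have "\<dots> \<le> ((s + z) * 2 ^ ?l) * ?k" using f(2) by (rule mult_le_mono1)
  also have "\<dots> = (s + z) * 2 ^ length q'" by (simp add: q' power_add)
  finally show ?thesis using 1 unfolding fits_def by blast
qed

text \<open>
  Consecutive intervals of lengths \<open>z 0, z 1, \<dots>\<close> are disjoint.
\<close>

lemma fits_unique:
  fixes z :: "nat \<Rightarrow> nat"
  assumes "fits E (\<Sum>i<j. z i) (z j) l v" "fits E (\<Sum>i<j'. z i) (z j') l v"
  shows "j = j'"
proof -
  have False if "fits E (\<Sum>i<j. z i) (z j) l v" "fits E (\<Sum>i<j'. z i) (z j') l v" "j < j'" for j j' :: nat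
  proof -
    have "(\<Sum>i<j. z i) + z j = (\<Sum>i<Suc j. z i)" by simp
    also have "\<dots> \<le> (\<Sum>i<j'. z i)" using that(3) by (intro sum_mono2) auto
    finally have "((\<Sum>i<j. z i) + z j) * 2 ^ l \<le> (\<Sum>i<j'. z i) * 2 ^ l" by (rule mult_le_mono1)
    then have "Suc v * 2 ^ E \<le> v * 2 ^ E" using that(1,2) unfolding fits_def by linarith
    then show False by simp
  qed
  with assms show ?thesis by (metis linorder_neqE_nat)
qed

text \<open>
  An interval of length \<open>2 ^ (- l)\<close> with arbitrary end points contains a dyadic interval of half
  its length.
\<close>

lemma fits_exists:
  assumes "l \<le> E" "s + 2 ^ (E - l) \<le> 2 ^ E"
  shows "\<exists>v<2 ^ Suc l. fits E s (2 ^ (E - l)) (Suc l) v"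
proof -
  define M :: nat where "M = 2 ^ E"
  have M: "0 < M" by (simp add: M_def)
  define x where "x = s * 2 ^ Suc l"
  \<comment> \<open>the quotient \<open>x / M\<close> rounded up\<close>
  define v where "v = (x + (M - 1)) div M"
  have room: "2 ^ (E - l) * 2 ^ Suc l = 2 * M"
    using assms(1) by (simp add: M_def power_add[symmetric])
  have "v * M + (x + (M - 1)) mod M = x + (M - 1)" unfolding v_def by simp
  moreover have "(x + (M - 1)) mod M < M" using M by simp
  ultimately have v: "x \<le> v * M" "v * M \<le> x + (M - 1)" by linarith+
  then have up: "Suc v * M \<le> (s + 2 ^ (E - l)) * 2 ^ Suc l"
    using M room unfolding add_mult_distrib mult_Suc x_def[symmetric] by linarith
  also have "\<dots> \<le> M * 2 ^ Suc l" unfolding M_def using assms(2) by (rule mult_le_mono1)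
  finally have "Suc v * M \<le> 2 ^ Suc l * M" by (simp only: mult.commute)
  then have "v < 2 ^ Suc l" using M unfolding mult_le_cancel2 by (simp only: Suc_le_eq)
  then show ?thesis using v(1) up unfolding fits_def x_def M_def by blast
qed

section \<open>Levels of a test at a rational parameter\<close>

lemma rat_code_fraction:
  assumes "0 < n"
  shows "rat_code (of_nat c / of_nat n) = prod_encode (2 * (c div gcd c n), n div gcd c n)"
proof -
  have "(of_nat c / of_nat n :: rat) = Fract (int c) (int n)" by (simp add: Fract_of_int_quotient)
  then have "quotient_of (of_nat c / of_nat n) = (int (c div gcd c n), int (n div gcd c n))"
    using assms by (simp add: quotient_of_Fract Rat.normalize_def zdiv_int Let_def)
  then show ?thesis by (simp add: rat_code_def int_encode_def sum_encode_def)
qed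

text \<open>
  The rational \<open>c / n\<close> itself is an admissible answer at every precision, so the oracle may be taken
  constant and eliminated. The result has to be total, hence \<open>n\<close>, \<open>c\<close> and \<open>k\<close> are first forced into the
  range in which the given program is known to halt. Only the positive part of the test is kept, which makes
  the values natural numbers and costs a bounded factor in the mean.
\<close>

lemma rational_levels_computable:
  assumes "lower_semicomputable T"
  shows "\<exists>lev. computable (\<lambda>w. lev (pfst w) (pfst (psnd w)) (pfst (psnd (psnd w))) (psnd (psnd (psnd w)))) \<and>
    (\<forall>n>0. \<forall>c\<le>n. \<forall>k\<le>n. mono (lev n c k) \<and>
       (SUP t. ereal (real (lev n c k t))) = max 0 (T n (real c / real n) k))"
proof -
  obtain e where e: "\<And>n p k a. 0 < n \<Longrightarrow> p \<in> {0..1} \<Longrightarrow> k \<le> n \<Longrightarrow>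
      (\<forall>i. \<bar>of_rat (a i) - p\<bar> \<le> 1 / 2 ^ i) \<Longrightarrow>
      (\<exists>m :: nat \<Rightarrow> int. mono m \<and>
         (\<forall>j. run (\<lambda>i. rat_code (a i)) e (prod_encode (n, prod_encode (k, j))) = Some (int_encode (m j))) \<and>
         (SUP j. ereal (of_int (m j))) = T n p k)"
    using assms unfolding lower_semicomputable_def by metis
  let ?gcd = "\<lambda>x. rec_nat 0 (\<lambda>m r. if Suc m dvd psnd x \<and> Suc m dvd pfst x then Suc m else r) (pfst x)"
  define g where "g x = prod_encode (2 * (psnd x div ?gcd x), pfst x div ?gcd x)" for x
  have "computable g" unfolding g_def by (intro computable_intros)
  have g: "g (prod_encode (n, c)) = rat_code (of_nat c / of_nat n)" if "0 < n" for n c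
    using that by (simp add: g_def rat_code_fraction rec_nat_gcd)
  obtain e' where e': "\<And>orc c x. run orc e' (prod_encode (c, x)) = run (\<lambda>_. g c) e x"
    using oracle_elimination[OF \<open>computable g\<close>] by blast
  let ?run = "\<lambda>n c k t. run (\<lambda>_. 0) e' (prod_encode (prod_encode (n, c), prod_encode (n, prod_encode (k, t))))"
  have ex: "\<exists>m :: nat \<Rightarrow> int. mono m \<and> (\<forall>orc t. run orc e' (prod_encode (prod_encode (n, c), prod_encode (n, prod_encode (k, t)))) = Some (int_encode (m t))) \<and>
      (SUP t. ereal (of_int (m t))) = T n (real c / real n) k" if "0 < n" "c \<le> n" "k \<le> n" for n c k
    using e[OF that(1) _ that(3), of "real c / real n" "\<lambda>_. of_nat c / of_nat n"] that
    by (simp add: e' g of_rat_divide)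
  \<comment> \<open>the sanitized arguments\<close>
  define N where "N w = (if pfst w = 0 then 1 else pfst w)" for w
  define c where "c w = (if pfst (psnd w) \<le> N w then pfst (psnd w) else N w)" for w
  define k where "k w = (if pfst (psnd (psnd w)) \<le> N w then pfst (psnd (psnd w)) else N w)" for w
  define t where "t w = psnd (psnd (psnd w))" for w
  note defs = N_def c_def k_def t_def
  define arg where "arg w = prod_encode (prod_encode (N w, c w), prod_encode (N w, prod_encode (k w, t w)))" for w
  have "computable arg" unfolding arg_def defs by (intro computable_intros)
  then obtain a where a: "\<And>orc w. run orc a w = Some (arg w)" unfolding computable_def by blast
  define val where "val w = the (run (\<lambda>_. 0) e' (arg w))" for w
  have "run orc (Comp e' a) w = Some (val w)" for orc w
  proof -
    have "0 < N w" "c w \<le> N w" "k w \<le> N w" by (simp_all add: defs)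
    from ex[OF this] obtain m :: "nat \<Rightarrow> int" where
      "\<forall>orc. run orc e' (arg w) = Some (int_encode (m (t w)))"
      unfolding arg_def by blast
    then show ?thesis by (simp add: a val_def)
  qed
  then have val: "computable val" unfolding computable_def by blast
  define lev where "lev n c k t = (let v = val (prod_encode (n, prod_encode (c, prod_encode (k, t)))) in
      if v mod 2 = 0 then v div 2 else 0)" for n c k t
  have "computable (\<lambda>w. lev (pfst w) (pfst (psnd w)) (pfst (psnd (psnd w))) (psnd (psnd (psnd w))))"
    unfolding lev_def Let_def by (intro computable_intros computable_comp[OF val])
  moreover have "mono (lev n c' k') \<and> (SUP t. ereal (real (lev n c' k' t))) = max 0 (T n (real c' / real n) k')"
    if *: "0 < n" "c' \<le> n" "k' \<le> n" for n c' k'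
  proof -
    from ex[OF *] obtain m :: "nat \<Rightarrow> int" where m: "mono m"
      "\<And>t. run (\<lambda>_. 0) e' (prod_encode (prod_encode (n, c'), prod_encode (n, prod_encode (k', t)))) = Some (int_encode (m t))"
      "(SUP t. ereal (of_int (m t))) = T n (real c' / real n) k'" by blast
    have lev: "lev n c' k' t = nat (m t)" for t
      using * by (simp add: lev_def val_def arg_def defs m(2) int_encode_def sum_encode_def)
    have "mono (lev n c' k')" using m(1) unfolding lev mono_def by (auto intro: nat_mono)
    moreover have "(SUP t. ereal (real (lev n c' k' t))) = (SUP t. sup 0 (ereal (of_int (m t))))"
      unfolding lev by (intro SUP_cong refl) (auto simp: sup_max max_def)
    moreover have "\<dots> = sup 0 (SUP t. ereal (of_int (m t)))"
      using complete_lattice_class.SUP_sup_distrib[of "\<lambda>_. 0::ereal" UNIV "\<lambda>t. ereal (of_int (m t))"] by simp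
    ultimately show ?thesis by (simp add: m(3) sup_max)
  qed
  ultimately show ?thesis by (intro exI[of _ lev] conjI) blast+
qed


section \<open>Binomial probabilities\<close>

definition bin :: "nat \<Rightarrow> real \<Rightarrow> nat \<Rightarrow> real" where
  "bin n p k = real (n choose k) * p ^ k * (1 - p) ^ (n - k)"

text \<open>
  The standard deviation of the binomial measure with parameters \<open>n\<close> and \<open>k / n\<close>.
\<close>

definition sd :: "nat \<Rightarrow> nat \<Rightarrow> real" where
  "sd n k = sqrt (real k * real (n - k) / real n)"

lemma bin_nonneg: "p \<in> {0..1} \<Longrightarrow> 0 \<le> bin n p k"
  by (simp add: bin_def)

lemma sum_bin:
  assumes "p \<in> {0..1}" shows "(\<Sum>k\<le>n. bin n p k) = 1"
  using binomial_ring[of p "1 - p" n] by (simp add: bin_def)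

lemma bin_le_1:
  assumes "p \<in> {0..1}" "k \<le> n" shows "bin n p k \<le> 1"
  using member_le_sum[of k "{..n}" "bin n p"] bin_nonneg[OF assms(1)] sum_bin[OF assms(1), of n] assms(2) by simp

text \<open>
  The logarithm of \<open>m!\<close> divided by \<open>sqrt m (m / e) ^ m\<close>. It decreases to \<open>ln (2 \<pi>) / 2\<close>.
\<close>

definition stirling_ratio :: "nat \<Rightarrow> real" where
  "stirling_ratio m = ln (fact m) - (real m + 1 / 2) * ln (real m) + real m"

text \<open>
  Both parts compare \<open>ln (m + 1) - ln m\<close> with a quadrature rule for \<open>1 / x\<close>: the midpoint rule
  shows that the ratio decreases, the trapezoidal rule that it decreases by at most the telescoping
  difference of \<open>1 / (4 m)\<close>.
\<close>

lemma stirling_ratio_step: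
  assumes "0 < m"
  shows "stirling_ratio (Suc m) \<le> stirling_ratio m"
    and "stirling_ratio m - 1 / (4 * real m) \<le> stirling_ratio (Suc m) - 1 / (4 * real (Suc m))"
proof -
  let ?d = "ln (real m + 1) - ln (real m)"
  have m: "0 < real m" using assms by simp
  have diff: "stirling_ratio (Suc m) = stirling_ratio m + 1 - (real m + 1 / 2) * ?d"
  proof -
    have "ln (fact (Suc m) :: real) = ln (real m + 1) + ln (fact m)"
      by (simp only: fact_Suc of_nat_Suc, subst ln_mult) (auto simp: add.commute)
    then show ?thesis using m by (simp add: stirling_ratio_def algebra_simps)
  qed
  have "?d \<ge> 2 / (2 * real m + 1)" using ln_inverse_approx_ge[of "real m" "real m + 1"] m by (simp add: field_simps)
  then have "(real m + 1 / 2) * ?d \<ge> (real m + 1 / 2) * (2 / (2 * real m + 1))"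
    using m by (intro mult_left_mono) auto
  also have "(real m + 1 / 2) * (2 / (2 * real m + 1)) = 1" using m by (simp add: field_simps)
  finally show "stirling_ratio (Suc m) \<le> stirling_ratio m" using diff by simp
  have "?d \<le> (1 / real m + 1 / (real m + 1)) / 2" using ln_inverse_approx_le[of "real m" 1] m by (simp add: field_simps)
  then have "(real m + 1 / 2) * ?d \<le> (real m + 1 / 2) * ((1 / real m + 1 / (real m + 1)) / 2)"
    using m by (intro mult_left_mono) auto
  also have "\<dots> = 1 + 1 / (4 * real m) - 1 / (4 * (real m + 1))"
  proof -
    have "(y + 1 / 2) * ((1 / y + 1 / (y + 1)) / 2) = 1 + 1 / (4 * y) - 1 / (4 * (y + 1))" if "0 < y" for y :: real
      using that by (simp add: divide_simps) (simp add: algebra_simps)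
    then show ?thesis using m by blast
  qed
  finally show "stirling_ratio m - 1 / (4 * real m) \<le> stirling_ratio (Suc m) - 1 / (4 * real (Suc m))"
    using diff by (simp add: add.commute)
qed

lemma stirling_ratio_bounds:
  assumes "0 < m"
  shows "3 / 4 \<le> stirling_ratio m" "stirling_ratio m \<le> 1"
proof -
  have "stirling_ratio m \<le> 1 \<and> 3 / 4 \<le> stirling_ratio m - 1 / (4 * real m)"
    using assms
  proof (induction m rule: nat_induct_non_zero)
    case 1
    then show ?case by (simp add: stirling_ratio_def)
  next
    case (Suc m)
    then show ?case using stirling_ratio_step[of m] by linarith
  qed
  moreover have "0 \<le> 1 / (4 * real m)" by simp
  ultimately show "3 / 4 \<le> stirling_ratio m" "stirling_ratio m \<le> 1" by linarith+
qed

lemma ln_bin_mode: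
  assumes "0 < k" "k < n"
  shows "ln (bin n (real k / real n) k) =
    stirling_ratio n - stirling_ratio k - stirling_ratio (n - k) - ln (sd n k)"
proof -
  define j where "j = n - k"
  have pos: "0 < real k" "0 < real j" "0 < real n" using assms by (auto simp: j_def)
  have n: "real n = real k + real j" using assms by (simp add: j_def)
  have q: "1 - real k / real n = real j / real n" using pos by (simp add: field_simps n)
  have "ln (real (n choose k)) = ln (fact n) - ln (fact k) - ln (fact j)"
    using assms by (simp add: binomial_fact j_def ln_div ln_mult)
  then have "ln (bin n (real k / real n) k) = ln (fact n) - ln (fact k) - ln (fact j)
      + real k * (ln (real k) - ln (real n)) + real j * (ln (real j) - ln (real n))"
    unfolding bin_def q j_def[symmetric] using pos assms
    by (simp add: ln_mult ln_div ln_realpow zero_less_binomial_iff)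
  moreover have "ln (sd n k) = (ln (real k) + ln (real j) - ln (real n)) / 2"
    unfolding sd_def j_def[symmetric] using pos by (simp add: ln_sqrt ln_mult ln_div)
  ultimately show ?thesis
    unfolding stirling_ratio_def j_def[symmetric] by (simp add: n algebra_simps add_divide_distrib diff_divide_distrib)
qed

lemma bin_pos: "0 < p \<Longrightarrow> p < 1 \<Longrightarrow> k \<le> n \<Longrightarrow> 0 < bin n p k"
  by (simp add: bin_def zero_less_binomial_iff)

lemma sd_pos: "0 < k \<Longrightarrow> k < n \<Longrightarrow> 0 < sd n k"
  by (simp add: sd_def)

text \<open>
  The probability of \<open>k\<close> under the measure with mean \<open>k\<close>: in Stirling's formula for the binomial
  coefficient the powers cancel against \<open>p ^ k (1 - p) ^ (n - k)\<close>, and the square roots give \<open>1 / sd n k\<close>.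
\<close>

lemma bin_mode_bounds:
  assumes "0 < k" "k < n"
  shows "exp (- 5 / 4) / sd n k \<le> bin n (real k / real n) k" "sd n k * bin n (real k / real n) k \<le> 1"
proof -
  have pos: "0 < bin n (real k / real n) k" "0 < sd n k"
    using assms by (auto intro!: bin_pos sd_pos)
  note b = stirling_ratio_bounds[of n] stirling_ratio_bounds[of k] stirling_ratio_bounds[of "n - k"]
  have l: "ln (sd n k * bin n (real k / real n) k) = stirling_ratio n - stirling_ratio k - stirling_ratio (n - k)"
    using pos by (simp add: ln_mult ln_bin_mode[OF assms])
  have "ln (sd n k * bin n (real k / real n) k) \<le> ln 1" "ln (exp (- 5 / 4)) \<le> ln (sd n k * bin n (real k / real n) k)"
    using b assms unfolding l by (simp, simp)
  moreover have "0 < sd n k * bin n (real k / real n) k" using pos by simp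
  ultimately have "sd n k * bin n (real k / real n) k \<le> 1" "exp (- 5 / 4) \<le> sd n k * bin n (real k / real n) k"
    by (simp_all only: ln_le_cancel_iff exp_gt_zero zero_less_one)
  then show "sd n k * bin n (real k / real n) k \<le> 1" "exp (- 5 / 4) / sd n k \<le> bin n (real k / real n) k"
    using pos by (simp_all add: divide_le_eq mult.commute)
qed

lemma sd_bin_mode_le_1:
  assumes "0 < n" "k \<le> n" shows "sd n k * bin n (real k / real n) k \<le> 1"
proof (cases "0 < k \<and> k < n")
  case True
  then show ?thesis using bin_mode_bounds by blast
next
  case False
  with assms have "sd n k = 0" by (auto simp: sd_def)
  then show ?thesis by simp
qed

text \<open>
  The logarithm of the quotient of the two probabilities is \<open>n\<close> times the Kullback-Leibler divergence
  of \<open>k / n\<close> from \<open>c / n\<close>, which is at most the \<open>\<chi>\<^sup>2\<close>-distance.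
\<close>

lemma bin_lower_bound:
  assumes c: "0 < c" "c < n" and k: "0 < k" "k < n"
  shows "bin n (real k / real n) k * exp (- (real k - real c)\<^sup>2 / (sd n c)\<^sup>2) \<le> bin n (real c / real n) k"
proof -
  define x where "x = real k / real n"
  define p where "p = real c / real n"
  have x: "0 < x" "x < 1" and p: "0 < p" "p < 1" and n: "0 < real n" using assms by (auto simp: x_def p_def)
  have nx: "real n * x = real k" "real n * (1 - x) = real (n - k)" using n k by (simp_all add: x_def field_simps of_nat_diff)
  have pos: "0 < bin n x k" "0 < bin n p k" using x p k by (auto intro!: bin_pos)
  have "ln (bin n x k) - ln (bin n p k) = real k * ln (x / p) + real (n - k) * ln ((1 - x) / (1 - p))"
    unfolding bin_def using x p k by (simp add: ln_mult ln_div ln_realpow zero_less_binomial_iff algebra_simps)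
  also have "\<dots> \<le> real k * (x / p - 1) + real (n - k) * ((1 - x) / (1 - p) - 1)"
    using x p by (intro add_mono mult_left_mono ln_le_minus_one) auto
  also have "\<dots> = real n * (x * (x / p - 1) + (1 - x) * ((1 - x) / (1 - p) - 1))"
    unfolding nx[symmetric] by (simp add: algebra_simps)
  also have "x * (x / p - 1) + (1 - x) * ((1 - x) / (1 - p) - 1) = (x - p)\<^sup>2 / (p * (1 - p))"
    using p by (simp add: field_simps power2_eq_square)
  also have "real n * ((x - p)\<^sup>2 / (p * (1 - p))) = (real k - real c)\<^sup>2 / (sd n c)\<^sup>2"
  proof -
    have "(x - p)\<^sup>2 = (real k - real c)\<^sup>2 / (real n)\<^sup>2"
      by (simp add: x_def p_def power_divide flip: diff_divide_distrib)
    moreover have "p * (1 - p) = (sd n c)\<^sup>2 / real n"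
      using c n by (simp add: p_def sd_def field_simps of_nat_diff)
    ultimately show ?thesis using n by (simp add: power2_eq_square)
  qed
  finally have "ln (bin n x k) - (real k - real c)\<^sup>2 / (sd n c)\<^sup>2 \<le> ln (bin n p k)" by simp
  then have "ln (bin n x k * exp (- (real k - real c)\<^sup>2 / (sd n c)\<^sup>2)) \<le> ln (bin n p k)"
    using pos by (simp add: ln_mult)
  then show ?thesis using pos unfolding x_def[symmetric] p_def[symmetric] by (subst (asm) ln_le_cancel_iff) auto
qed

text \<open>
  The Kullback-Leibler divergence is at least \<open>- 2\<close> times the logarithm of the Hellinger affinity of
  the two Bernoulli distributions. In terms of angles the affinity is the cosine of half their
  difference, which is why the decay is uniform in the angle.
\<close>

lemma bin_upper_bound:
  assumes p: "p \<in> {0..1}" and n: "0 < n" and k: "k \<le> n"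
  defines "x \<equiv> real k / real n"
  shows "bin n p k \<le> bin n x k * ((sqrt (x * p) + sqrt ((1 - x) * (1 - p)))\<^sup>2) ^ n"
proof -
  consider "k = 0" | "k = n" | "0 < k" "k < n" using k by linarith
  then show ?thesis
  proof cases
    case 1
    then show ?thesis using p by (simp add: bin_def x_def)
  next
    case 2
    then show ?thesis using p n by (simp add: bin_def x_def)
  next
    case 3
    have x: "0 < x" "x < 1" using 3 by (auto simp: x_def)
    have nx: "real n * x = real k" "real n * (1 - x) = real (n - k)" using n k by (simp_all add: x_def field_simps of_nat_diff)
    define h where "h = sqrt (x * p) + sqrt ((1 - x) * (1 - p))"
    have core: "p ^ k * (1 - p) ^ (n - k) \<le> x ^ k * (1 - x) ^ (n - k) * (h\<^sup>2) ^ n"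
    proof (cases "p = 0 \<or> p = 1")
      case True
      with 3 have "p ^ k * (1 - p) ^ (n - k) = 0" by auto
      moreover have "0 \<le> x ^ k * (1 - x) ^ (n - k) * (h\<^sup>2) ^ n" using x by simp
      ultimately show ?thesis by (simp only:)
    next
      case False
      then have p: "0 < p" "p < 1" using p by auto
      have h: "0 < h" using x p by (simp add: h_def add_pos_pos)
      \<comment> \<open>\<open>?a\<close> and \<open>?b\<close> form a probability distribution, so Gibbs' inequality bounds
        \<open>x ln (?a / x) + (1 - x) ln (?b / (1 - x))\<close> by 0\<close>
      let ?a = "sqrt (x * p) / h" and ?b = "sqrt ((1 - x) * (1 - p)) / h"
      have ab: "?a + ?b = 1" using h by (simp add: h_def flip: add_divide_distrib)
      have pa: "0 < ?a" "0 < ?b" using x p h by simp_all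
      have "real k * ln (?a / x) + real (n - k) * ln (?b / (1 - x)) \<le> real k * (?a / x - 1) + real (n - k) * (?b / (1 - x) - 1)"
        using divide_pos_pos[OF pa(1) x(1)] divide_pos_pos[OF pa(2), of "1 - x"] x
        by (intro add_mono mult_left_mono ln_le_minus_one) auto
      also have "\<dots> = real n * (?a - x + (?b - (1 - x)))"
      proof -
        have cancel: "y * (a / y - 1) = a - y" if "0 < y" for a y :: real
          using that by (simp add: right_diff_distrib)
        have "x * (?a / x - 1) = ?a - x" "(1 - x) * (?b / (1 - x) - 1) = ?b - (1 - x)"
          using x by (intro cancel; simp)+
        then show ?thesis unfolding nx[symmetric] by (simp only: mult.assoc distrib_left)
      qed
      also have "\<dots> = 0" using ab by simp
      finally have le: "real k * ln (?a / x) + real (n - k) * ln (?b / (1 - x)) \<le> 0" .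
      have logs: "ln (?a / x) = (ln p - ln x) / 2 - ln h" "ln (?b / (1 - x)) = (ln (1 - p) - ln (1 - x)) / 2 - ln h"
      proof -
        have "ln (sqrt (y * q) / h / y) = (ln q - ln y) / 2 - ln h" if "0 < y" "0 < q" for y q :: real
        proof -
          have "ln (sqrt (y * q) / h / y) = ln (sqrt (y * q)) - ln h - ln y"
            using that h by (subst ln_div, simp, simp, subst ln_div) auto
          then show ?thesis using that by (simp add: ln_sqrt ln_mult field_simps)
        qed
        from this[OF x(1) p(1)] this[of "1 - x" "1 - p"] x p
        show "ln (?a / x) = (ln p - ln x) / 2 - ln h" "ln (?b / (1 - x)) = (ln (1 - p) - ln (1 - x)) / 2 - ln h"
          by (simp_all only: diff_gt_0_iff_gt)
      qed
      have twice: "K * P + J * P' \<le> K * X + J * X' + 2 * (K + J) * H"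
        if "K * ((P - X) / 2 - H) + J * ((P' - X') / 2 - H) \<le> 0" for K J P P' X X' H :: real
        using that by (simp add: algebra_simps diff_divide_distrib)
      have split: "real k + real (n - k) = real n" using k by simp
      have "real k * ln p + real (n - k) * ln (1 - p) \<le> real k * ln x + real (n - k) * ln (1 - x) + 2 * real n * ln h"
        using twice[OF le[unfolded logs]] unfolding split .
      then have "ln (p ^ k * (1 - p) ^ (n - k)) \<le> ln (x ^ k * (1 - x) ^ (n - k) * (h\<^sup>2) ^ n)"
        using x p h by (simp add: ln_mult ln_realpow)
      then show ?thesis using x p h by (subst (asm) ln_le_cancel_iff) auto
    qed
    show ?thesis
      using mult_left_mono[OF core, of "real (n choose k)"] unfolding bin_def h_def by (simp add: mult.assoc)
  qed
qed

section \<open>The angle coordinate\<close>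

text \<open>
  The concave function \<open>sin\<close> lies above its chord on \<open>{0..pi / 2}\<close>.
\<close>

lemma sin_ge_linear:
  assumes "0 \<le> x" "x \<le> pi / 2"
  shows "2 / pi * x \<le> sin x"
proof -
  have "convex_on {0..pi/2} (\<lambda>x. - sin x)"
  proof (rule f''_ge0_imp_convex[where f' = "\<lambda>x. - cos x" and f'' = "\<lambda>x. sin x"])
    show "\<And>x. x \<in> {0..pi / 2} \<Longrightarrow> ((\<lambda>x. - sin x) has_real_derivative - cos x) (at x)"
      and "\<And>x. x \<in> {0..pi / 2} \<Longrightarrow> ((\<lambda>x. - cos x) has_real_derivative sin x) (at x)"
      by (auto intro!: derivative_eq_intros)
    show "\<And>x. x \<in> {0..pi / 2} \<Longrightarrow> 0 \<le> sin x" by (auto intro: sin_ge_zero)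
  qed auto
  moreover define t where "t = 2 * x / pi"
  have "0 \<le> t" "t \<le> 1" using assms by (auto simp: t_def field_simps)
  ultimately have "- sin ((1 - t) *\<^sub>R 0 + t *\<^sub>R (pi / 2)) \<le> (1 - t) * - sin 0 + t * - sin (pi / 2)"
    by (intro convex_onD) auto
  then show ?thesis by (simp add: t_def)
qed

lemma sin_square_ge:
  fixes x :: real
  assumes "\<bar>x\<bar> \<le> pi / 2"
  shows "(2 / pi * x)\<^sup>2 \<le> (sin x)\<^sup>2"
proof -
  have "(2 / pi * \<bar>x\<bar>)\<^sup>2 \<le> (sin \<bar>x\<bar>)\<^sup>2"
    using assms by (intro power_mono sin_ge_linear) auto
  then show ?thesis by (cases "0 \<le> x") (simp_all add: power2_eq_square)
qed

lemma cos_dist_le: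
  fixes a b d :: real
  assumes "\<bar>a - b\<bar> \<le> d"
  shows "\<bar>cos a - cos b\<bar> \<le> d\<^sup>2 / 2 + d * \<bar>sin a\<bar>"
proof -
  define e where "e = b - a"
  have e: "\<bar>e\<bar> \<le> d" using assms by (simp add: e_def abs_minus_commute)
  have "cos b = cos (a + e)" by (simp add: e_def)
  then have eq: "cos a - cos b = cos a * (1 - cos e) + sin a * sin e" by (simp add: cos_add algebra_simps)
  have "(sin (e / 2))\<^sup>2 \<le> (\<bar>e\<bar> / 2)\<^sup>2"
    using power_mono[OF abs_sin_x_le_abs_x[of "e / 2"], of 2] by simp
  moreover have "1 - cos e = 2 * (sin (e / 2))\<^sup>2" using cos_double_sin[of "e / 2"] by simp
  moreover have "\<bar>e\<bar>\<^sup>2 \<le> d\<^sup>2" using e by (intro power_mono) auto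
  ultimately have 1: "\<bar>1 - cos e\<bar> \<le> d\<^sup>2 / 2" by (simp add: power_divide)
  have 2: "\<bar>sin e\<bar> \<le> d" using abs_sin_x_le_abs_x[of e] e by linarith
  have "\<bar>cos a - cos b\<bar> \<le> \<bar>cos a\<bar> * \<bar>1 - cos e\<bar> + \<bar>sin a\<bar> * \<bar>sin e\<bar>"
    unfolding eq abs_mult[symmetric] by (rule abs_triangle_ineq)
  also have "\<dots> \<le> 1 * (d\<^sup>2 / 2) + \<bar>sin a\<bar> * d"
    using 1 2 by (intro add_mono mult_mono) auto
  finally show ?thesis by (simp add: mult.commute)
qed

text \<open>
  Near \<open>0\<close> and \<open>pi\<close> the cosine is flat, so the angle is only Hoelder continuous of exponent \<open>1 / 2\<close>
  as a function of the cosine. This suffices: an error \<open>O(1)\<close> in \<open>k\<close> changes \<open>cos \<theta>\<close> by \<open>O(1 / n)\<close>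
  and the angle by \<open>O(1 / sqrt n)\<close>, the width of a cell.
\<close>

lemma angle_square_dist_le:
  fixes a b :: real
  assumes "0 \<le> a" "a \<le> pi" "0 \<le> b" "b \<le> pi"
  shows "(a - b)\<^sup>2 \<le> pi\<^sup>2 / 2 * \<bar>cos a - cos b\<bar>"
  using assms
proof (induction a b rule: linorder_wlog)
  case (le a b)
  then have ab: "0 \<le> a" "b \<le> pi" "a \<le> b" by auto
  \<comment> \<open>the half difference is at most the half sum and its reflection at \<open>pi / 2\<close>\<close>
  have "sin ((b - a) / 2) \<le> sin ((a + b) / 2)"
  proof (cases "(a + b) / 2 \<le> pi / 2")
    case True
    then show ?thesis using le by (intro sin_monotone_2pi_le) auto
  next
    case False
    have "(b - a) / 2 \<le> pi - (a + b) / 2" using ab by (simp add: field_simps)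
    then have "sin ((b - a) / 2) \<le> sin (pi - (a + b) / 2)"
      using False ab by (intro sin_monotone_2pi_le) auto
    then show ?thesis by simp
  qed
  moreover have "0 \<le> sin ((b - a) / 2)" using le by (intro sin_ge_zero) auto
  ultimately have "(sin ((b - a) / 2))\<^sup>2 \<le> sin ((a + b) / 2) * sin ((b - a) / 2)"
    unfolding power2_eq_square by (intro mult_right_mono)
  moreover have "cos a - cos b = 2 * (sin ((a + b) / 2) * sin ((b - a) / 2))"
    by (simp add: cos_diff_cos)
  moreover have "(2 / pi * ((b - a) / 2))\<^sup>2 \<le> (sin ((b - a) / 2))\<^sup>2"
    using le by (intro sin_square_ge) auto
  ultimately have "2 * (2 / pi * ((b - a) / 2))\<^sup>2 \<le> cos a - cos b" by linarith
  also have "2 / pi * ((b - a) / 2) = (b - a) / pi"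
    using mult_divide_mult_cancel_left[of 2 "b - a" pi] by (simp only: times_divide_times_eq mult.commute[of pi])
  also have "cos a - cos b \<le> \<bar>cos a - cos b\<bar>" by simp
  finally have "2 * ((b - a) / pi)\<^sup>2 \<le> \<bar>cos a - cos b\<bar>" .
  then have "2 * (b - a)\<^sup>2 \<le> pi\<^sup>2 * \<bar>cos a - cos b\<bar>"
    unfolding power_divide by (simp add: divide_le_eq mult.commute)
  then show ?case by (simp add: power2_commute)
next
  case (sym a b)
  then show ?case by (simp add: power2_commute abs_minus_commute)
qed

text \<open>
  Each term is at most three times the integral of \<open>1 / (1 + (x - u)\<^sup>2)\<close> over the unit interval that
  starts at it; the integral over the line is \<open>pi\<close>.
\<close>

lemma sum_Cauchy_kernel:
  fixes u :: real
  shows "(\<Sum>s<N. 1 / (1 + (real s - u)\<^sup>2)) \<le> 3 * pi"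
proof -
  have kernel: "1 / (1 + (x - u)\<^sup>2) \<le> 3 * (arctan (x + 1 - u) - arctan (x - u))" for x :: real
  proof -
    have "\<exists>z>x - u. z < x + 1 - u \<and> arctan (x + 1 - u) - arctan (x - u) = (x + 1 - u - (x - u)) * inverse (1 + z\<^sup>2)"
      by (rule MVT2) (auto intro!: derivative_eq_intros simp: power2_eq_square)
    then obtain z where z: "x - u < z" "z < x - u + 1" and eq: "arctan (x + 1 - u) - arctan (x - u) = inverse (1 + z\<^sup>2)"
      by auto
    define y where "y = x - u"
    have "(z - y)\<^sup>2 \<le> 1" using z abs_square_le_1[of "z - y"] unfolding y_def by auto
    moreover have "z\<^sup>2 \<le> 2 * y\<^sup>2 + 2 * (z - y)\<^sup>2"
      using zero_le_power2[of "z - 2 * y"] by (simp add: power2_eq_square algebra_simps)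
    moreover have "0 \<le> y\<^sup>2" by simp
    moreover have "1 + a \<le> 3 * (1 + c)" if "b \<le> 1" "a \<le> 2 * c + 2 * b" "0 \<le> c" for a b c :: real
    proof -
      have "1 + a \<le> 1 + (2 * c + 2 * 1)" using that(1,2) by simp
      also have "\<dots> \<le> 3 * (1 + c)" using that(3) by simp
      finally show ?thesis .
    qed
    ultimately have "1 + z\<^sup>2 \<le> 3 * (1 + y\<^sup>2)" by blast
    moreover have "0 < 1 + z\<^sup>2" "0 < 1 + y\<^sup>2" by (simp_all add: add_pos_nonneg)
    ultimately show ?thesis unfolding eq unfolding y_def[symmetric] by (simp add: field_simps)
  qed
  have "(\<Sum>s<N. 1 / (1 + (real s - u)\<^sup>2)) \<le> (\<Sum>s<N. 3 * (arctan (real (Suc s) - u) - arctan (real s - u)))"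
  proof (rule sum_mono)
    fix s
    have "real (Suc s) = real s + 1" by simp
    then show "1 / (1 + (real s - u)\<^sup>2) \<le> 3 * (arctan (real (Suc s) - u) - arctan (real s - u))"
      using kernel[of "real s"] by (simp only:)
  qed
  also have "\<dots> = 3 * (arctan (real N - u) - arctan (real 0 - u))"
    unfolding sum_distrib_left[symmetric] by (subst sum_lessThan_telescope) simp
  also have "\<dots> \<le> 3 * pi"
    using arctan_ubound[of "real N - u"] arctan_lbound[of "real 0 - u"] by simp
  finally show ?thesis .
qed


text \<open>
  The angle is scaled by \<open>sqrt n\<close>, so that consecutive knots up to the angle \<open>pi\<close>
  are at distance 1.
\<close>

definition angle :: "nat \<Rightarrow> real \<Rightarrow> real" where
  "angle n x = sqrt (real n) * arccos (1 - 2 * x / real n)"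

text \<open>
  The constant of \<open>card_bin_le\<close>. Its first factor bounds \<open>|S|\<close> times the probability of \<open>k\<close> for
  \<open>p = k / n\<close>; its second factor pays for measuring distances from \<open>\<tau>\<close> instead of \<open>k\<close>.
\<close>

definition spread :: "real \<Rightarrow> real" where
  "spread C = (1 + 2 * C\<^sup>2 + 4 * C) * (1 + 2 * C\<^sup>2 + 2 * pi\<^sup>2)"

lemma card_le_diameter:
  fixes S :: "nat set"
  assumes "finite S" "\<And>k k'. k \<in> S \<Longrightarrow> k' \<in> S \<Longrightarrow> \<bar>real k - real k'\<bar> \<le> d"  "S \<noteq> {}"
  shows "real (card S) \<le> d + 1"
proof -
  have "S \<subseteq> {Min S..Max S}" using assms(1) by auto
  then have "card S \<le> Suc (Max S) - Min S" using card_mono[of "{Min S..Max S}" S] by simp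
  moreover have "Min S \<le> Max S" using assms by simp
  moreover have "\<bar>real (Max S) - real (Min S)\<bar> \<le> d" using assms by (intro assms(2)) auto
  ultimately show ?thesis by (simp add: of_nat_diff)
qed

context
  fixes n :: nat and N :: real
  assumes n: "0 < n"
  defines "N \<equiv> sqrt (real n)"
begin

lemma N_pos: "0 < N" and N_square: "N * N = real n"
  using n by (simp_all add: N_def)

lemma angle_arg: "0 \<le> x \<Longrightarrow> x \<le> real n \<Longrightarrow> - 1 \<le> 1 - 2 * x / real n \<and> 1 - 2 * x / real n \<le> 1"
  using n by (simp add: field_simps)

lemma angle_scaled: "angle n x = N * arccos (1 - 2 * x / real n)"
  by (simp add: angle_def N_def)

lemma angle_mono: "0 \<le> x \<Longrightarrow> x \<le> y \<Longrightarrow> y \<le> real n \<Longrightarrow> angle n x \<le> angle n y"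
  unfolding angle_scaled using N_pos angle_arg[of x] angle_arg[of y] n
  by (intro mult_left_mono arccos_le_mono[THEN iffD2]) (auto simp: field_simps)

lemma sin_arccos_position:
  assumes k: "k \<le> n"
  shows "sin (arccos (1 - 2 * real k / real n)) = 2 / N * sd n k"
proof -
  have "(1 - 2 * real k / real n)\<^sup>2 \<le> 1"
    using angle_arg[of "real k"] k by (simp add: abs_square_le_1 abs_le_iff)
  then have "sin (arccos (1 - 2 * real k / real n)) = sqrt (1 - (1 - 2 * real k / real n)\<^sup>2)"
    by (intro sin_arccos_abs) (simp add: abs_square_le_1)
  also have "1 - (1 - 2 * real k / real n)\<^sup>2 = (2 / N)\<^sup>2 * (real k * real (n - k) / real n)"
    using n k N_square by (simp add: power2_eq_square of_nat_diff field_simps)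
  also have "sqrt \<dots> = 2 / N * sd n k"
  proof -
    have "sqrt ((2 / N)\<^sup>2 * z) = 2 / N * sqrt z" for z using N_pos by (simp add: real_sqrt_mult)
    then show ?thesis unfolding sd_def .
  qed
  finally show ?thesis .
qed

text \<open>
  The derivative of the position with respect to the scaled angle is \<open>sd n k\<close>, and its second derivative
  is at most \<open>1 / 2\<close>.
\<close>

lemma dist_le_of_angle_dist:
  assumes k: "k \<le> n" and x: "0 \<le> x" "x \<le> real n" and d: "\<bar>angle n (real k) - angle n x\<bar> \<le> d"
  shows "\<bar>real k - x\<bar> \<le> d\<^sup>2 / 4 + d * sd n k"
proof -
  define a where "a = arccos (1 - 2 * real k / real n)"
  define b where "b = arccos (1 - 2 * x / real n)"
  have ca: "cos a = 1 - 2 * real k / real n" and cb: "cos b = 1 - 2 * x / real n"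
    using angle_arg[of "real k"] angle_arg[of x] k x by (simp_all add: a_def b_def)
  have sa: "\<bar>sin a\<bar> = 2 / N * sd n k" using sin_arccos_position[OF k] N_pos
    unfolding a_def by (simp add: sd_def)
  have "N * \<bar>a - b\<bar> \<le> d" using d N_pos unfolding angle_scaled a_def[symmetric] b_def[symmetric]
    by (simp add: abs_mult flip: right_diff_distrib)
  then have "\<bar>a - b\<bar> \<le> d / N" using N_pos by (simp add: field_simps)
  from cos_dist_le[OF this] have "\<bar>cos a - cos b\<bar> \<le> (d / N)\<^sup>2 / 2 + d / N * (2 / N * sd n k)"
    unfolding sa .
  then have "real n * \<bar>cos a - cos b\<bar> \<le> real n * ((d / N)\<^sup>2 / 2 + d / N * (2 / N * sd n k))"
    by (intro mult_left_mono) auto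
  also have "\<dots> = d\<^sup>2 / 2 + 2 * d * sd n k"
    using N_pos unfolding N_square[symmetric] by (simp add: field_simps power2_eq_square)
  also have "real n * \<bar>cos a - cos b\<bar> = \<bar>real n * (cos a - cos b)\<bar>" using n by (simp add: abs_mult)
  also have "real n * (cos a - cos b) = 2 * (x - real k)" using n by (simp add: ca cb field_simps)
  finally show ?thesis by simp
qed

lemma angle_dist_le_of_dist:
  assumes "0 \<le> x" "x \<le> real n" "0 \<le> y" "y \<le> real n" "\<bar>x - y\<bar> \<le> c"
  shows "\<bar>angle n x - angle n y\<bar> \<le> pi * sqrt c"
proof -
  define a where "a = arccos (1 - 2 * x / real n)"
  define b where "b = arccos (1 - 2 * y / real n)"
  have c: "0 \<le> c" using assms(5) by linarith
  have "(a - b)\<^sup>2 \<le> pi\<^sup>2 / 2 * \<bar>cos a - cos b\<bar>"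
    unfolding a_def b_def using angle_arg[of x] angle_arg[of y] assms
    by (intro angle_square_dist_le arccos_lbound arccos_ubound) auto
  also have "cos a - cos b = 2 / real n * (y - x)"
    unfolding a_def b_def using angle_arg[of x] angle_arg[of y] assms by (simp add: algebra_simps diff_divide_distrib)
  also have "\<bar>2 / real n * (y - x)\<bar> \<le> 2 / real n * c"
    unfolding abs_mult using assms(5) n by (intro mult_mono) auto
  finally have "(a - b)\<^sup>2 \<le> pi\<^sup>2 / 2 * (2 / real n * c)" by (simp add: mult_left_mono)
  then have "real n * (a - b)\<^sup>2 \<le> pi\<^sup>2 * c" using n by (simp add: field_simps)
  moreover have "(angle n x - angle n y)\<^sup>2 = real n * (a - b)\<^sup>2"
  proof -
    have "(N * a - N * b)\<^sup>2 = (N * N) * (a - b)\<^sup>2" by (simp add: power2_eq_square algebra_simps)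
    then show ?thesis unfolding N_square angle_scaled a_def b_def .
  qed
  moreover have "(pi * sqrt c)\<^sup>2 = pi\<^sup>2 * c" using c by (simp add: power_mult_distrib)
  ultimately have "(angle n x - angle n y)\<^sup>2 \<le> (pi * sqrt c)\<^sup>2" by simp
  then show ?thesis using c abs_le_square_iff[of "angle n x - angle n y" "pi * sqrt c"] by simp
qed

lemma knot_range: "0 \<le> knot n s" "knot n s \<le> real n"
proof -
  have "0 \<le> 1 - cos (real s / sqrt (real n))" "1 - cos (real s / sqrt (real n)) \<le> 2"
    using cos_le_one[of "real s / sqrt (real n)"] cos_ge_minus_one[of "real s / sqrt (real n)"] by linarith+
  then show "0 \<le> knot n s" "knot n s \<le> real n"
    unfolding knot_def using mult_left_mono[of "1 - cos (real s / sqrt (real n))" 2 "real n / 2"] by auto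
qed

lemma angle_knot: "angle n (knot n s) = N * arccos (cos (real s / N))"
proof -
  have "1 - 2 * knot n s / real n = cos (real s / N)" using n by (simp add: knot_def N_def field_simps)
  then show ?thesis by (simp add: angle_scaled)
qed

text \<open>
  The formula for the knots is not restricted to indices up to \<open>last_index n\<close>. Past the angle \<open>pi\<close> the knots
  return on the same path. This has to be admitted, because the last index is not decided by
  the programs below.
\<close>

lemma angle_knot_folded:
  assumes "real s \<le> 2 * pi * N"
  shows "angle n (knot n s) = pi * N - \<bar>real s - pi * N\<bar>"
proof -
  have s: "0 \<le> real s / N" "real s / N \<le> 2 * pi" using assms N_pos by (simp_all add: field_simps)
  show ?thesis
  proof (cases "real s / N \<le> pi")
    case True
    then show ?thesis using s N_pos by (simp add: angle_knot arccos_cos field_simps)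
  next
    case False
    then have "arccos (cos (2 * pi - real s / N)) = 2 * pi - real s / N"
      using s by (intro arccos_cos) auto
    moreover have "cos (real s / N) = cos (2 * pi - real s / N)" by (simp add: cos_diff)
    ultimately have "angle n (knot n s) = N * (2 * pi - real s / N)" by (simp only: angle_knot)
    also have "\<dots> = 2 * pi * N - real s" using N_pos by (simp add: right_diff_distrib)
    finally show ?thesis using False N_pos by (simp add: field_simps)
  qed
qed

lemma angle_near_knot:
  assumes "real (Suc s) \<le> 2 * pi * N" "k \<le> n" "knot n s - c \<le> real k" "real k \<le> knot n (Suc s) + c" "0 \<le> c"
  shows "\<bar>angle n (real k) - angle n (knot n s)\<bar> \<le> pi * sqrt c + 1"
proof -
  have step: "\<bar>angle n (knot n (Suc s)) - angle n (knot n s)\<bar> \<le> 1"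
    using assms(1) by (simp add: angle_knot_folded)
  have pc: "0 \<le> pi * sqrt c" using assms(5) by simp
  have "angle n (knot n s) - pi * sqrt c \<le> angle n (real k)"
  proof (cases "knot n s \<le> real k")
    case True
    then show ?thesis using angle_mono[of "knot n s" "real k"] knot_range assms(2) pc by force
  next
    case False
    then show ?thesis using angle_dist_le_of_dist[of "knot n s" "real k" c] knot_range assms by force
  qed
  moreover have "angle n (real k) \<le> angle n (knot n (Suc s)) + pi * sqrt c"
  proof (cases "real k \<le> knot n (Suc s)")
    case True
    then show ?thesis using angle_mono[of "real k" "knot n (Suc s)"] knot_range pc by force
  next
    case False
    then show ?thesis using angle_dist_le_of_dist[of "real k" "knot n (Suc s)" c] knot_range assms by force
  qed
  ultimately show ?thesis using step by linarith
qed

section \<open>Decay of binomial probabilities in the angle\<close>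

text \<open>
  A weak form of \<open>cos x ^ (2 n) \<le> exp (- n x\<^sup>2)\<close>; quadratic decay is enough for summability.
\<close>

lemma cos_power_decay:
  fixes x :: real
  assumes "\<bar>x\<bar> \<le> pi / 2"
  shows "((cos x)\<^sup>2) ^ n \<le> 1 / (1 + real n * (2 / pi * x)\<^sup>2)"
proof -
  let ?s = "(sin x)\<^sup>2"
  have s: "0 \<le> ?s" "?s \<le> 1" using abs_sin_le_one[of x] by (auto simp: abs_square_le_1)
  have "((cos x)\<^sup>2) ^ n * (1 + real n * ?s) \<le> (1 - ?s) ^ n * (1 + ?s) ^ n"
  proof -
    have "- 1 \<le> ?s" using s by linarith
    from Bernoulli_inequality[OF this, of n] show ?thesis
      unfolding cos_squared_eq using s by (intro mult_left_mono) auto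
  qed
  also have "\<dots> = (1 - ?s\<^sup>2) ^ n" by (simp add: power2_eq_square algebra_simps flip: power_mult_distrib)
  also have "\<dots> \<le> 1"
    using zero_le_power2[of ?s] power_le_one[OF s, of 2] by (intro power_le_one) (simp_all only: diff_ge_0_iff_ge diff_le_eq le_add_same_cancel1)
  finally have 1: "((cos x)\<^sup>2) ^ n * (1 + real n * ?s) \<le> 1" .
  have pos: "0 < 1 + real n * (2 / pi * x)\<^sup>2" by (simp add: add_pos_nonneg)
  have "((cos x)\<^sup>2) ^ n * (1 + real n * (2 / pi * x)\<^sup>2) \<le> ((cos x)\<^sup>2) ^ n * (1 + real n * ?s)"
    using sin_square_ge[OF assms] by (intro mult_left_mono add_left_mono) auto
  also note 1
  finally show ?thesis using pos by (simp add: field_simps)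
qed

lemma bin_decay:
  assumes p: "p \<in> {0..1}" and k: "k \<le> n"
  shows "bin n p k \<le> bin n (real k / real n) k * (1 / (1 + (angle n (real k) - angle n (real n * p))\<^sup>2 / pi\<^sup>2))"
proof -
  define a where "a = arccos (1 - 2 * real k / real n)"
  define b where "b = arccos (1 - 2 * p)"
  define x where "x = real k / real n"
  have ab: "0 \<le> a" "a \<le> pi" "0 \<le> b" "b \<le> pi" and ca: "cos a = 1 - 2 * x" and cb: "cos b = 1 - 2 * p"
    unfolding a_def b_def x_def using angle_arg[of "real k"] k p by (auto intro!: arccos_lbound arccos_ubound)
  have half: "sqrt ((1 - cos t) / 2) = sin (t / 2)" "sqrt ((1 + cos t) / 2) = cos (t / 2)" if "0 \<le> t" "t \<le> pi" for t
    using that sin_ge_zero[of "t / 2"] cos_ge_zero[of "t / 2"] cos_double_sin[of "t / 2"] cos_double_cos[of "t / 2"]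
    by (auto intro!: real_sqrt_unique)
  have "sqrt (x * p) + sqrt ((1 - x) * (1 - p)) = cos ((a - b) / 2)"
    using half[OF ab(1,2)] half[OF ab(3,4)] unfolding ca cb by (simp add: real_sqrt_mult diff_divide_distrib cos_diff)
  with bin_upper_bound[OF p n k] have "bin n p k \<le> bin n x k * ((cos ((a - b) / 2))\<^sup>2) ^ n"
    by (simp add: x_def)
  also have "\<dots> \<le> bin n x k * (1 / (1 + real n * (2 / pi * ((a - b) / 2))\<^sup>2))"
    using k n ab by (intro mult_left_mono cos_power_decay bin_nonneg) (auto simp: x_def)
  also have "real n * (2 / pi * ((a - b) / 2))\<^sup>2 = (angle n (real k) - angle n (real n * p))\<^sup>2 / pi\<^sup>2"
  proof -
    have "(N * a - N * b)\<^sup>2 / pi\<^sup>2 = (N * N) * (2 / pi * ((a - b) / 2))\<^sup>2"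
      by (simp add: power2_eq_square field_simps)
    moreover have "angle n (real k) = N * a" "angle n (real n * p) = N * b"
      using n by (simp_all add: angle_scaled a_def b_def)
    ultimately show ?thesis unfolding N_square by simp
  qed
  finally show ?thesis by (simp add: x_def)
qed

text \<open>
  All points of \<open>S\<close> have almost the same angle, hence \<open>S\<close> has at most a constant times \<open>sd n k + 1\<close> points, while
  no measure gives \<open>k\<close> more than \<open>1 / sd n k\<close>. The remaining factor is the decay in the angle.
\<close>

lemma card_bin_le:
  assumes p: "p \<in> {0..1}" and S: "S \<subseteq> {..n}" and C: "0 \<le> C"
    and near: "\<And>k. k \<in> S \<Longrightarrow> \<bar>angle n (real k) - \<tau>\<bar> \<le> C" and k: "k \<in> S"
  shows "real (card S) * bin n p k \<le> spread C / (1 + (\<tau> - angle n (real n * p))\<^sup>2)"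
proof -
  define B where "B = bin n (real k / real n) k"
  have kn: "k \<le> n" using S k by auto
  have B: "0 \<le> B" "B \<le> 1" "sd n k * B \<le> 1"
    unfolding B_def using kn n by (auto intro!: bin_nonneg bin_le_1 sd_bin_mode_le_1)
  have sd: "0 \<le> sd n k" by (simp add: sd_def)
  have dist: "\<bar>real k - real k'\<bar> \<le> C\<^sup>2 + 2 * C * sd n k" if "k' \<in> S" for k'
  proof -
    have "\<bar>angle n (real k) - angle n (real k')\<bar> \<le> 2 * C" using near[OF k] near[OF that] by linarith
    moreover have "k' \<le> n" using that S by auto
    ultimately show ?thesis using dist_le_of_angle_dist[of k "real k'" "2 * C"] kn by (simp add: power_mult_distrib)
  qed
  define d where "d = C\<^sup>2 + 2 * C * sd n k"
  have "real (card S) \<le> 2 * d + 1"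
  proof (rule card_le_diameter)
    show "finite S" using S finite_subset by blast
    show "S \<noteq> {}" using k by auto
  next
    fix i j assume "i \<in> S" "j \<in> S"
    with dist have "\<bar>real k - real i\<bar> \<le> d" "\<bar>real k - real j\<bar> \<le> d" unfolding d_def by blast+
    then show "\<bar>real i - real j\<bar> \<le> 2 * d" by linarith
  qed
  then have "real (card S) * B \<le> (2 * d + 1) * B" using B by (intro mult_right_mono)
  also have "\<dots> = (1 + 2 * C\<^sup>2) * B + 4 * C * (sd n k * B)" by (simp add: d_def algebra_simps)
  also have "\<dots> \<le> (1 + 2 * C\<^sup>2) * 1 + 4 * C * 1" using B C by (intro add_mono mult_left_mono) auto
  finally have size: "real (card S) * B \<le> 1 + 2 * C\<^sup>2 + 4 * C" by simp
  define w where "w = angle n (real k) - angle n (real n * p)"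
  define z where "z = \<tau> - angle n (real n * p)"
  have "\<bar>z - w\<bar>\<^sup>2 \<le> C\<^sup>2" using near[OF k] unfolding w_def z_def by (intro power_mono) auto
  then have "(z - w)\<^sup>2 \<le> C\<^sup>2" by simp
  moreover have "z\<^sup>2 \<le> 2 * w\<^sup>2 + 2 * (z - w)\<^sup>2"
    using zero_le_power2[of "z - 2 * w"] by (simp add: power2_eq_square algebra_simps)
  ultimately have z: "z\<^sup>2 \<le> 2 * w\<^sup>2 + 2 * C\<^sup>2" by (meson add_left_mono mult_left_mono order_trans zero_le_numeral)
  have "1 + z\<^sup>2 \<le> (1 + 2 * C\<^sup>2 + 2 * pi\<^sup>2) * (1 + w\<^sup>2 / pi\<^sup>2)"
  proof -
    have "(1 + 2 * C\<^sup>2 + 2 * pi\<^sup>2) * (1 + w\<^sup>2 / pi\<^sup>2) = 1 + 2 * C\<^sup>2 + 2 * w\<^sup>2 + (2 * pi\<^sup>2 + (1 + 2 * C\<^sup>2) * (w\<^sup>2 / pi\<^sup>2))"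
      by (simp add: field_simps)
    moreover have "0 \<le> 2 * pi\<^sup>2 + (1 + 2 * C\<^sup>2) * (w\<^sup>2 / pi\<^sup>2)" by simp
    ultimately show ?thesis using z by linarith
  qed
  moreover have "0 < 1 + w\<^sup>2 / pi\<^sup>2" "0 < 1 + z\<^sup>2" by (simp_all add: add_pos_nonneg)
  ultimately have decay: "1 / (1 + w\<^sup>2 / pi\<^sup>2) \<le> (1 + 2 * C\<^sup>2 + 2 * pi\<^sup>2) / (1 + z\<^sup>2)"
    by (simp add: divide_le_eq pos_le_divide_eq) 
  have "real (card S) * bin n p k \<le> real (card S) * (B * (1 / (1 + w\<^sup>2 / pi\<^sup>2)))"
    unfolding B_def w_def by (intro mult_left_mono bin_decay p kn) auto
  also have "\<dots> = (real (card S) * B) * (1 / (1 + w\<^sup>2 / pi\<^sup>2))" by simp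
  also have "\<dots> \<le> (1 + 2 * C\<^sup>2 + 4 * C) * ((1 + 2 * C\<^sup>2 + 2 * pi\<^sup>2) / (1 + z\<^sup>2))"
    using size decay B C by (intro mult_mono) auto
  finally show ?thesis by (simp add: spread_def z_def)
qed

text \<open>
  Folding at \<open>pi\<close> makes the knots run through two arithmetic progressions of step 1.
\<close>

lemma sum_knot_kernel:
  assumes "\<And>s. s \<in> I \<Longrightarrow> real s \<le> 2 * pi * N" "finite I"
  shows "(\<Sum>s\<in>I. 1 / (1 + (angle n (knot n s) - u)\<^sup>2)) \<le> 6 * pi"
proof -
  let ?g = "\<lambda>v s. 1 / (1 + (real s - v)\<^sup>2)"
  have g: "0 \<le> ?g v s" for v :: real and s :: nat by (simp add: add_nonneg_nonneg)
  have "1 / (1 + (angle n (knot n s) - u)\<^sup>2) \<le> ?g u s + ?g (2 * pi * N - u) s" if "s \<in> I" for s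
  proof -
    have "angle n (knot n s) = real s \<or> angle n (knot n s) = 2 * pi * N - real s"
      using angle_knot_folded[OF assms(1)[OF that]] by (auto simp: abs_if)
    then show ?thesis
    proof
      assume "angle n (knot n s) = real s"
      then show ?thesis using g[of s "2 * pi * N - u"] by simp
    next
      assume *: "angle n (knot n s) = 2 * pi * N - real s"
      have "(2 * pi * N - real s - u)\<^sup>2 = (real s - (2 * pi * N - u))\<^sup>2" by (simp add: power2_eq_square algebra_simps)
      then show ?thesis using g[of s u] unfolding * by simp
    qed
  qed
  then have "(\<Sum>s\<in>I. 1 / (1 + (angle n (knot n s) - u)\<^sup>2)) \<le> (\<Sum>s\<in>I. ?g u s + ?g (2 * pi * N - u) s)"
    by (rule sum_mono)
  also have "\<dots> \<le> (\<Sum>s<Suc (Max I). ?g u s + ?g (2 * pi * N - u) s)"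
  proof (rule sum_mono2)
    show "I \<subseteq> {..<Suc (Max I)}" using assms(2) by (auto simp: less_Suc_eq_le)
    show "\<And>s. s \<in> {..<Suc (Max I)} - I \<Longrightarrow> 0 \<le> ?g u s + ?g (2 * pi * N - u) s"
      by (intro add_nonneg_nonneg g)
  qed simp
  also have "\<dots> \<le> 3 * pi + 3 * pi" unfolding sum.distrib by (intro add_mono sum_Cauchy_kernel)
  finally show ?thesis by simp
qed


section \<open>Binomial probabilities on a cell\<close>

lemma knot_near_end:
  assumes "\<bar>pi * N - real s\<bar> \<le> 1" shows "real n - knot n s \<le> 1 / 4"
proof -
  have "\<bar>pi - real s / N\<bar> * N \<le> 1"
  proof -
    have "\<bar>pi - real s / N\<bar> * N = \<bar>(pi - real s / N) * N\<bar>" using N_pos by (simp add: abs_mult)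
    also have "(pi - real s / N) * N = pi * N - real s" using N_pos by (simp add: left_diff_distrib)
    finally show ?thesis using assms by simp
  qed
  then have "\<bar>pi - real s / N\<bar> \<le> 1 / N" using N_pos by (simp add: field_simps)
  from cos_dist_le[OF this] have "1 + cos (real s / N) \<le> (1 / N)\<^sup>2 / 2" by simp
  then have "real n * (1 + cos (real s / N)) \<le> (N * N) * ((1 / N)\<^sup>2 / 2)"
    unfolding N_square by (intro mult_left_mono) auto
  then have "real n * (1 + cos (real s / N)) \<le> 1 / 2" using N_pos by (simp add: power2_eq_square)
  then show ?thesis by (simp add: knot_def N_def algebra_simps)
qed

lemma last_index_bounds: "real (last_index n) \<le> pi * N" "pi * N < real (last_index n) + 1"
proof -
  have "0 \<le> pi * N" using N_pos by simp
  then show "real (last_index n) \<le> pi * N" "pi * N < real (last_index n) + 1"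
    unfolding last_index_def N_def by linarith+
qed

lemma last_index_pos: "0 < last_index n"
proof -
  have "1 \<le> N" using n by (simp add: N_def)
  then have "pi * 1 \<le> pi * N" by (intro mult_left_mono) auto
  then have "1 < pi * N" using pi_gt3 by linarith
  then show ?thesis using last_index_bounds by linarith
qed

lemma knot_last: "real n - knot n (last_index n) \<le> 1 / 4" "real n - knot n (Suc (last_index n)) \<le> 1 / 4"
  using last_index_bounds by (intro knot_near_end, simp add: abs_le_iff)+

lemma angle_knot_eq: "s \<le> last_index n \<Longrightarrow> angle n (knot n s) = real s"
proof -
  assume "s \<le> last_index n"
  then have "real s \<le> pi * N" using last_index_bounds by linarith
  moreover have "0 \<le> pi * N" using N_pos by simp
  ultimately have "\<bar>real s - pi * N\<bar> = pi * N - real s" "real s \<le> 2 * pi * N" by auto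
  then show ?thesis by (simp add: angle_knot_folded)
qed

lemma knot_1: "knot n 1 \<le> 1 / 4"
proof -
  have "\<bar>cos 0 - cos (1 / N)\<bar> \<le> (1 / N)\<^sup>2 / 2 + 1 / N * \<bar>sin 0\<bar>" using N_pos by (intro cos_dist_le) simp
  then have "1 - cos (1 / N) \<le> (1 / N)\<^sup>2 / 2" by simp
  then have "real n * (1 - cos (1 / N)) \<le> (N * N) * ((1 / N)\<^sup>2 / 2)"
    unfolding N_square by (intro mult_left_mono) auto
  then have "real n * (1 - cos (1 / N)) \<le> 1 / 2" using N_pos by (simp add: power2_eq_square)
  then show ?thesis by (simp add: knot_def N_def)
qed

lemma knot_0: "knot n 0 = 0"
  by (simp add: knot_def)

text \<open>
  The end cells are singletons, since the first and the last step of the partition move the position by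
  at most \<open>1 / 4\<close>. This is why all other cells avoid the degenerate measures.
\<close>

lemma block_cases:
  assumes "s \<le> last_index n"
  obtains "s = 0" "block n s = {0}" | "s = last_index n" "block n s = {n}"
    | "0 < s" "s < last_index n" "\<And>k. k \<in> block n s \<Longrightarrow> 0 < k \<and> k < n"
proof -
  consider "s = 0" | "s = last_index n" | "0 < s" "s < last_index n" using assms by linarith
  then show thesis
  proof cases
    case 1
    have "block n s = {0}"
    proof (intro equalityI subsetI)
      fix k assume "k \<in> block n s"
      then have "real k < knot n 1" using 1 last_index_pos by (simp add: block_def)
      then show "k \<in> {0}" using knot_1 by simp
    next
      have "0 \<noteq> knot n 1"
        using angle_knot_eq[of 1] angle_knot_eq[of 0] last_index_pos knot_0 by auto
      then have "0 < knot n 1" using knot_range[of 1] by linarith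
      fix k :: nat assume "k \<in> {0}"
      then show "k \<in> block n s" using 1 \<open>0 < knot n 1\<close> by (simp add: block_def knot_0)
    qed
    with 1 that show thesis by blast
  next
    case 2
    have "block n s = {n}"
    proof (intro equalityI subsetI)
      fix k assume "k \<in> block n s"
      then have "knot n (last_index n) \<le> real k" "k \<le> n" using 2 by (simp_all add: block_def)
      then have "real n - real k \<le> 1 / 4" using knot_last by linarith
      then show "k \<in> {n}" using \<open>k \<le> n\<close> by simp
    qed (use 2 knot_range in \<open>simp add: block_def\<close>)
    with 2 that show thesis by blast
  next
    case 3
    have "0 < k \<and> k < n" if "k \<in> block n s" for k
    proof -
      have k: "knot n s \<le> real k" "real k < knot n (Suc s)" using that 3 by (simp_all add: block_def)
      then have "k < n" using knot_range[of "Suc s"] by linarith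
      moreover have "knot n s \<noteq> 0"
        using angle_knot_eq[of s] angle_knot_eq[of 0] 3 knot_0 by auto
      then have "0 < knot n s" using knot_range[of s] by linarith
      ultimately show ?thesis using k by linarith
    qed
    with 3 that show thesis by blast
  qed
qed

text \<open>
  A step of 1 in the scaled angle moves the position by about \<open>sd n k\<close>, and an interval of length \<open>x\<close>
  contains more than \<open>x - 1\<close> integers. If \<open>sd n k \<le> 5\<close>, it suffices that the cell is not empty.
\<close>

lemma card_block_ge:
  assumes s: "s < last_index n" and k: "k \<in> block n s"
  shows "sd n k / 5 \<le> real (card (block n s))"
proof -
  define a where "a = real s / N"
  define b where "b = real (Suc s) / N"
  define t where "t = arccos (1 - 2 * real k / real n)"
  define x where "x = knot n s"
  define y where "y = knot n (Suc s)"
  have k': "k \<le> n" "x \<le> real k" "real k < y" using k s by (simp_all add: block_def x_def y_def)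
  have ang: "angle n x = real s" "angle n y = real (Suc s)"
    unfolding x_def y_def using s by (simp_all add: angle_knot_eq)
  have "angle n x \<le> angle n (real k)" "angle n (real k) \<le> angle n y"
    using k' knot_range unfolding x_def y_def by (auto intro!: angle_mono)
  moreover have "angle n (real k) = N * t" by (simp add: angle_scaled t_def)
  ultimately have t: "a \<le> t" "t \<le> b" unfolding ang a_def b_def
    using N_pos by (simp_all add: field_simps)
  have ba: "b - a = 1 / N" by (simp add: a_def b_def flip: diff_divide_distrib)
  have "\<bar>sin t - sin ((a + b) / 2)\<bar> \<le> 1 / N"
  proof -
    have "\<bar>sin u - sin v\<bar> \<le> \<bar>u - v\<bar>" for u v :: real
    proof -
      have "\<bar>sin u - sin v\<bar> = 2 * \<bar>sin ((u - v) / 2)\<bar> * \<bar>cos ((u + v) / 2)\<bar>"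
        by (simp add: sin_diff_sin abs_mult)
      also have "\<dots> \<le> 2 * \<bar>(u - v) / 2\<bar> * 1"
        using abs_sin_x_le_abs_x[of "(u - v) / 2"] by (intro mult_mono) auto
      finally show ?thesis by simp
    qed
    then have "\<bar>sin t - sin ((a + b) / 2)\<bar> \<le> \<bar>t - (a + b) / 2\<bar>" .
    moreover have "\<bar>t - (a + b) / 2\<bar> \<le> b - a" using t by (simp add: abs_le_iff field_simps)
    ultimately show ?thesis unfolding ba by (rule order_trans)
  qed
  then have mid: "sin t - 1 / N \<le> sin ((a + b) / 2)" by linarith
  have st: "N * sin t = 2 * sd n k"
    using sin_arccos_position[OF k'(1)] N_pos by (simp add: t_def)
  have fin: "finite (block n s)" by (simp add: block_def)
  have "block n s \<noteq> {}" using k by blast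
  then have "0 < card (block n s)" using fin by (simp add: card_gt_0_iff)
  then have one: "1 \<le> real (card (block n s))" by linarith
  show ?thesis
  proof (cases "sd n k \<le> 5")
    case True
    with one show ?thesis by linarith
  next
    case False
    have N1: "1 \<le> N" using n by (simp add: N_def)
    have "1 / pi * (1 / N) \<le> sin (1 / N / 2)"
    proof -
      have "1 / N \<le> 1" "0 \<le> 1 / N" using N1 by simp_all
      moreover have "2 / pi * (d / 2) \<le> sin (d / 2)" if "d \<le> 1" "0 \<le> d" for d :: real
        using that pi_gt3 by (intro sin_ge_linear) linarith+
      ultimately have "2 / pi * (1 / N / 2) \<le> sin (1 / N / 2)" by blast
      then show ?thesis by simp
    qed
    moreover have "0 \<le> sin t - 1 / N"
    proof -
      have "1 \<le> N * sin t" using False st by linarith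
      then show ?thesis using N_pos by (simp add: field_simps)
    qed
    ultimately have "(sin t - 1 / N) * (1 / pi * (1 / N)) \<le> sin ((a + b) / 2) * sin (1 / N / 2)"
      using mid N_pos by (intro mult_mono) auto
    moreover have "y - x = real n * (sin ((a + b) / 2) * sin (1 / N / 2))"
    proof -
      have "y - x = real n / 2 * (cos a - cos b)" by (simp add: x_def y_def knot_def a_def b_def N_def algebra_simps)
      also have "cos a - cos b = 2 * sin ((a + b) / 2) * sin ((b - a) / 2)" by (rule cos_diff_cos)
      finally show ?thesis by (simp add: ba)
    qed
    ultimately have "real n * ((sin t - 1 / N) * (1 / pi * (1 / N))) \<le> y - x"
      by (metis mult_left_mono of_nat_0_le_iff)
    also have "real n * ((sin t - 1 / N) * (1 / pi * (1 / N))) = (N * sin t - 1) / pi"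
    proof -
      have "(N * N) * ((z - 1 / N) * (1 / pi * (1 / N))) = (N * z - 1) / pi" for z
        using N_pos by (simp add: field_simps)
      then show ?thesis unfolding N_square .
    qed
    finally have yx: "(2 * sd n k - 1) / pi \<le> y - x" unfolding st .
    have "(2 * sd n k - 1) / 4 \<le> (2 * sd n k - 1) / pi"
      using False pi_less_4 by (intro divide_left_mono) auto
    with yx have len: "(2 * sd n k - 1) / 4 \<le> y - x" by linarith
    have "{nat \<lceil>x\<rceil>..<nat \<lceil>y\<rceil>} \<subseteq> block n s"
    proof
      fix j assume "j \<in> {nat \<lceil>x\<rceil>..<nat \<lceil>y\<rceil>}"
      then have "x \<le> real j" "real j < y" by (auto simp: nat_le_iff ceiling_le_iff less_ceiling_iff zless_nat_eq_int_zless)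
      then show "j \<in> block n s" using knot_range[of "Suc s"] by (simp add: block_def x_def y_def)
    qed
    from card_mono[OF fin this] have "nat \<lceil>y\<rceil> - nat \<lceil>x\<rceil> \<le> card (block n s)" by simp
    then have "nat \<lceil>y\<rceil> \<le> nat \<lceil>x\<rceil> + card (block n s)" by (simp only: le_diff_conv add.commute)
    then have "real (nat \<lceil>y\<rceil>) \<le> real (nat \<lceil>x\<rceil>) + real (card (block n s))" by linarith
    moreover have "y \<le> real (nat \<lceil>y\<rceil>)" by (rule real_nat_ceiling_ge)
    moreover have "real (nat \<lceil>x\<rceil>) \<le> x + 1"
      using knot_range[of s] ceiling_correct[of x] unfolding x_def[symmetric] by simp
    ultimately have "y - x - 1 \<le> real (card (block n s))" by linarith
    moreover have "(2 * sd n k - 1) / 4 = sd n k / 2 - 1 / 4" by (simp add: diff_divide_distrib)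
    ultimately show ?thesis using len False by linarith
  qed
qed

text \<open>
  Within a cell \<open>k\<close> and \<open>c\<close> differ by at most \<open>sd n c + 1 / 4\<close>, so moving the
  parameter from \<open>k / n\<close> to \<open>c / n\<close> costs only a constant factor, and the probability of \<open>k\<close> for \<open>k / n\<close>
  is of the order \<open>1 / sd n k\<close>.
\<close>

lemma bin_block_ge:
  assumes s: "s \<le> last_index n" and c: "c \<in> block n s" and k: "k \<in> block n s"
  shows "1 \<le> 2 ^ 9 * real (card (block n s)) * bin n (real c / real n) k"
  using s
proof (cases rule: block_cases)
  case 1
  then have "c = 0" "k = 0" using c k by auto
  then show ?thesis using 1 by (simp add: bin_def)
next
  case 2
  then have "c = n" "k = n" using c k by auto
  then show ?thesis using 2 n by (simp add: bin_def)
next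
  case 3
  have c': "0 < c" "c < n" and k': "0 < k" "k < n" using 3 c k by auto
  have sdk: "0 < sd n k" using k' by (rule sd_pos)
  have ang: "angle n (knot n s) = real s" "angle n (knot n (Suc s)) = real (Suc s)"
    using 3 by (simp_all add: angle_knot_eq)
  have "real s \<le> angle n (real j) \<and> angle n (real j) \<le> real (Suc s)" if "j \<in> block n s" for j
  proof -
    have "knot n s \<le> real j" "real j < knot n (Suc s)" using that 3 by (simp_all add: block_def)
    then show ?thesis unfolding ang[symmetric] using knot_range[of s] knot_range[of "Suc s"] by (auto intro!: angle_mono)
  qed
  from this[OF c] this[OF k] have "\<bar>angle n (real c) - angle n (real k)\<bar> \<le> 1" by auto
  from dist_le_of_angle_dist[OF _ _ _ this] c' k' have dist: "\<bar>real c - real k\<bar> \<le> 1 / 4 + sd n c" by simp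
  have "sqrt (1 / 2) \<le> sd n c"
  proof -
    have "(real c - 1) * (real n - real c - 1) \<ge> 0" using c' by (intro mult_nonneg_nonneg) auto
    then have "real n - 1 \<le> real c * real (n - c)" using c' by (simp add: algebra_simps of_nat_diff)
    moreover have "real n / 2 \<le> real n - 1" using c' by simp
    ultimately have "real n / 2 \<le> real c * real (n - c)" by linarith
    then have "1 / 2 \<le> real c * real (n - c) / real n" using n by (simp add: le_divide_eq del: of_nat_diff)
    then show ?thesis unfolding sd_def by (rule real_sqrt_le_mono)
  qed
  moreover have "7 / 10 \<le> sqrt (1 / 2 :: real)" by (intro real_le_rsqrt) (simp add: power2_eq_square)
  ultimately have sdc: "7 / 10 \<le> sd n c" by linarith
  have "\<bar>real c - real k\<bar>\<^sup>2 \<le> (1 / 4 + sd n c)\<^sup>2" using dist by (intro power_mono) auto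
  also have "\<dots> \<le> 2 * (sd n c)\<^sup>2"
  proof -
    have "7 / 10 * sd n c \<le> sd n c * sd n c" using sdc by (intro mult_right_mono) auto
    moreover have "(1 / 4 + sd n c)\<^sup>2 = 1 / 16 + sd n c / 2 + sd n c * sd n c"
      by (simp add: power2_eq_square algebra_simps)
    ultimately show ?thesis unfolding power2_eq_square[of "sd n c"] using sdc by linarith
  qed
  finally have "(real k - real c)\<^sup>2 / (sd n c)\<^sup>2 \<le> 2"
    using sdc by (simp add: divide_le_eq power2_commute[of "real c"])
  then have "exp (- 2) \<le> exp (- (real k - real c)\<^sup>2 / (sd n c)\<^sup>2)" by simp
  then have "exp (- 5 / 4) / sd n k * exp (- 2) \<le> bin n (real k / real n) k * exp (- (real k - real c)\<^sup>2 / (sd n c)\<^sup>2)"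
    using k' by (intro mult_mono bin_mode_bounds(1)[OF k'] bin_nonneg) auto
  also have "\<dots> \<le> bin n (real c / real n) k" by (rule bin_lower_bound[OF c' k'])
  finally have "exp (- 5 / 4) / sd n k * exp (- 2) \<le> bin n (real c / real n) k" .
  moreover have "exp (- 5 / 4) * exp (- 2 :: real) \<ge> 1 / 81"
  proof -
    have "exp (4 :: real) = exp 1 ^ 4" using exp_of_nat_mult[of 4 "1 :: real"] by simp
    also have "\<dots> \<le> 3 ^ 4" using exp_le by (intro power_mono) auto
    finally have "exp (4 :: real) \<le> 81" by simp
    then have "1 / 81 \<le> 1 / exp (4 :: real)" by (intro divide_left_mono) auto
    also have "1 / exp (4 :: real) = exp (- 4)" by (simp add: exp_minus inverse_eq_divide)
    also have "exp (- 4 :: real) \<le> exp (- 5 / 4 + - 2)" by simp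
    also have "\<dots> = exp (- 5 / 4) * exp (- 2)" by (rule exp_add)
    finally show ?thesis .
  qed
  ultimately have "1 / 81 / sd n k \<le> bin n (real c / real n) k"
    using sdk divide_right_mono[of "1 / 81" "exp (- 5 / 4) * exp (- 2 :: real)" "sd n k"] by simp
  then have "1 \<le> 81 * sd n k * bin n (real c / real n) k" using sdk by (simp add: field_simps)
  also have "\<dots> \<le> 2 ^ 9 * real (card (block n s)) * bin n (real c / real n) k"
    using card_block_ge[OF 3(2) k] c' by (intro mult_right_mono bin_nonneg) auto
  finally show ?thesis .
qed

end


section \<open>Computable approximation of the knots\<close>

text \<open>
  \<open>n\<^sup>2\<close> times the absolute value of the \<open>j\<close>-th term of the cosine series at \<open>s / sqrt n\<close>, rounded
  down. One factor \<open>n\<close> belongs to the knot; the other one turns the sum of \<open>n\<close> rounding errors into an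
  error \<open>O(1)\<close> of the knot. No square root appears, as the series has only even powers.
\<close>

definition cos_term :: "nat \<Rightarrow> nat \<Rightarrow> nat \<Rightarrow> nat" where
  "cos_term n s j = n * n * s ^ (2 * j) div (n ^ j * fact (2 * j))"

text \<open>
  The summand \<open>exp 25\<close> bounds the Taylor remainder for angles up to 5, the summand 5 pays for the
  rounding errors and for the distance 2 allowed in \<open>near_knotI\<close>.
\<close>

definition slack :: nat where
  "slack = nat \<lceil>exp (25 :: real)\<rceil> + 5"

text \<open>
  \<open>|2 n a - Q| \<le> n slack\<close>, where \<open>Q\<close> is the rounded series for \<open>2 n\<close> times the knot; the negative terms
  have been moved to the other side to stay within the natural numbers.
\<close>

definition near_knot :: "nat \<Rightarrow> nat \<Rightarrow> nat \<Rightarrow> bool" where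
  "near_knot n s a \<longleftrightarrow>
     2 * n * a + (\<Sum>j<n. if j mod 2 = 0 then cos_term n s j else 0)
       \<le> n * n + (\<Sum>j<n. if j mod 2 = 0 then 0 else cos_term n s j) + n * slack \<and>
     n * n + (\<Sum>j<n. if j mod 2 = 0 then 0 else cos_term n s j)
       \<le> 2 * n * a + (\<Sum>j<n. if j mod 2 = 0 then cos_term n s j else 0) + n * slack"

lemma computable_cos_term [computable_intros]:
  assumes f: "computable f" and g: "computable g" and h: "computable h"
  shows "computable (\<lambda>x. cos_term (f x) (g x) (h x))"
  unfolding cos_term_def by (intro computable_intros f g h)

lemma computable_near_knot [computable_intros]:
  assumes f: "computable f" and g: "computable g" and h: "computable h"
  shows "computable (\<lambda>x. of_bool (near_knot (f x) (g x) (h x)))"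
  unfolding near_knot_def
  by (intro computable_intros f g h computable_comp[OF f] computable_comp[OF g] computable_comp[OF h])

lemma cos_Taylor:
  fixes x :: real
  shows "\<bar>cos x - (\<Sum>j<J. (- 1) ^ j * x ^ (2 * j) / fact (2 * j))\<bar> \<le> (x\<^sup>2) ^ J / fact (2 * J)"
proof -
  obtain t where t: "cos x = (\<Sum>m<2 * J. cos_coeff m * x ^ m) + cos (t + 1 / 2 * real (2 * J) * pi) / fact (2 * J) * x ^ (2 * J)"
    using Maclaurin_cos_expansion[of x "2 * J"] by blast
  have "(\<Sum>m<2 * J. cos_coeff m * x ^ m) = (\<Sum>j<J. (- 1) ^ j * x ^ (2 * j) / fact (2 * j))"
    by (induction J) (simp_all add: cos_coeff_def)
  with t have "cos x - (\<Sum>j<J. (- 1) ^ j * x ^ (2 * j) / fact (2 * j)) = cos (t + 1 / 2 * real (2 * J) * pi) * ((x\<^sup>2) ^ J / fact (2 * J))"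
    by (simp add: power_mult)
  also have "\<bar>\<dots>\<bar> \<le> 1 * ((x\<^sup>2) ^ J / fact (2 * J))"
    unfolding abs_mult by (intro mult_mono) auto
  finally show ?thesis by simp
qed

text \<open>
  \<open>y ^ n / n! \<le> exp y\<close>, and \<open>(2 n)! \<ge> n! n!\<close>, where one factor \<open>n!\<close> absorbs \<open>n\<close>.
\<close>

lemma Taylor_remainder_le:
  fixes y :: real
  assumes "0 \<le> y" "y \<le> 25" "0 < n"
  shows "real n * (y ^ n / fact (2 * n)) \<le> exp 25"
proof -
  have "y ^ n / fact n \<le> exp y"
  proof -
    have s: "(\<lambda>i. y ^ i /\<^sub>R fact i) sums exp y" by (rule exp_converges)
    have "y ^ n /\<^sub>R fact n \<le> (\<Sum>i. y ^ i /\<^sub>R fact i)"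
      using sum_le_suminf[OF sums_summable[OF s], of "{n}"] assms(1) by simp
    also have "\<dots> = exp y" using s by (simp add: sums_iff)
    finally show ?thesis by (simp add: divide_inverse mult.commute)
  qed
  also have "exp y \<le> exp 25" using assms by simp
  finally have 1: "y ^ n / fact n \<le> exp 25" .
  have "(fact n * fact n :: nat) dvd fact (n + n)" by (rule fact_fact_dvd_fact)
  then have "(fact n * fact n :: nat) \<le> fact (2 * n)" by (intro dvd_imp_le) (simp_all add: mult_2)
  then have "real (fact n * fact n) \<le> real (fact (2 * n))" by (simp only: of_nat_le_iff)
  then have f: "fact n * fact n \<le> (fact (2 * n) :: real)" by simp
  have "real n \<le> real (fact n)" using fact_ge_self[of n] by (simp only: of_nat_le_iff)
  then have g: "real n \<le> fact n" by simp
  have "real n * (y ^ n / fact (2 * n)) \<le> fact n * (y ^ n / (fact n * fact n))"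
    using f g assms by (intro mult_mono divide_left_mono) auto
  also have "\<dots> = y ^ n / fact n" by simp
  finally show ?thesis using 1 by linarith
qed

lemma knot_approximation:
  assumes n: "0 < n" and s: "s * s \<le> 25 * n"
  shows "\<bar>2 * real n * knot n s -
      (real n * real n + real (\<Sum>j<n. if j mod 2 = 0 then 0 else cos_term n s j)
        - real (\<Sum>j<n. if j mod 2 = 0 then cos_term n s j else 0))\<bar> \<le> real n * (1 + exp 25)"
proof -
  define x where "x = real s / sqrt (real n)"
  have x2: "x\<^sup>2 = real (s * s) / real n" using n by (simp add: x_def power_divide power2_eq_square)
  have "real (s * s) \<le> real (25 * n)" using s by (simp only: of_nat_le_iff)
  then have y: "0 \<le> x\<^sup>2" "x\<^sup>2 \<le> 25" using n unfolding x2 by (simp_all add: field_simps)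
  let ?c = "\<lambda>j. (- 1) ^ j * x ^ (2 * j) / fact (2 * j) :: real"
  have close: "\<bar>real n * real n * (x ^ (2 * j) / fact (2 * j)) - real (cos_term n s j)\<bar> \<le> 1" for j
  proof -
    define a where "a = n * n * s ^ (2 * j)"
    define b where "b = n ^ j * (fact (2 * j) :: nat)"
    have b: "0 < b" using n by (simp add: b_def)
    have "x ^ (2 * j) = real s ^ (2 * j) / real n ^ j"
      unfolding power_mult x2 by (simp add: power_divide power2_eq_square)
    then have eq: "real n * real n * (x ^ (2 * j) / fact (2 * j)) = real a / real b"
      by (simp add: a_def b_def)
    have "real a = real b * real (a div b) + real (a mod b)"
      by (metis mult_div_mod_eq of_nat_add of_nat_mult)
    then have "real a / real b = real (a div b) + real (a mod b) / real b" using b by (simp add: field_simps)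
    moreover have "real (a mod b) / real b \<le> 1" "0 \<le> real (a mod b) / real b"
      using b mod_less_divisor[OF b, of a] by (auto simp: divide_le_eq)
    ultimately show ?thesis unfolding eq cos_term_def a_def[symmetric] b_def[symmetric] by simp
  qed
  have "\<bar>real n * real n * (\<Sum>j<n. ?c j) - (\<Sum>j<n. (- 1) ^ j * real (cos_term n s j))\<bar>
      = \<bar>\<Sum>j<n. (- 1) ^ j * (real n * real n * (x ^ (2 * j) / fact (2 * j)) - real (cos_term n s j))\<bar>"
    by (simp add: sum_distrib_left sum_subtractf algebra_simps)
  also have "\<dots> \<le> (\<Sum>j<n. \<bar>(- 1) ^ j * (real n * real n * (x ^ (2 * j) / fact (2 * j)) - real (cos_term n s j))\<bar>)"
    by (rule sum_abs)
  also have "\<dots> \<le> (\<Sum>j<n. 1)"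
    using close by (intro sum_mono) (simp add: abs_mult power_abs)
  finally have 1: "\<bar>real n * real n * (\<Sum>j<n. ?c j) - (\<Sum>j<n. (- 1) ^ j * real (cos_term n s j))\<bar> \<le> real n" by simp
  have "real n * \<bar>cos x - (\<Sum>j<n. ?c j)\<bar> \<le> real n * ((x\<^sup>2) ^ n / fact (2 * n))"
    by (intro mult_left_mono cos_Taylor) auto
  also have "\<dots> \<le> exp 25" using Taylor_remainder_le[OF y n] .
  finally have "real n * (real n * \<bar>cos x - (\<Sum>j<n. ?c j)\<bar>) \<le> real n * exp 25" by (intro mult_left_mono) auto
  then have 2: "\<bar>real n * real n * cos x - real n * real n * (\<Sum>j<n. ?c j)\<bar> \<le> real n * exp 25"
    by (simp add: abs_mult mult.assoc flip: right_diff_distrib)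
  have 3: "(\<Sum>j<n. (- 1) ^ j * real (cos_term n s j)) = real (\<Sum>j<n. if j mod 2 = 0 then cos_term n s j else 0)
      - real (\<Sum>j<n. if j mod 2 = 0 then 0 else cos_term n s j)"
    unfolding of_nat_sum sum_subtractf[symmetric]
    by (intro sum.cong refl) (auto simp: even_iff_mod_2_eq_zero[symmetric] uminus_power_if)
  have 4: "2 * real n * knot n s = real n * real n - real n * real n * cos x"
    by (simp add: knot_def x_def algebra_simps)
  have "real n * (1 + exp 25) = real n + real n * exp 25" by (simp add: algebra_simps)
  then show ?thesis using 1 2 unfolding 3 4 by linarith
qed

lemma near_knotD:
  assumes n: "0 < n" and s: "s * s \<le> 25 * n" and a: "near_knot n s a"
  shows "\<bar>real a - knot n s\<bar> \<le> real slack"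
proof -
  define P where "P = (\<Sum>j<n. if j mod 2 = 0 then cos_term n s j else 0)"
  define M where "M = (\<Sum>j<n. if j mod 2 = 0 then 0 else cos_term n s j)"
  have "2 * n * a + P \<le> n * n + M + n * slack" "n * n + M \<le> 2 * n * a + P + n * slack"
    using a unfolding near_knot_def P_def M_def by auto
  then have "real (2 * n * a + P) \<le> real (n * n + M + n * slack)" "real (n * n + M) \<le> real (2 * n * a + P + n * slack)"
    by (simp_all only: of_nat_le_iff)
  then have "\<bar>2 * real n * real a - (real n * real n + real M - real P)\<bar> \<le> real n * real slack" by simp
  with knot_approximation[OF n s] have "\<bar>2 * real n * real a - 2 * real n * knot n s\<bar> \<le> real n * real slack + real n * (1 + exp 25)"
    unfolding P_def[symmetric] M_def[symmetric] by linarith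
  also have "2 * real n * real a - 2 * real n * knot n s = real n * (2 * (real a - knot n s))" by (simp add: algebra_simps)
  also have "\<bar>\<dots>\<bar> = real n * (2 * \<bar>real a - knot n s\<bar>)" unfolding abs_mult by simp
  also have "real n * real slack + real n * (1 + exp 25) = real n * (real slack + 1 + exp 25)" by (simp add: algebra_simps)
  finally have "2 * \<bar>real a - knot n s\<bar> \<le> real slack + 1 + exp 25" using n by simp
  moreover have "d \<le> c" if "2 * d \<le> c + 1 + e" "e + 5 \<le> c" for c d e :: real using that by linarith
  moreover have "exp 25 + 5 \<le> real slack" unfolding slack_def using real_nat_ceiling_ge[of "exp 25"] by simp
  ultimately show ?thesis by blast
qed

lemma near_knotI:
  assumes n: "0 < n" and s: "s * s \<le> 25 * n" and a: "\<bar>real a - knot n s\<bar> \<le> 2"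
  shows "near_knot n s a"
proof -
  define P where "P = (\<Sum>j<n. if j mod 2 = 0 then cos_term n s j else 0)"
  define M where "M = (\<Sum>j<n. if j mod 2 = 0 then 0 else cos_term n s j)"
  have "real n * (2 * \<bar>real a - knot n s\<bar>) \<le> real n * 4" using a by (intro mult_left_mono) auto
  also have "real n * (2 * \<bar>real a - knot n s\<bar>) = \<bar>real n * (2 * (real a - knot n s))\<bar>" unfolding abs_mult by simp
  also have "real n * (2 * (real a - knot n s)) = 2 * real n * real a - 2 * real n * knot n s" by (simp add: algebra_simps)
  finally have "\<bar>2 * real n * real a - (real n * real n + real M - real P)\<bar> \<le> real n * 4 + real n * (1 + exp 25)"
    using knot_approximation[OF n s] unfolding P_def[symmetric] M_def[symmetric] by linarith
  also have "\<dots> = real n * (exp 25 + 5)" by (simp add: algebra_simps)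
  also have "\<dots> \<le> real n * real slack"
    unfolding slack_def using real_nat_ceiling_ge[of "exp 25"] by (intro mult_left_mono) auto
  finally have "real (2 * n * a + P) \<le> real (n * n + M + n * slack)" "real (n * n + M) \<le> real (2 * n * a + P + n * slack)"
    by simp_all
  then show ?thesis unfolding near_knot_def P_def[symmetric] M_def[symmetric] by (simp only: of_nat_le_iff)
qed

text \<open>
  The bound on \<open>s\<close> replaces the undecided condition \<open>s \<le> last_index n\<close>. It keeps the angles of both
  knots at most 5 and thus below \<open>2 pi\<close>, so only one fold of the knots has to be considered.
\<close>

definition candidate :: "nat \<Rightarrow> nat \<Rightarrow> nat \<Rightarrow> nat \<Rightarrow> bool" where
  "candidate n s a b \<longleftrightarrow> s * s \<le> 16 * n \<and> a < b \<and> b \<le> Suc n \<and> near_knot n s a \<and> near_knot n (Suc s) b"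

lemma computable_candidate [computable_intros]:
  assumes f: "computable f" and g: "computable g" and h: "computable h" and k: "computable k"
  shows "computable (\<lambda>x. of_bool (candidate (f x) (g x) (h x) (k x)))"
  unfolding candidate_def by (intro computable_intros f g h k)

lemma index_range:
  assumes n: "0 < n" and s: "s * s \<le> 16 * n"
  shows "Suc s * Suc s \<le> 25 * n" "s * s \<le> 25 * n" "real (Suc s) \<le> 2 * pi * sqrt (real n)" "real s \<le> 2 * pi * sqrt (real n)"
proof -
  have "real (s * s) \<le> real (16 * n)" using s by (simp only: of_nat_le_iff)
  then have "(real s)\<^sup>2 \<le> (4 * sqrt (real n))\<^sup>2" by (simp add: power2_eq_square)
  then have s4: "real s \<le> 4 * sqrt (real n)" by (rule power2_le_imp_le) simp
  moreover have "1 \<le> sqrt (real n)" using n by simp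
  ultimately have s5: "real (Suc s) \<le> 5 * sqrt (real n)" by linarith
  then have "(real (Suc s))\<^sup>2 \<le> (5 * sqrt (real n))\<^sup>2" by (intro power_mono) auto
  also have "\<dots> = 25 * real n" by (simp add: power_mult_distrib)
  also have "(real (Suc s))\<^sup>2 = real (Suc s * Suc s)" unfolding power2_eq_square of_nat_mult ..
  finally show "Suc s * Suc s \<le> 25 * n" using of_nat_le_iff[of "Suc s * Suc s" "25 * n", where ?'a = real] by simp
  show "s * s \<le> 25 * n" using s by simp
  have "5 * sqrt (real n) \<le> 2 * pi * sqrt (real n)" using pi_gt3 by (intro mult_right_mono) auto
  with s5 show "real (Suc s) \<le> 2 * pi * sqrt (real n)" "real s \<le> 2 * pi * sqrt (real n)" by simp_all
qed

text \<open>
  The ends of an inner cell are knots rounded up. The last cell is \<open>{n}\<close>; its candidate ends at \<open>Suc n\<close>,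
  which is near the folded knot that follows the last one.
\<close>

lemma block_candidate:
  assumes n: "0 < n" and s: "s \<le> last_index n" and ne: "block n s \<noteq> {}"
  shows "\<exists>a b. candidate n s a b \<and> block n s = {a..<b}"
proof -
  have "(real s)\<^sup>2 \<le> (4 * sqrt (real n))\<^sup>2"
  proof (rule power_mono)
    have "pi * sqrt (real n) \<le> 4 * sqrt (real n)" using pi_less_4 by (intro mult_right_mono) auto
    then show "real s \<le> 4 * sqrt (real n)" using last_index_bounds(1)[OF n] s by linarith
  qed simp
  then have "real (s * s) \<le> real (16 * n)" by (simp add: power2_eq_square)
  then have s16: "s * s \<le> 16 * n" by (simp only: of_nat_le_iff)
  note near = near_knotI[OF n index_range(2)[OF n s16]] near_knotI[OF n index_range(1)[OF n s16]]
  from n s show ?thesis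
  proof (cases rule: block_cases)
    case 1
    have "near_knot n s 0" "near_knot n (Suc s) 1"
      using 1 knot_0[OF n] knot_1[OF n] knot_range[OF n, of 1] by (intro near; simp)+
    then have "candidate n s 0 1" using s16 n by (simp add: candidate_def)
    moreover have "block n s = {0..<1}" using 1 by auto
    ultimately show ?thesis by blast
  next
    case 2
    have "near_knot n s n" "near_knot n (Suc s) (Suc n)"
      using 2 knot_last[OF n] knot_range[OF n, of s] knot_range[OF n, of "Suc s"] by (intro near; simp)+
    then have "candidate n s n (Suc n)" using s16 n by (simp add: candidate_def)
    moreover have "block n s = {n..<Suc n}" using 2 by auto
    ultimately show ?thesis by blast
  next
    case 3
    let ?a = "nat \<lceil>knot n s\<rceil>" and ?b = "nat \<lceil>knot n (Suc s)\<rceil>"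
    have near2: "\<bar>real (nat \<lceil>knot n t\<rceil>) - knot n t\<bar> \<le> 2" for t
      using knot_range(1)[OF n, of t] ceiling_correct[of "knot n t"] by simp
    have "block n s = {?a..<?b}"
    proof (intro equalityI subsetI)
      fix k assume "k \<in> block n s"
      then have "knot n s \<le> real k" "real k < knot n (Suc s)" using 3 by (simp_all add: block_def)
      then show "k \<in> {?a..<?b}" by (auto simp: nat_le_iff ceiling_le_iff less_ceiling_iff zless_nat_eq_int_zless)
    next
      fix k assume "k \<in> {?a..<?b}"
      then have "knot n s \<le> real k" "real k < knot n (Suc s)"
        by (auto simp: nat_le_iff ceiling_le_iff less_ceiling_iff zless_nat_eq_int_zless)
      then show "k \<in> block n s" using knot_range(2)[OF n, of "Suc s"] by (simp add: block_def)
    qed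
    moreover from this ne have "?a < ?b" by auto
    moreover have "?b \<le> Suc n" using knot_range(2)[OF n, of "Suc s"] by (simp add: nat_le_iff ceiling_le_iff)
    ultimately show ?thesis using s16 near near2 unfolding candidate_def by blast
  qed
qed

lemma card_near_knot:
  assumes n: "0 < n" and s: "s * s \<le> 25 * n"
  shows "finite {a. near_knot n s a}" "real (card {a. near_knot n s a}) \<le> 2 * real slack + 1"
proof -
  show fin: "finite {a. near_knot n s a}"
  proof (rule finite_subset)
    show "{a. near_knot n s a} \<subseteq> {..nat \<lceil>knot n s + real slack\<rceil>}"
    proof
      fix a assume "a \<in> {a. near_knot n s a}"
      then have "real a \<le> knot n s + real slack" using near_knotD[OF n s, of a] by simp
      also have "\<dots> \<le> real (nat \<lceil>knot n s + real slack\<rceil>)" by (rule real_nat_ceiling_ge)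
      finally show "a \<in> {..nat \<lceil>knot n s + real slack\<rceil>}" by simp
    qed
  qed simp
  show "real (card {a. near_knot n s a}) \<le> 2 * real slack + 1"
  proof (cases "{a. near_knot n s a} = {}")
    case False
    show ?thesis
    proof (rule card_le_diameter[OF fin _ False])
      fix a b assume "a \<in> {a. near_knot n s a}" "b \<in> {a. near_knot n s a}"
      then show "\<bar>real a - real b\<bar> \<le> 2 * real slack"
        using near_knotD[OF n s, of a] near_knotD[OF n s, of b] by simp
    qed
  qed simp
qed

text \<open>
  A bound for the distance in the scaled angle of a point of a candidate from the first of its two knots:
  1 for the step between the knots, the rest for the uncertainty \<open>slack\<close> of its ends.
\<close>

definition width :: real where "width = pi * sqrt (real slack) + 1"

lemma candidate_near:
  assumes n: "0 < n" and c: "candidate n s a b" and k: "k \<in> {a..<b}"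
  shows "\<bar>angle n (real k) - angle n (knot n s)\<bar> \<le> width"
  unfolding width_def
proof (rule angle_near_knot[OF n])
  have s: "s * s \<le> 16 * n" using c by (simp add: candidate_def)
  note r = index_range[OF n s]
  show "real (Suc s) \<le> 2 * pi * sqrt (real n)" by (rule r)
  show "k \<le> n" using c k by (auto simp: candidate_def)
  have "\<bar>real a - knot n s\<bar> \<le> real slack" "\<bar>real b - knot n (Suc s)\<bar> \<le> real slack"
    using c by (auto simp: candidate_def intro!: near_knotD[OF n] r)
  with k show "knot n s - real slack \<le> real k" "real k \<le> knot n (Suc s) + real slack" by auto
qed simp

text \<open>
  Each knot is near at most \<open>2 slack + 1\<close> integers, so an index belongs to at most
  \<open>(2 slack + 1)\<^sup>2\<close> candidates.
\<close>

lemma candidate_sum_le: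
  assumes n: "0 < n" and F: "\<And>s a b. (s, a, b) \<in> F \<Longrightarrow> candidate n s a b"
  shows "finite F" "(\<Sum>(s, a, b)\<in>F. 1 / (1 + (angle n (knot n s) - u)\<^sup>2)) \<le> (2 * real slack + 1)\<^sup>2 * (6 * pi)"
proof -
  let ?I = "{s. s * s \<le> 16 * n}"
  let ?X = "\<lambda>s. {a. near_knot n s a} \<times> {b. near_knot n (Suc s) b}"
  let ?g = "\<lambda>s. 1 / (1 + (angle n (knot n s) - u)\<^sup>2)"
  have g: "0 \<le> ?g s" for s by (simp add: add_nonneg_nonneg)
  have "?I \<subseteq> {..16 * n}" by (auto intro: order_trans[OF le_square])
  then have I: "finite ?I" using finite_subset by blast
  have X: "finite (?X s)" "real (card (?X s)) \<le> (2 * real slack + 1)\<^sup>2" if "s \<in> ?I" for s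
  proof -
    have s: "s * s \<le> 16 * n" using that by simp
    note c = card_near_knot[OF n index_range(2)[OF n s]] card_near_knot[OF n index_range(1)[OF n s]]
    show "finite (?X s)" using c by simp
    show "real (card (?X s)) \<le> (2 * real slack + 1)\<^sup>2"
      unfolding card_cartesian_product of_nat_mult power2_eq_square using c by (intro mult_mono) auto
  qed
  have sub: "F \<subseteq> (SIGMA s:?I. ?X s)" using F by (auto simp: candidate_def)
  have finX: "\<forall>s\<in>?I. finite (?X s)" using X(1) by blast
  have finS: "finite (SIGMA s:?I. ?X s)" using I finX by (simp only: finite_SigmaI Ball_def)
  show "finite F" using sub finS finite_subset by blast
  have "(\<Sum>(s, a, b)\<in>F. ?g s) \<le> (\<Sum>(s, a, b)\<in>(SIGMA s:?I. ?X s). ?g s)"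
    using g by (intro sum_mono2 finS sub) auto
  also have "\<dots> = (\<Sum>s\<in>?I. \<Sum>(a, b)\<in>?X s. ?g s)"
    using sum.Sigma[OF I finX, of "\<lambda>s _. ?g s", symmetric] unfolding case_prod_unfold .
  also have "\<dots> = (\<Sum>s\<in>?I. real (card (?X s)) * ?g s)" by (simp add: case_prod_beta)
  also have "\<dots> \<le> (\<Sum>s\<in>?I. (2 * real slack + 1)\<^sup>2 * ?g s)"
    using X g by (intro sum_mono mult_right_mono) auto
  also have "\<dots> = (2 * real slack + 1)\<^sup>2 * (\<Sum>s\<in>?I. ?g s)" by (simp add: sum_distrib_left)
  also have "\<dots> \<le> (2 * real slack + 1)\<^sup>2 * (6 * pi)"
    using I index_range(4)[OF n] by (intro mult_left_mono sum_knot_kernel[OF n]) auto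
  finally show "(\<Sum>(s, a, b)\<in>F. ?g s) \<le> (2 * real slack + 1)\<^sup>2 * (6 * pi)" .
qed


section \<open>A test from a prefix method\<close>

lemma inj_obj_code: "obj_code x = obj_code y \<longleftrightarrow> x = y"
  by (cases x; cases y) (auto simp: list_encode_eq inj_bits_code)

text \<open>
  As in \<open>approximates\<close>, the value \<open>0\<close> means that no result has appeared by the stage \<open>t\<close>.
\<close>

definition enumerates :: "(nat \<Rightarrow> nat \<Rightarrow> nat) \<Rightarrow> (bool list \<Rightarrow> obj \<Rightarrow> obj option) \<Rightarrow> bool" where
  "enumerates h A \<longleftrightarrow> (\<forall>q y x. A q y = Some x \<longleftrightarrow>
     (\<exists>t. h t (prod_encode (bits_code q, obj_code y)) = Suc (obj_code x)))"

lemma description_method_enumerable: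
  assumes "description_method A"
  shows "\<exists>h. computable (\<lambda>w. h (pfst w) (psnd w)) \<and> enumerates h A"
proof -
  obtain e where e: "\<And>q y. run (\<lambda>_. 0) e (prod_encode (bits_code q, obj_code y)) = map_option obj_code (A q y)"
    using assms unfolding description_method_def by blast
  obtain h where h: "computable (\<lambda>w. h (pfst w) (psnd w))" "approximates h (run (\<lambda>_. 0) e)"
    using approximation_in_stages by blast
  have "A q y = Some x \<longleftrightarrow> run (\<lambda>_. 0) e (prod_encode (bits_code q, obj_code y)) = Some (obj_code x)" for q y x
    unfolding e by (cases "A q y") (auto simp: inj_obj_code)
  then have "enumerates h A" unfolding enumerates_def approximates_Some[OF h(2)] by blast
  with h(1) show ?thesis by blast
qed

text \<open>
  The amount by which the program \<open>q\<close> with length \<open>l\<close> and value \<open>v\<close>, if it prints \<open>k\<close> within \<open>t\<close>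
  steps, is shorter than the trivial code of \<open>k\<close> as an element of the candidate. Truncated
  subtraction gives 0 to useless programs.
\<close>

definition gain_at :: "(nat \<Rightarrow> nat \<Rightarrow> nat) \<Rightarrow> nat \<Rightarrow> nat \<Rightarrow> nat \<Rightarrow> nat \<Rightarrow> nat \<Rightarrow> nat \<Rightarrow> nat \<Rightarrow> nat \<Rightarrow> nat" where
  "gain_at h n k t s a b l v =
     (if candidate n s a b \<and> a \<le> k \<and> k < b \<and>
         h t (prod_encode (code_bits l v, code_condition n a b)) = Suc (prod_encode (2, k))
      then clog (b - a) - l else 0)"

text \<open>
  The search data are packed into one number, so that the stages of the enumeration are
  the numbers below a bound.
\<close>

definition gain :: "(nat \<Rightarrow> nat \<Rightarrow> nat) \<Rightarrow> nat \<Rightarrow> nat \<Rightarrow> nat \<Rightarrow> nat" where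
  "gain h n k w = gain_at h n k (pfst w) (pfst (psnd w)) (pfst (psnd (psnd w))) (pfst (psnd (psnd (psnd w))))
     (pfst (psnd (psnd (psnd (psnd w))))) (psnd (psnd (psnd (psnd (psnd w)))))"

definition best_gain :: "(nat \<Rightarrow> nat \<Rightarrow> nat) \<Rightarrow> nat \<Rightarrow> nat \<Rightarrow> nat" where
  "best_gain h n k = Max (range (gain h n k))"

definition gain_upto :: "(nat \<Rightarrow> nat \<Rightarrow> nat) \<Rightarrow> nat \<Rightarrow> nat \<Rightarrow> nat \<Rightarrow> nat" where
  "gain_upto h n k j = rec_nat 0 (\<lambda>m r. if r \<le> gain h n k m then gain h n k m else r) j"

lemma computable_gain_upto:
  assumes "computable (\<lambda>w. h (pfst w) (psnd w))"
  shows "computable (\<lambda>x. gain_upto h (pfst x) (pfst (psnd x)) (psnd (psnd x)))"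
  unfolding gain_upto_def gain_def gain_at_def
  by (intro computable_intros computable_comp2[OF assms])

lemma clog_le: "clog n \<le> n"
  unfolding clog_eq_Least by (rule Least_le) (simp add: less_imp_le)

lemma gain_bounded: "gain h n k w \<le> Suc n"
proof -
  have "clog (b - a) \<le> Suc n" if "candidate n s a b" for s a b
    using clog_le[of "b - a"] that unfolding candidate_def by linarith
  then show ?thesis unfolding gain_def gain_at_def by (auto intro: le_trans[OF diff_le_self])
qed

lemma finite_range_gain: "finite (range (gain h n k))"
  by (rule finite_subset[of _ "{..Suc n}"]) (use gain_bounded in auto)

lemma gain_le_best: "gain h n k w \<le> best_gain h n k"
  unfolding best_gain_def by (intro Max_ge finite_range_gain) auto

lemma best_gain_attained: "\<exists>w. gain h n k w = best_gain h n k"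
  using Max_in[OF finite_range_gain, of h n k] unfolding best_gain_def by auto

lemma gain_upto_mono: "mono (gain_upto h n k)"
  unfolding gain_upto_def by (rule mono_iff_le_Suc[THEN iffD2]) auto

lemma gain_upto_le_best: "gain_upto h n k j \<le> best_gain h n k"
  by (induction j) (auto simp: gain_upto_def gain_le_best)

lemma gain_upto_attained: "\<exists>j. gain_upto h n k j = best_gain h n k"
proof -
  obtain w where w: "gain h n k w = best_gain h n k" using best_gain_attained by blast
  have "gain h n k w \<le> gain_upto h n k (Suc w)" by (simp add: gain_upto_def)
  then show ?thesis using w gain_upto_le_best[of h n k "Suc w"] by (metis le_antisym)
qed

lemma gain_program:
  assumes A: "enumerates h A" and pos: "0 < best_gain h n k"
  shows "\<exists>s a b q. candidate n s a b \<and> k \<in> {a..<b} \<and> A q (condition n {a..<b}) = Some (Num k) \<and>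
    2 ^ best_gain h n k \<le> 2 * real (card {a..<b}) * (1 / 2) ^ length q"
proof -
  obtain w where w: "gain h n k w = best_gain h n k" using best_gain_attained by blast
  then obtain t s a b l v where g: "gain_at h n k t s a b l v = best_gain h n k" unfolding gain_def by blast
  with pos have c: "candidate n s a b" "a \<le> k" "k < b"
    and t: "h t (prod_encode (code_bits l v, code_condition n a b)) = Suc (prod_encode (2, k))"
    and best: "best_gain h n k = clog (b - a) - l"
    by (auto simp: gain_at_def split: if_splits)
  have ab: "a < b" using c by simp
  have "A (bits_of l v) (condition n {a..<b}) = Some (Num k)"
    using A t ab unfolding enumerates_def by (simp add: code_bits code_condition less_imp_le) blast
  moreover have "2 ^ best_gain h n k \<le> 2 * real (card {a..<b}) * (1 / 2) ^ length (bits_of l v)"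
  proof -
    have "real (2 ^ clog (b - a)) \<le> real (2 * (b - a))"
      using two_power_clog_le[of "b - a"] ab by (simp only: of_nat_le_iff zero_less_diff)
    then have "2 ^ clog (b - a) \<le> 2 * real (b - a)" by simp
    moreover have "clog (b - a) = best_gain h n k + l" using best pos by simp
    ultimately have "2 ^ best_gain h n k * 2 ^ l \<le> 2 * real (b - a)" by (simp add: power_add)
    then show ?thesis by (simp add: power_divide field_simps)
  qed
  ultimately show ?thesis using c by (intro exI[of _ s] exI[of _ a] exI[of _ b] exI[of _ "bits_of l v"]) auto
qed

definition mass_bound :: real where
  "mass_bound = 1 + 2 * spread width * ((2 * real slack + 1)\<^sup>2 * (6 * pi))"

text \<open>
  Points without a profitable program contribute at most 1. The others are grouped by the candidate
  that their best program uses; within a group Kraft's inequality applies, as all these programs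
  have the same condition. Then the groups are summed by \<open>candidate_sum_le\<close>.
\<close>

lemma best_gain_mass:
  assumes n: "0 < n" and p: "p \<in> {0..1}" and A: "enumerates h A" and prefix: "prefix_method A"
  shows "(\<Sum>k\<le>n. bin n p k * 2 ^ best_gain h n k) \<le> mass_bound"
proof -
  define K where "K = {k \<in> {..n}. 0 < best_gain h n k}"
  have "\<forall>k\<in>K. \<exists>s a b q. candidate n s a b \<and> k \<in> {a..<b} \<and> A q (condition n {a..<b}) = Some (Num k) \<and>
      2 ^ best_gain h n k \<le> 2 * real (card {a..<b}) * (1 / 2) ^ length q"
    using gain_program[OF A] unfolding K_def by simp
  from bchoice[OF this] obtain s where "\<forall>k\<in>K. \<exists>a b q. candidate n (s k) a b \<and> k \<in> {a..<b} \<and> A q (condition n {a..<b}) = Some (Num k) \<and>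
      2 ^ best_gain h n k \<le> 2 * real (card {a..<b}) * (1 / 2) ^ length q" by (elim exE)
  from bchoice[OF this] obtain a where "\<forall>k\<in>K. \<exists>b q. candidate n (s k) (a k) b \<and> k \<in> {a k..<b} \<and> A q (condition n {a k..<b}) = Some (Num k) \<and>
      2 ^ best_gain h n k \<le> 2 * real (card {a k..<b}) * (1 / 2) ^ length q" by (elim exE)
  from bchoice[OF this] obtain b where "\<forall>k\<in>K. \<exists>q. candidate n (s k) (a k) (b k) \<and> k \<in> {a k..<b k} \<and> A q (condition n {a k..<b k}) = Some (Num k) \<and>
      2 ^ best_gain h n k \<le> 2 * real (card {a k..<b k}) * (1 / 2) ^ length q" by (elim exE)
  from bchoice[OF this] obtain q where prog: "\<And>k. k \<in> K \<Longrightarrow> candidate n (s k) (a k) (b k) \<and> k \<in> {a k..<b k} \<and>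
      A (q k) (condition n {a k..<b k}) = Some (Num k) \<and>
      2 ^ best_gain h n k \<le> 2 * real (card {a k..<b k}) * (1 / 2) ^ length (q k)"
    by (elim exE) blast
  have finK: "finite K" by (simp add: K_def)
  define u where "u = angle n (real n * p)"
  define g where "g s = 1 / (1 + (angle n (knot n s) - u)\<^sup>2)" for s
  have g: "0 \<le> g s" for s by (simp add: g_def add_nonneg_nonneg)
  have width: "0 \<le> width" by (simp add: width_def)
  have spread: "0 \<le> spread width" using width by (simp add: spread_def)
  define c where "c k = (s k, a k, b k)" for k
  let ?W = "\<lambda>c. 2 * (spread width * g (fst c))"
  have weight: "bin n p k * 2 ^ best_gain h n k \<le> ?W (c k) * (1 / 2) ^ length (q k)" if k: "k \<in> K" for k
  proof -
    note P = prog[OF k]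
    have "candidate n (s k) (a k) (b k)" using P by blast
    then have sub: "{a k..<b k} \<subseteq> {..n}" by (auto simp: candidate_def)
    have "real (card {a k..<b k}) * bin n p k \<le> spread width / (1 + (angle n (knot n (s k)) - u)\<^sup>2)"
      unfolding u_def
    proof (rule card_bin_le[OF n p sub width])
      show "k \<in> {a k..<b k}" using P by blast
      fix i assume "i \<in> {a k..<b k}"
      with P show "\<bar>angle n (real i) - angle n (knot n (s k))\<bar> \<le> width" using candidate_near[OF n] by blast
    qed
    then have *: "real (card {a k..<b k}) * bin n p k \<le> spread width * g (s k)" by (simp add: g_def)
    have "bin n p k * 2 ^ best_gain h n k \<le> bin n p k * (2 * real (card {a k..<b k}) * (1 / 2) ^ length (q k))"
      using P by (intro mult_left_mono bin_nonneg[OF p]) blast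
    also have "\<dots> = 2 * (real (card {a k..<b k}) * bin n p k) * (1 / 2) ^ length (q k)" by (simp only: ac_simps)
    also have "\<dots> \<le> 2 * (spread width * g (s k)) * (1 / 2) ^ length (q k)"
      using * by (intro mult_right_mono mult_left_mono) auto
    finally show ?thesis by (simp add: c_def)
  qed
  \<comment> \<open>Kraft's inequality for the programs whose common condition is the candidate \<open>y\<close>\<close>
  have kraft: "(\<Sum>k\<in>{k \<in> K. c k = y}. (1 / 2) ^ length (q k)) \<le> (1::real)" for y
  proof -
    let ?Ky = "{k \<in> K. c k = y}"
    obtain s' a' b' where y: "y = (s', a', b')" by (cases y)
    have out: "A (q k) (condition n {a'..<b'}) = Some (Num k)" if "k \<in> ?Ky" for k
    proof -
      from that have k: "k \<in> K" "s k = s'" "a k = a'" "b k = b'" by (simp_all add: c_def y)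
      have "A (q k) (condition n {a k..<b k}) = Some (Num k)" using prog[OF k(1)] by blast
      then show ?thesis unfolding k(3,4) .
    qed
    have inj: "inj_on q ?Ky"
    proof (rule inj_onI)
      fix i j assume i: "i \<in> ?Ky" and j: "j \<in> ?Ky" and eq: "q i = q j"
      have "Some (Num i) = Some (Num j)" unfolding out[OF i, symmetric] out[OF j, symmetric] eq ..
      then show "i = j" by simp
    qed
    have "(\<Sum>r\<in>q ` ?Ky. (1 / 2) ^ length r) \<le> (1::real)"
    proof (rule Kraft_inequality)
      fix r r' assume r: "r \<in> q ` ?Ky" "r' \<in> q ` ?Ky" and pr: "prefix r r'"
      obtain i where i: "r = q i" "i \<in> ?Ky" using r(1) by (rule imageE)
      obtain j where j: "r' = q j" "j \<in> ?Ky" using r(2) by (rule imageE)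
      note ij = i(2) j(2) i(1) j(1) pr[unfolded i j]
      have "A (q j) (condition n {a'..<b'}) = Some (Num i)"
        using prefix out[OF ij(1)] ij(5) unfolding prefix_method_def by blast
      then have "i = j" unfolding out[OF ij(2)] by simp
      then show "r = r'" unfolding i(1) j(1) by simp
    qed (simp add: finK)
    then show ?thesis by (simp add: sum.reindex[OF inj])
  qed
  have cand: "candidate n s' a' b'" if "(s', a', b') \<in> c ` K" for s' a' b'
  proof -
    from that obtain k where k: "k \<in> K" "s k = s'" "a k = a'" "b k = b'" by (auto simp: c_def)
    have "candidate n (s k) (a k) (b k)" using prog[OF k(1)] by blast
    then show ?thesis unfolding k(2,3,4) .
  qed
  have "(\<Sum>k\<in>K. bin n p k * 2 ^ best_gain h n k) \<le> (\<Sum>k\<in>K. ?W (c k) * (1 / 2) ^ length (q k))"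
    by (intro sum_mono weight)
  also have "\<dots> = (\<Sum>y\<in>c ` K. \<Sum>k\<in>{k \<in> K. c k = y}. ?W (c k) * (1 / 2) ^ length (q k))"
    by (rule sum.image_gen[OF finK])
  also have "\<dots> = (\<Sum>y\<in>c ` K. ?W y * (\<Sum>k\<in>{k \<in> K. c k = y}. (1 / 2) ^ length (q k)))"
    unfolding sum_distrib_left by (intro sum.cong refl) auto
  also have "\<dots> \<le> (\<Sum>y\<in>c ` K. ?W y * 1)"
    using g spread by (intro sum_mono mult_left_mono kraft mult_nonneg_nonneg) auto
  also have "\<dots> = 2 * spread width * (\<Sum>(s, a, b)\<in>c ` K. g s)"
    unfolding sum_distrib_left case_prod_unfold by (simp only: mult.assoc mult_1_right)
  also have "\<dots> \<le> 2 * spread width * ((2 * real slack + 1)\<^sup>2 * (6 * pi))"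
    unfolding g_def using spread candidate_sum_le(2)[OF n cand] by (intro mult_left_mono) auto
  finally have large: "(\<Sum>k\<in>K. bin n p k * 2 ^ best_gain h n k) \<le> 2 * spread width * ((2 * real slack + 1)\<^sup>2 * (6 * pi))" .
  have "(\<Sum>k\<le>n. bin n p k * 2 ^ best_gain h n k) \<le> (\<Sum>k\<le>n. bin n p k + (if k \<in> K then bin n p k * 2 ^ best_gain h n k else 0))"
    using bin_nonneg[OF p] by (intro sum_mono) (auto simp: K_def)
  also have "\<dots> = 1 + (\<Sum>k\<in>K. bin n p k * 2 ^ best_gain h n k)"
  proof -
    have "{..n} \<inter> K = K" by (auto simp: K_def)
    then show ?thesis using sum.inter_restrict[of "{..n}" "\<lambda>k. bin n p k * 2 ^ best_gain h n k" K]
      by (simp add: sum.distrib sum_bin[OF p])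
  qed
  finally show ?thesis using large by (simp add: mass_bound_def)
qed

lemma integral_binomial:
  assumes "p \<in> {0..1}"
  shows "(\<integral>\<^sup>+ k. f k \<partial>measure_pmf (binomial_pmf n p)) = (\<Sum>k\<le>n. ennreal (bin n p k) * f k)"
proof -
  have "(\<integral>\<^sup>+ k. f k \<partial>measure_pmf (binomial_pmf n p)) = (\<Sum>k\<le>n. f k * ennreal (pmf (binomial_pmf n p) k))"
    using assms by (intro nn_integral_measure_pmf_support) (auto simp: set_pmf_binomial_eq split: if_splits)
  then show ?thesis using assms by (simp add: bin_def mult.commute)
qed

text \<open>
  Subtracting \<open>C\<close> divides the mean by \<open>2 ^ C\<close>.
\<close>

definition gain_test :: "(nat \<Rightarrow> nat \<Rightarrow> nat) \<Rightarrow> nat \<Rightarrow> nat \<Rightarrow> real \<Rightarrow> nat \<Rightarrow> ereal" where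
  "gain_test h C n p k = ereal (of_int (int (best_gain h n k) - int C))"

lemma lower_semicomputable_gain_test:
  assumes h: "computable (\<lambda>w. h (pfst w) (psnd w))"
  shows "lower_semicomputable (gain_test h C)"
proof -
  let ?L = "\<lambda>x. gain_upto h (pfst x) (pfst (psnd x)) (psnd (psnd x))"
  have "computable (\<lambda>x. if C \<le> ?L x then 2 * (?L x - C) else Suc (2 * (C - Suc (?L x))))"
    by (intro computable_intros computable_gain_upto h)
  moreover have "(if C \<le> L then 2 * (L - C) else Suc (2 * (C - Suc L))) = int_encode (int L - int C)" for L
    by (auto simp: int_encode_def sum_encode_def nat_diff_distrib' of_nat_diff)
  ultimately obtain e where e: "\<And>orc x. run orc e x = Some (int_encode (int (?L x) - int C))"
    unfolding computable_def by auto
  have "\<exists>m :: nat \<Rightarrow> int. mono m \<and>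
      (\<forall>j. run orc e (prod_encode (n, prod_encode (k, j))) = Some (int_encode (m j))) \<and>
      (SUP j. ereal (of_int (m j))) = gain_test h C n p k" for orc n p k
  proof (intro exI[of _ "\<lambda>j. int (gain_upto h n k j) - int C"] conjI allI)
    show "mono (\<lambda>j. int (gain_upto h n k j) - int C)"
      using gain_upto_mono[of h n k] by (auto simp: mono_def)
    show "run orc e (prod_encode (n, prod_encode (k, j))) = Some (int_encode (int (gain_upto h n k j) - int C))" for j
      by (simp add: e)
    show "(SUP j. ereal (of_int (int (gain_upto h n k j) - int C))) = gain_test h C n p k"
    proof (rule antisym)
      show "(SUP j. ereal (of_int (int (gain_upto h n k j) - int C))) \<le> gain_test h C n p k"
        using gain_upto_le_best[of h n k] by (intro SUP_least) (simp add: gain_test_def)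
      obtain j where "gain_upto h n k j = best_gain h n k" using gain_upto_attained by blast
      then show "gain_test h C n p k \<le> (SUP j. ereal (of_int (int (gain_upto h n k j) - int C)))"
        unfolding gain_test_def by (intro SUP_upper2[of j]) auto
    qed
  qed
  then show ?thesis unfolding lower_semicomputable_def by blast
qed

lemma test_gain_test:
  assumes h: "computable (\<lambda>w. h (pfst w) (psnd w))" and A: "enumerates h A" "prefix_method A"
    and C: "mass_bound \<le> 2 ^ C"
  shows "test (gain_test h C)"
  unfolding test_def
proof (intro conjI allI impI ballI)
  fix n :: nat and p :: real assume n: "0 < n" and p: "p \<in> {0..1}"
  have "pow2 (gain_test h C n p k) = ennreal (2 ^ best_gain h n k / 2 ^ C)" for k
    by (simp add: pow2_def gain_test_def powr_diff powr_realpow)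
  then have "(\<integral>\<^sup>+ k. pow2 (gain_test h C n p k) \<partial>measure_pmf (binomial_pmf n p))
      = (\<Sum>k\<le>n. ennreal (bin n p k * (2 ^ best_gain h n k / 2 ^ C)))"
    unfolding integral_binomial[OF p] by (intro sum.cong refl) (simp only: ennreal_mult bin_nonneg[OF p] divide_nonneg_nonneg zero_le_power zero_le_numeral)
  also have "\<dots> = ennreal (\<Sum>k\<le>n. bin n p k * (2 ^ best_gain h n k / 2 ^ C))"
    using p by (intro sum_ennreal) (simp add: bin_nonneg)
  also have "\<dots> \<le> 1"
  proof -
    have "(\<Sum>k\<le>n. bin n p k * (2 ^ best_gain h n k / 2 ^ C)) = (\<Sum>k\<le>n. bin n p k * 2 ^ best_gain h n k) / 2 ^ C"
      by (simp add: sum_divide_distrib)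
    also have "\<dots> \<le> 1" using best_gain_mass[OF n p A] C by (simp add: divide_le_eq)
    finally show ?thesis by simp
  qed
  finally show "(\<integral>\<^sup>+ k. pow2 (gain_test h C n p k) \<partial>measure_pmf (binomial_pmf n p)) \<le> 1" .
next
  show "lower_semicomputable (gain_test h C)" by (rule lower_semicomputable_gain_test[OF h])
qed (unfold gain_test_def, blast)

lemma gain_test_ge:
  assumes A: "enumerates h A" and c: "candidate n s a b" "k \<in> {a..<b}" and q: "A q (condition n {a..<b}) = Some (Num k)"
  shows "ereal (log 2 (real (card {a..<b})) - real (length q) - real C) \<le> gain_test h C n p k"
proof -
  have ab: "a < b" using c by (simp add: candidate_def)
  obtain t where "h t (prod_encode (bits_code q, obj_code (condition n {a..<b}))) = Suc (obj_code (Num k))"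
    using A q unfolding enumerates_def by blast
  then have "h t (prod_encode (code_bits (length q) (bitval q), code_condition n a b)) = Suc (prod_encode (2, k))"
    using ab by (simp add: code_bits_bitval code_condition less_imp_le)
  then have "gain_at h n k t s a b (length q) (bitval q) = clog (b - a) - length q"
    using c by (simp add: gain_at_def)
  then have "gain h n k (prod_encode (t, prod_encode (s, prod_encode (a, prod_encode (b, prod_encode (length q, bitval q))))))
      = clog (b - a) - length q" by (simp add: gain_def)
  then have "clog (b - a) - length q \<le> best_gain h n k" using gain_le_best by metis
  then have "real (clog (b - a)) - real (length q) \<le> real (best_gain h n k)" by linarith
  with log_bounds_clog(1)[of "b - a"] ab show ?thesis by (simp add: gain_test_def)
qed

section \<open>The deficiency and the complexity\<close>

lemma complexity_attained:
  assumes "complexity A x y = enat m" shows "\<exists>q. A q y = Some x \<and> length q = m"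
proof -
  have ne: "{q. A q y = Some x} \<noteq> {}"
  proof
    assume "{q. A q y = Some x} = {}"
    then show False using assms by (simp add: complexity_def top_enat_def)
  qed
  let ?L = "(\<lambda>q. enat (length q)) ` {q. A q y = Some x}"
  have ne': "?L \<noteq> {}" using ne by blast
  then have "complexity A x y = (LEAST l. l \<in> ?L)" by (simp only: complexity_def Inf_enat_def if_False)
  also have "\<dots> \<in> ?L" by (rule LeastI_ex) (use ne' in blast)
  finally show ?thesis using assms by auto
qed

text \<open>
  The test is independent of \<open>p\<close>, so the inequality between it and \<open>D\<close> passes to the infimum.
\<close>

lemma deficiency_lower_bound:
  assumes A: "optimal_prefix_method A" and D: "universal_test D"
  shows "\<exists>C::real. \<forall>n>0. \<forall>k\<le>n. \<forall>m. complexity A (Num k) (condition n (cell n k)) = enat m \<longrightarrow>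
    ereal (log 2 (real (card (cell n k))) - real m - C) \<le> binom_deficiency D n k"
proof -
  have pm: "prefix_method A" using A by (simp add: optimal_prefix_method_def)
  then have "description_method A" by (simp add: prefix_method_def)
  then obtain h where h: "computable (\<lambda>w. h (pfst w) (psnd w))" "enumerates h A"
    using description_method_enumerable by blast
  obtain C where C: "mass_bound < 2 ^ C" using real_arch_pow[of 2 mass_bound] by auto
  have "test (gain_test h C)" by (rule test_gain_test[OF h pm less_imp_le[OF C]])
  then obtain C' :: real where C': "\<And>n p k. 0 < n \<Longrightarrow> p \<in> {0..1} \<Longrightarrow> k \<le> n \<Longrightarrow> gain_test h C n p k - ereal C' \<le> D n p k"
    using D unfolding universal_test_def by metis
  have "ereal (log 2 (real (card (cell n k))) - real m - (real C + C')) \<le> binom_deficiency D n k"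
    if n: "0 < n" and k: "k \<le> n" and m: "complexity A (Num k) (condition n (cell n k)) = enat m" for n k m
    unfolding binom_deficiency_def
  proof (rule INF_greatest)
    fix p :: real assume p: "p \<in> {0..1}"
    from cell(1)[OF n k] have "cell n k \<in> block n ` {0..last_index n}" unfolding blocks_def by blast
    then obtain s where s: "s \<le> last_index n" "cell n k = block n s" by (elim imageE) simp
    have ks: "k \<in> block n s" using cell(2)[OF n k] s by simp
    obtain a b where ab: "candidate n s a b" "block n s = {a..<b}"
      using block_candidate[OF n s(1)] ks by blast
    obtain q where q: "A q (condition n {a..<b}) = Some (Num k)" "length q = m"
      using complexity_attained[OF m] unfolding s(2) ab(2) by blast
    have "ereal (log 2 (real (card {a..<b})) - real (length q) - real C) \<le> gain_test h C n p k"
      using ks unfolding ab(2) by (rule gain_test_ge[OF h(2) ab(1) _ q(1)])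
    then have "ereal (log 2 (real (card {a..<b})) - real m - real C) - ereal C' \<le> gain_test h C n p k - ereal C'"
      unfolding q(2) by (rule ereal_minus_mono) simp
    also have "\<dots> \<le> D n p k" by (rule C'[OF n p k])
    finally show "ereal (log 2 (real (card (cell n k))) - real m - (real C + C')) \<le> D n p k"
      unfolding s(2) ab(2) by (simp only: ereal_minus(1) diff_diff_eq add.assoc)
  qed
  then show ?thesis by blast
qed


section \<open>A prefix method from a test\<close>

type_synonym levels = "nat \<Rightarrow> nat \<Rightarrow> nat \<Rightarrow> nat \<Rightarrow> nat"

definition levels_computable :: "levels \<Rightarrow> bool" where
  "levels_computable lev \<longleftrightarrow>
     computable (\<lambda>w. lev (pfst w) (pfst (psnd w)) (pfst (psnd (psnd w))) (psnd (psnd (psnd w))))"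

lemma computable_lev:
  assumes "levels_computable lev" and f: "computable f" "computable g" "computable h" "computable k"
  shows "computable (\<lambda>x. lev (f x) (g x) (h x) (k x))"
proof -
  have "computable (\<lambda>x. prod_encode (f x, prod_encode (g x, prod_encode (h x, k x))))"
    by (intro computable_intros f)
  from computable_comp[OF assms(1)[unfolded levels_computable_def] this] show ?thesis by simp
qed

text \<open>
  A cell with \<open>m\<close> points gets \<open>2 ^ budget m\<close> units to distribute. Of the constant 11, the lower bound
  \<open>bin_block_ge\<close> uses 9, replacing the test by its positive part uses 1, and serving all intermediate
  levels of a point besides the final one uses 1.
\<close>

definition budget :: "nat \<Rightarrow> nat" where
  "budget m = clog m + 11"

text \<open>
  The index \<open>j\<close> stands for the time \<open>pfst j\<close> and the point \<open>a + psnd j\<close>. A share of \<open>2 ^ level\<close> units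
  is requested whenever the level of a point has changed.
\<close>

definition request :: "levels \<Rightarrow> nat \<Rightarrow> nat \<Rightarrow> nat \<Rightarrow> nat \<Rightarrow> nat" where
  "request lev n a b j =
     (if psnd j < b - a \<and> (pfst j = 0 \<or> lev n a (a + psnd j) (pfst j) \<noteq> lev n a (a + psnd j) (pfst j - 1))
      then 2 ^ lev n a (a + psnd j) (pfst j)
      else 0)"

lemma computable_request:
  assumes lev: "levels_computable lev"
    and c: "computable f" "computable g" "computable h" "computable k"
  shows "computable (\<lambda>x. request lev (f x) (g x) (h x) (k x))"
  unfolding request_def by (intro computable_intros computable_lev[OF lev] c)

text \<open>
  The shares are laid out consecutively in the order of their indices. For intervals that are not cells
  they may exceed the budget; the shares beyond it contain no string.
\<close>

definition served :: "levels \<Rightarrow> nat \<Rightarrow> nat \<Rightarrow> nat \<Rightarrow> nat \<Rightarrow> nat \<Rightarrow> nat \<Rightarrow> bool" where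
  "served lev n a b j l v \<longleftrightarrow> 0 < n \<and> a < b \<and> b \<le> Suc n \<and> psnd j < b - a \<and>
     fits (budget (b - a)) (\<Sum>i<j. request lev n a b i) (request lev n a b j) l v"

definition method_relation :: "levels \<Rightarrow> bool list \<Rightarrow> obj \<Rightarrow> obj \<Rightarrow> bool" where
  "method_relation lev q y x \<longleftrightarrow>
     (\<exists>n a b j. y = condition n {a..<b} \<and> served lev n a b j (length q) (bitval q) \<and> x = Num (a + psnd j))"

text \<open>
  The condition determines the interval, and distinct shares contain distinct strings.
\<close>

lemma method_relation_unique:
  assumes "method_relation lev q y x" "method_relation lev q y x'"
  shows "x = x'"
proof -
  obtain n a b j where 1: "y = condition n {a..<b}" "served lev n a b j (length q) (bitval q)" "x = Num (a + psnd j)"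
    using assms(1) unfolding method_relation_def by blast
  obtain n' a' b' j' where 2: "y = condition n' {a'..<b'}" "served lev n' a' b' j' (length q) (bitval q)" "x' = Num (a' + psnd j')"
    using assms(2) unfolding method_relation_def by blast
  have ab: "a < b" "a' < b'" using 1(2) 2(2) by (simp_all add: served_def)
  then have "code_condition n a b = code_condition n' a' b'"
    using 1(1) 2(1) by (simp add: code_condition)
  from code_condition_inj[OF ab this] have eq: "n' = n" "a' = a" "b' = b" by simp_all
  have "j = j'"
    using 1(2) 2(2) unfolding served_def eq by (blast intro: fits_unique)
  then show ?thesis using 1(3) 2(3) eq by simp
qed

lemma method_relation_prefix:
  assumes "method_relation lev q y x" "prefix q q'"
  shows "method_relation lev q' y x"
  using assms fits_prefix unfolding method_relation_def served_def by blast

definition level_method :: "levels \<Rightarrow> bool list \<Rightarrow> obj \<Rightarrow> obj option" where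
  "level_method lev q y = (if \<exists>x. method_relation lev q y x then Some (THE x. method_relation lev q y x) else None)"

lemma level_method_Some: "level_method lev q y = Some x \<longleftrightarrow> method_relation lev q y x"
proof
  assume "level_method lev q y = Some x"
  then have ex: "\<exists>x. method_relation lev q y x" and x: "x = (THE x. method_relation lev q y x)"
    by (auto simp: level_method_def split: if_splits)
  from ex obtain x' where x': "method_relation lev q y x'" by blast
  then have "(THE x. method_relation lev q y x) = x'" by (rule the_equality) (rule method_relation_unique[OF _ x'])
  with x x' show "method_relation lev q y x" by simp
next
  assume x: "method_relation lev q y x"
  then have "(THE x. method_relation lev q y x) = x" by (rule the_equality) (rule method_relation_unique[OF _ x])
  with x show "level_method lev q y = Some x" unfolding level_method_def by auto
qed

text \<open>
  The program searches for the share that contains the given string. The interval, the length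
  and the value of the string are also found by search, and checked by comparing codes.
\<close>

lemma description_level_method:
  assumes lev: "levels_computable lev"
  shows "description_method (level_method lev)"
proof -
  define l where "l w = pfst w" for w
  define v where "v w = pfst (psnd w)" for w
  define n where "n w = pfst (psnd (psnd w))" for w
  define a where "a w = pfst (psnd (psnd (psnd w)))" for w
  define b where "b w = pfst (psnd (psnd (psnd (psnd w))))" for w
  define j where "j w = psnd (psnd (psnd (psnd (psnd w))))" for w
  note defs = l_def v_def n_def a_def b_def j_def
  have c: "computable l" "computable v" "computable n" "computable a" "computable b" "computable j"
    unfolding defs by (intro computable_intros)+
  define acc where "acc x w \<longleftrightarrow> served lev (n w) (a w) (b w) (j w) (l w) (v w) \<and> v w < 2 ^ l w \<and>
      code_bits (l w) (v w) = pfst x \<and> code_condition (n w) (a w) (b w) = psnd x" for x w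
  have "computable (\<lambda>u. of_bool (\<not> acc (pfst u) (psnd u)))"
    unfolding acc_def served_def fits_def budget_def
    by (intro computable_intros computable_request[OF lev] c[THEN computable_comp])
  then obtain f where f: "\<And>orc u. run orc f u = Some (of_bool (\<not> acc (pfst u) (psnd u)))"
    unfolding computable_def by blast
  have "computable (\<lambda>w. prod_encode (2, a w + psnd (j w)))" by (intro computable_intros c)
  then obtain e where e: "\<And>orc w. run orc e w = Some (prod_encode (2, a w + psnd (j w)))"
    unfolding computable_def by blast
  have sound: "method_relation lev q y (Num (a w + psnd (j w)))"
    if "acc (prod_encode (bits_code q, obj_code y)) w" for q y w
  proof -
    have w: "served lev (n w) (a w) (b w) (j w) (l w) (v w)" "v w < 2 ^ l w"
      "code_bits (l w) (v w) = bits_code q" "code_condition (n w) (a w) (b w) = obj_code y"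
      using that by (simp_all add: acc_def)
    have "l w = length q" "v w = bitval q" using w(2,3) by (simp_all add: code_bits_eq_iff)
    moreover have "a w \<le> b w" using w(1) by (simp add: served_def)
    then have "y = condition (n w) {a w..<b w}" using w(4) by (simp add: code_condition inj_obj_code)
    ultimately show ?thesis using w(1) unfolding method_relation_def by auto
  qed
  have complete: "\<exists>w. acc (prod_encode (bits_code q, obj_code y)) w" if rel: "method_relation lev q y x" for q y x
  proof -
    obtain n' a' b' j' where r: "y = condition n' {a'..<b'}" "served lev n' a' b' j' (length q) (bitval q)"
      using rel unfolding method_relation_def by blast
    have "a' \<le> b'" using r(2) by (simp add: served_def)
    then have "acc (prod_encode (bits_code q, obj_code y))
        (prod_encode (length q, prod_encode (bitval q, prod_encode (n', prod_encode (a', prod_encode (b', j'))))))"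
      using r by (simp add: acc_def defs code_bits_bitval code_condition bitval_less)
    then show ?thesis by blast
  qed
  have "run (\<lambda>_. 0) (Comp e (Mu f)) (prod_encode (bits_code q, obj_code y)) = map_option obj_code (level_method lev q y)" for q y
  proof (cases "\<exists>w. acc (prod_encode (bits_code q, obj_code y)) w")
    case True
    let ?P = "acc (prod_encode (bits_code q, obj_code y))"
    define w where "w = (LEAST w. ?P w)"
    have w: "?P w" unfolding w_def by (rule LeastI_ex[OF True])
    have "\<not> ?P m" if "m < w" for m using that not_less_Least unfolding w_def by blast
    then have "run (\<lambda>_. 0) (Mu f) (prod_encode (bits_code q, obj_code y)) = Some w"
      using w unfolding run_Mu_Some by (simp add: f)
    moreover have "level_method lev q y = Some (Num (a w + psnd (j w)))"
      using sound[OF w] level_method_Some by blast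
    ultimately show ?thesis by (simp add: e)
  next
    case False
    then have "level_method lev q y = None"
      using complete level_method_Some by (metis option.exhaust)
    moreover have "run (\<lambda>_. 0) (Mu f) (prod_encode (bits_code q, obj_code y)) = None"
      using False by (simp add: f)
    ultimately show ?thesis by simp
  qed
  then show ?thesis unfolding description_method_def by blast
qed

lemma prefix_level_method:
  assumes "levels_computable lev" shows "prefix_method (level_method lev)"
  unfolding prefix_method_def level_method_Some
  using description_level_method[OF assms] method_relation_prefix by blast

section \<open>The requests fit into the budget\<close>

text \<open>
  The levels at which a jump occurs are distinct, so this is a geometric sum dominated by its last
  term.
\<close>

lemma sum_level_jumps:
  fixes f :: "nat \<Rightarrow> nat"
  assumes "mono f"
  shows "(\<Sum>t<Suc J. if t = 0 \<or> f t \<noteq> f (t - 1) then 2 ^ f t else 0) \<le> (2 * 2 ^ f J :: nat)"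
proof (induction J)
  case (Suc J)
  have le: "f J \<le> f (Suc J)" using assms by (simp add: mono_def)
  show ?case
  proof (cases "f (Suc J) = f J")
    case True
    with Suc show ?thesis by simp
  next
    case False
    with le have "Suc (f J) \<le> f (Suc J)" by simp
    then have "(2::nat) ^ Suc (f J) \<le> 2 ^ f (Suc J)" by (rule power_increasing) simp
    with Suc False show ?thesis by simp
  qed
qed simp

lemma sum_requests_le:
  assumes mono: "\<And>i. i < b - a \<Longrightarrow> mono (lev n a (a + i))"
  shows "(\<Sum>j<J. request lev n a b j) \<le> 2 * (\<Sum>i<b - a. 2 ^ lev n a (a + i) J)"
proof -
  let ?r = "\<lambda>t i. if t = 0 \<or> lev n a (a + i) t \<noteq> lev n a (a + i) (t - 1) then 2 ^ lev n a (a + i) t else (0::nat)"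
  let ?J = "{j \<in> {..<J}. psnd j < b - a}"
  have "(\<Sum>j<J. request lev n a b j) = (\<Sum>j\<in>?J. request lev n a b j)"
    by (rule sum.mono_neutral_right) (auto simp: request_def)
  also have "\<dots> \<le> (\<Sum>j\<in>?J. ?r (pfst j) (psnd j))"
    by (intro sum_mono) (auto simp: request_def)
  also have "\<dots> = (\<Sum>(t, i)\<in>prod_decode ` ?J. ?r t i)"
    by (subst sum.reindex) (auto simp: inj_prod_decode pfst_def psnd_def case_prod_unfold intro!: sum.cong)
  also have "\<dots> \<le> (\<Sum>(t, i)\<in>{..<Suc J} \<times> {..<b - a}. ?r t i)"
  proof (rule sum_mono2)
    show "prod_decode ` ?J \<subseteq> {..<Suc J} \<times> {..<b - a}"
    proof
      fix z assume "z \<in> prod_decode ` ?J"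
      then obtain j where j: "z = (pfst j, psnd j)" "j < J" "psnd j < b - a" by (auto simp: pfst_def psnd_def)
      have "pfst j \<le> prod_encode (pfst j, psnd j)" by (rule le_prod_encode_1)
      then have "pfst j \<le> j" by simp
      with j show "z \<in> {..<Suc J} \<times> {..<b - a}" by simp
    qed
  qed auto
  also have "\<dots> = (\<Sum>t<Suc J. \<Sum>i<b - a. ?r t i)" by (simp only: sum.cartesian_product)
  also have "\<dots> = (\<Sum>i<b - a. \<Sum>t<Suc J. ?r t i)" by (rule sum.swap)
  also have "\<dots> \<le> (\<Sum>i<b - a. 2 * 2 ^ lev n a (a + i) J)"
    using mono by (intro sum_mono sum_level_jumps) auto
  also have "\<dots> = 2 * (\<Sum>i<b - a. 2 ^ lev n a (a + i) J)" by (simp add: sum_distrib_left)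
  finally show ?thesis .
qed

text \<open>
  \<open>2 ^ max 0 x \<le> 1 + 2 ^ x\<close>.
\<close>

lemma level_mass:
  assumes T: "test T" and n: "0 < n" and p: "p \<in> {0..1}"
    and f: "\<And>k. k \<le> n \<Longrightarrow> ereal (real (f k)) \<le> max 0 (T n p k)"
  shows "(\<Sum>k\<le>n. bin n p k * 2 ^ f k) \<le> 2"
proof -
  have f': "ennreal (2 ^ f k) \<le> 1 + pow2 (T n p k)" if "k \<le> n" for k
  proof (cases "f k = 0")
    case False
    then have "ereal (real (f k)) \<le> T n p k" using f[OF that] by (auto simp: max_def split: if_splits)
    then have "ennreal (2 ^ f k) \<le> pow2 (T n p k)"
      by (cases "T n p k") (auto simp: pow2_def powr_realpow[symmetric] intro!: ennreal_leI powr_mono)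
    then show ?thesis by (simp add: add_increasing)
  qed simp
  have "ennreal (\<Sum>k\<le>n. bin n p k * 2 ^ f k) = (\<Sum>k\<le>n. ennreal (bin n p k) * ennreal (2 ^ f k))"
    by (subst sum_ennreal[symmetric]) (auto simp: ennreal_mult bin_nonneg[OF p])
  also have "\<dots> \<le> (\<Sum>k\<le>n. ennreal (bin n p k) * (1 + pow2 (T n p k)))"
    using f' by (intro sum_mono mult_left_mono) auto
  also have "\<dots> = (\<Sum>k\<le>n. ennreal (bin n p k)) + (\<Sum>k\<le>n. ennreal (bin n p k) * pow2 (T n p k))"
    by (simp add: distrib_left sum.distrib)
  also have "(\<Sum>k\<le>n. ennreal (bin n p k)) = 1"
    using sum_bin[OF p, of n] by (subst sum_ennreal) (auto simp: bin_nonneg[OF p])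
  also have "(\<Sum>k\<le>n. ennreal (bin n p k) * pow2 (T n p k)) \<le> 1"
    using T n p unfolding test_def integral_binomial[OF p, symmetric] by blast
  finally have "ennreal (\<Sum>k\<le>n. bin n p k * 2 ^ f k) \<le> ennreal 2" by simp
  then show ?thesis by (simp only: ennreal_le_iff zero_le_numeral)
qed

lemma level_sum_le:
  assumes T: "test T" and n: "0 < n" and s: "s \<le> last_index n" and S: "block n s = {a..<b}" "a < b"
    and lev: "\<And>k t. k \<le> n \<Longrightarrow> ereal (real (lev n a k t)) \<le> max 0 (T n (real a / real n) k)"
  shows "(\<Sum>i<b - a. 2 ^ lev n a (a + i) t) \<le> (2::nat) ^ (clog (b - a) + 10)"
proof -
  let ?p = "real a / real n"
  let ?m = "real (card (block n s))"
  have sub: "{a..<b} \<subseteq> {..n}" using S by (auto simp: block_def)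
  have a: "a \<in> block n s" using S by simp
  have p: "?p \<in> {0..1}" using sub S(2) n by auto
  have "(\<Sum>k\<in>{a..<b}. 2 ^ lev n a k t) \<le> (\<Sum>k\<in>{a..<b}. 2 ^ 9 * ?m * bin n ?p k * 2 ^ lev n a k t)"
  proof (rule sum_mono)
    fix k assume "k \<in> {a..<b}"
    then have "k \<in> block n s" using S by simp
    from bin_block_ge[OF n s a this]
    show "(2::real) ^ lev n a k t \<le> 2 ^ 9 * ?m * bin n ?p k * 2 ^ lev n a k t"
      using mult_right_mono[of 1 "2 ^ 9 * ?m * bin n ?p k" "2 ^ lev n a k t"] by simp
  qed
  also have "\<dots> = 2 ^ 9 * ?m * (\<Sum>k\<in>{a..<b}. bin n ?p k * 2 ^ lev n a k t)"
    by (simp add: sum_distrib_left mult.assoc)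
  also have "\<dots> \<le> 2 ^ 9 * ?m * (\<Sum>k\<le>n. bin n ?p k * 2 ^ lev n a k t)"
    using sub by (intro mult_left_mono sum_mono2) (auto intro!: mult_nonneg_nonneg bin_nonneg[OF p])
  also have "\<dots> \<le> 2 ^ 9 * ?m * 2"
    using level_mass[OF T n p lev] by (intro mult_left_mono) auto
  also have "\<dots> = real (2 ^ 10 * (b - a))" using S by (simp add: of_nat_diff)
  also have "\<dots> \<le> real (2 ^ (clog (b - a) + 10))"
    using le_two_power_clog[of "b - a"] by (simp only: of_nat_le_iff power_add mult.commute[of "2 ^ 10"] mult_le_mono1)
  finally have "real (\<Sum>k\<in>{a..<b}. 2 ^ lev n a k t) \<le> real (2 ^ (clog (b - a) + 10))" by simp
  then have "(\<Sum>k\<in>{a..<b}. 2 ^ lev n a k t) \<le> (2::nat) ^ (clog (b - a) + 10)" by (simp only: of_nat_le_iff)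
  moreover have "(\<Sum>i<b - a. 2 ^ lev n a (a + i) t) = (\<Sum>k\<in>{a..<b}. (2::nat) ^ lev n a k t)"
    by (rule sum.reindex_bij_witness[of _ "\<lambda>k. k - a" "\<lambda>i. a + i"]) auto
  ultimately show ?thesis by simp
qed

text \<open>
  The levels of a point are bounded, because its share has to fit into the budget. The last level
  \<open>d\<close> is therefore attained, and the request made when it first appears is served by a string of
  length \<open>budget - d + 1\<close>.
\<close>

lemma level_method_complexity:
  assumes T: "test T" and n: "0 < n" and s: "s \<le> last_index n" and S: "block n s = {a..<b}" and k: "k \<in> {a..<b}"
    and mono: "\<And>k. k \<le> n \<Longrightarrow> mono (lev n a k)"
    and sup: "\<And>k. k \<le> n \<Longrightarrow> (SUP t. ereal (real (lev n a k t))) = max 0 (T n (real a / real n) k)"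
  shows "\<exists>d \<le> budget (b - a). T n (real a / real n) k \<le> ereal (real d) \<and>
    complexity (level_method lev) (Num k) (condition n {a..<b}) \<le> enat (Suc (budget (b - a) - d))"
proof -
  have ab: "a < b" using k by simp
  have sub: "{a..<b} \<subseteq> {..n}" using S by (auto simp: block_def)
  moreover have "b - 1 \<in> {a..<b}" using ab by auto
  ultimately have "b - 1 \<le> n" by blast
  then have bn: "b \<le> Suc n" by simp
  have kn: "k \<le> n" using k bn by simp
  have lev: "ereal (real (lev n a k t)) \<le> max 0 (T n (real a / real n) k)" if "k \<le> n" for k t
    unfolding sup[OF that, symmetric] by (rule SUP_upper) simp
  have sum: "(\<Sum>i<b - a. 2 ^ lev n a (a + i) t) \<le> (2::nat) ^ (clog (b - a) + 10)" for t
    using T n s S ab lev by (rule level_sum_le)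
  have bound: "lev n a k t \<le> budget (b - a)" for t
  proof -
    have "(2::nat) ^ lev n a (a + (k - a)) t \<le> (\<Sum>i<b - a. 2 ^ lev n a (a + i) t)"
      using k by (intro member_le_sum) auto
    also note sum
    finally have "lev n a k t \<le> clog (b - a) + 10" using k by simp
    then show ?thesis by (simp add: budget_def)
  qed
  define d where "d = Max (range (lev n a k))"
  have fin: "finite (range (lev n a k))" by (rule finite_subset[of _ "{..budget (b - a)}"]) (use bound in auto)
  have d: "\<exists>t. lev n a k t = d" using Max_in[OF fin] unfolding d_def by auto
  have le_d: "lev n a k t \<le> d" for t unfolding d_def using fin by (intro Max_ge) auto
  have "T n (real a / real n) k \<le> max 0 (T n (real a / real n) k)" by simp
  also have "\<dots> \<le> ereal (real d)"
    unfolding sup[OF kn, symmetric] using le_d by (intro SUP_least) simp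
  finally have Td: "T n (real a / real n) k \<le> ereal (real d)" .
  have dE: "d \<le> budget (b - a)" using d bound by metis
  \<comment> \<open>the first time at which the level \<open>d\<close> is reached, since requests are made only at changes\<close>
  define t where "t = (LEAST t. lev n a k t = d)"
  have t: "lev n a k t = d" unfolding t_def by (rule LeastI_ex[OF d])
  have first: "t = 0 \<or> lev n a k t \<noteq> lev n a k (t - 1)"
  proof (cases t)
    case (Suc u)
    then have "lev n a k u \<noteq> d" using not_less_Least[of u "\<lambda>t. lev n a k t = d"] unfolding t_def by simp
    then show ?thesis using t Suc by simp
  qed simp
  define j where "j = prod_encode (t, k - a)"
  let ?E = "budget (b - a)"
  have req: "request lev n a b j = 2 ^ (?E - (?E - d))"
    using first k t dE by (auto simp: request_def j_def)
  have mono': "mono (lev n a (a + i))" if "i < b - a" for i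
    using that bn by (intro mono) simp
  have "(\<Sum>i<j. request lev n a b i) + request lev n a b j = (\<Sum>i<Suc j. request lev n a b i)" by simp
  also have "\<dots> \<le> 2 * (\<Sum>i<b - a. 2 ^ lev n a (a + i) (Suc j))" using mono' by (rule sum_requests_le)
  also have "\<dots> \<le> 2 * 2 ^ (clog (b - a) + 10)" using sum by (intro mult_le_mono2)
  also have "\<dots> = 2 ^ ?E" by (simp add: budget_def power_add)
  finally have room: "(\<Sum>i<j. request lev n a b i) + 2 ^ (?E - (?E - d)) \<le> 2 ^ ?E" unfolding req .
  obtain v where v: "v < 2 ^ Suc (?E - d)" "fits ?E (\<Sum>i<j. request lev n a b i) (2 ^ (?E - (?E - d))) (Suc (?E - d)) v"
    using fits_exists[OF diff_le_self room] by blast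
  define q where "q = bits_of (Suc (?E - d)) v"
  have q: "length q = Suc (?E - d)" "bitval q = v" unfolding q_def length_bits_of bitval_bits_of using v(1) by simp_all
  have "served lev n a b j (length q) (bitval q)"
    unfolding served_def req q using n ab bn k v(2) by (auto simp: j_def)
  then have "method_relation lev q (condition n {a..<b}) (Num (a + psnd j))"
    unfolding method_relation_def by blast
  moreover have "a + psnd j = k" using k by (simp add: j_def)
  ultimately have "level_method lev q (condition n {a..<b}) = Some (Num k)"
    unfolding level_method_Some by simp
  then have "complexity (level_method lev) (Num k) (condition n {a..<b}) \<le> enat (length q)"
    unfolding complexity_def by (intro INF_lower) simp
  with Td dE show ?thesis unfolding q by blast
qed

text \<open>
  The infimum is estimated by its value at the least point of the cell. Finiteness of the
  complexity comes with the estimate.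
\<close>

lemma deficiency_upper_bound:
  assumes A: "optimal_prefix_method A" and D: "universal_test D"
  shows "\<exists>C::real. \<forall>n>0. \<forall>k\<le>n. \<exists>m. complexity A (Num k) (condition n (cell n k)) = enat m \<and>
    binom_deficiency D n k \<le> ereal (log 2 (real (card (cell n k))) - real m + C)"
proof -
  have T: "test D" using D by (simp add: universal_test_def)
  then have "lower_semicomputable D" by (simp add: test_def)
  from rational_levels_computable[OF this] obtain lev where
    c: "levels_computable lev" and
    lev: "\<And>n c k. 0 < n \<Longrightarrow> c \<le> n \<Longrightarrow> k \<le> n \<Longrightarrow> mono (lev n c k) \<and>
       (SUP t. ereal (real (lev n c k t))) = max 0 (D n (real c / real n) k)"
    unfolding levels_computable_def by blast
  obtain C :: nat where C: "\<And>x y. complexity A x y \<le> complexity (level_method lev) x y + enat C"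
    using A prefix_level_method[OF c] unfolding optimal_prefix_method_def by blast
  have "\<exists>m. complexity A (Num k) (condition n (cell n k)) = enat m \<and>
    binom_deficiency D n k \<le> ereal (log 2 (real (card (cell n k))) - real m + (real C + 13))"
    if n: "0 < n" and k: "k \<le> n" for n k
  proof -
    from cell(1)[OF n k] have "cell n k \<in> block n ` {0..last_index n}" unfolding blocks_def by blast
    then obtain s where s: "s \<le> last_index n" "cell n k = block n s" by (elim imageE) simp
    have ks: "k \<in> block n s" using cell(2)[OF n k] s by simp
    obtain a b where ab: "block n s = {a..<b}"
      using block_candidate[OF n s(1)] ks by blast
    have k': "k \<in> {a..<b}" using ks ab by simp
    then have "a \<in> block n s" using ab by auto
    then have a: "a \<le> n" by (simp add: block_def)
    obtain d where d: "d \<le> budget (b - a)" "D n (real a / real n) k \<le> ereal (real d)"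
        "complexity (level_method lev) (Num k) (condition n {a..<b}) \<le> enat (Suc (budget (b - a) - d))"
      using level_method_complexity[OF T n s(1) ab k'] lev[OF n a] by blast
    have "complexity A (Num k) (condition n {a..<b}) \<le> enat (Suc (budget (b - a) - d)) + enat C"
      using C d(3) by (meson add_right_mono order_trans)
    then obtain m where m: "complexity A (Num k) (condition n {a..<b}) = enat m" "m \<le> Suc (budget (b - a) - d) + C"
      by (cases "complexity A (Num k) (condition n {a..<b})") auto
    have "binom_deficiency D n k \<le> D n (real a / real n) k"
      unfolding binom_deficiency_def using a n by (intro INF_lower) auto
    also note d(2)
    also have "ereal (real d) \<le> ereal (log 2 (real (card {a..<b})) - real m + (real C + 13))"
    proof -
      have "real (clog (b - a)) \<le> log 2 (real (b - a)) + 1" using k' by (intro log_bounds_clog(2)) auto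
      moreover have "real m \<le> 1 + (real (clog (b - a)) + 11 - real d) + real C"
        using m(2) d(1) unfolding budget_def by linarith
      ultimately show ?thesis by simp
    qed
    finally show ?thesis using m(1) unfolding s(2) ab by blast
  qed
  then show ?thesis by blast
qed

theorem theorem2:
  fixes A :: "bool list \<Rightarrow> obj \<Rightarrow> obj option"
    and D :: "nat \<Rightarrow> real \<Rightarrow> nat \<Rightarrow> ereal"
  assumes "optimal_prefix_method A"
    and "universal_test D"
  shows "\<exists>C::real. \<forall>n>0. \<forall>k\<le>n.
    \<bar>binom_deficiency D n k -
      (ereal (log 2 (real (card (cell n k)))) -
       ereal_of_enat (complexity A (Num k) (pair_obj (Num n) (set_obj (cell n k)))))\<bar> \<le> ereal C"
proof -
  obtain C1 :: real where C1: "\<And>n k m. 0 < n \<Longrightarrow> k \<le> n \<Longrightarrow> complexity A (Num k) (condition n (cell n k)) = enat m \<Longrightarrow>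
      ereal (log 2 (real (card (cell n k))) - real m - C1) \<le> binom_deficiency D n k"
    using deficiency_lower_bound[OF assms] by blast
  obtain C2 :: real where C2: "\<And>n k. 0 < n \<Longrightarrow> k \<le> n \<Longrightarrow> \<exists>m. complexity A (Num k) (condition n (cell n k)) = enat m \<and>
      binom_deficiency D n k \<le> ereal (log 2 (real (card (cell n k))) - real m + C2)"
    using deficiency_upper_bound[OF assms] by blast
  have "\<bar>binom_deficiency D n k - (ereal (log 2 (real (card (cell n k)))) -
       ereal_of_enat (complexity A (Num k) (pair_obj (Num n) (set_obj (cell n k)))))\<bar> \<le> ereal (max C1 C2)"
    if n: "0 < n" and k: "k \<le> n" for n k
  proof -
    obtain m where m: "complexity A (Num k) (condition n (cell n k)) = enat m"
      and up: "binom_deficiency D n k \<le> ereal (log 2 (real (card (cell n k))) - real m + C2)"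
      using C2[OF n k] by blast
    note low = C1[OF n k m]
    obtain r where r: "binom_deficiency D n k = ereal r"
      using up low by (cases "binom_deficiency D n k") auto
    have "\<bar>r - (log 2 (real (card (cell n k))) - real m)\<bar> \<le> max C1 C2"
      using up low unfolding r by (simp add: abs_le_iff max_def)
    then show ?thesis unfolding m[unfolded condition_def] r by (simp del: ereal_max)
  qed
  then show ?thesis by blast
qed

end
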